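(* Let $\Gamma$ be a finite connected graph with a good orientation and let $n\geq 2$ be an integer. Then there exist a smooth closed connected $n$-manifold $M$ and a Morse function $f\colon M\to\mathbb{R}$ such that the Reeb graph $\mathcal{R}(f)$ is isomorphic, as an oriented graph, to $\Gamma$.
   Context: All manifolds are compact, smooth, connected, of dimension at least $2$; a closed manifold is one without boundary. All graphs are finite and connected (multiple edges allowed), regarded as one-dimensional finite CW-complexes with a fixed combinatorial structure. Reeb graph. Let $f\colon M\to\mathbb{R}$ be a smooth function with finitely many critical points on a closed manifold $M$. Two points of $M$ are in Reeb relation if they lie in the same connected component of a level set of $f$. The quotient space $\mathcal{R}(f)$, with quotient map $q\colon M\to\mathcal{R}(f)$, is homeomorphic to a finite graph, called the Reeb graph; its vertices are the points corresponding to the connected components of level sets of $f$ that contain critical points, and its edges are the closures of the components of the complement of the vertices. The function $f$ induces a continuous $\overline{f}\colon\mathcal{R}(f)\to\mathbb{R}$ with $f=\overline{f}\circ q$, and each edge is oriented in the direction of increasing $\overline{f}$. Good orientation. The orientation of a graph $\Gamma$ induced by a continuous function $g\colon\Gamma\to\mathbb{R}$ that is strictly monotonic on each edge is the one in which each edge is directed towards increasing $g$. It is a good orientation if it is induced by such a $g$ all of whose local extrema are attained at vertices of degree one. A Morse function is a smooth function all of whose critical points are non-degenerate (several critical points may lie on the same level). *)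

theory Defs
  imports "Graph_Theory.Graph_Theory" "HOL-Analysis.Analysis"
begin

section \<open>Smooth manifolds\<close>

text \<open>Both notions are meant for open sets \<open>S\<close>. Iterated directional derivatives in all
  directions give the usual \<open>C\<^sup>k\<close> notion because the domain is finite-dimensional.\<close>

primrec Ck_on ::
    "nat \<Rightarrow> 'a::euclidean_space set \<Rightarrow> ('a \<Rightarrow> 'b::real_normed_vector) \<Rightarrow> bool" where
  "Ck_on 0 S f \<longleftrightarrow> continuous_on S f"
| "Ck_on (Suc k) S f \<longleftrightarrow>
     f differentiable_on S \<and> (\<forall>v. Ck_on k S (\<lambda>x. frechet_derivative f (at x) v))"

definition smooth_on ::
    "'a::euclidean_space set \<Rightarrow> ('a \<Rightarrow> 'b::real_normed_vector) \<Rightarrow> bool" where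
  "smooth_on S f \<longleftrightarrow> (\<forall>k. Ck_on k S f)"

type_synonym ('a, 'n) chart = "'a set \<times> ('a \<Rightarrow> real ^ 'n)"

text \<open>The image of a chart is open in the whole space \<open>real ^ 'n\<close>, so there is no boundary.
  The values of a chart outside its domain \<open>U\<close> are irrelevant.\<close>

definition is_chart :: "'a topology \<Rightarrow> 'a set \<Rightarrow> ('a \<Rightarrow> real ^ 'n) \<Rightarrow> bool" where
  "is_chart X U \<phi> \<longleftrightarrow> openin X U \<and> open (\<phi> ` U) \<and>
     homeomorphic_map (subtopology X U) (top_of_set (\<phi> ` U)) \<phi>"

definition smooth_atlas :: "'a topology \<Rightarrow> ('a, 'n::finite) chart set \<Rightarrow> bool" where
  "smooth_atlas X A \<longleftrightarrow>
     (\<forall>(U, \<phi>) \<in> A. is_chart X U \<phi>) \<and>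
     (\<Union>(U, \<phi>) \<in> A. U) = topspace X \<and>
     (\<forall>(U, \<phi>) \<in> A. \<forall>(V, \<psi>) \<in> A. smooth_on (\<phi> ` (U \<inter> V)) (\<psi> \<circ> inv_into U \<phi>))"

text \<open>Smooth, closed (compact without boundary), connected manifolds of dimension
  \<open>CARD('n)\<close>. The empty space counts as connected in the library and is excluded here.
  The atlas need not be maximal.\<close>

definition closed_connected_manifold :: "'a topology \<Rightarrow> ('a, 'n::finite) chart set \<Rightarrow> bool" where
  "closed_connected_manifold X A \<longleftrightarrow>
     Hausdorff_space X \<and> second_countable X \<and> compact_space X \<and>
     connected_space X \<and> topspace X \<noteq> {} \<and> smooth_atlas X A"


section \<open>Morse functions\<close>

definition smooth_function :: "('a, 'n::finite) chart set \<Rightarrow> ('a \<Rightarrow> real) \<Rightarrow> bool" where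
  "smooth_function A f \<longleftrightarrow> (\<forall>(U, \<phi>) \<in> A. smooth_on (\<phi> ` U) (f \<circ> inv_into U \<phi>))"

definition hessian :: "(real ^ 'n \<Rightarrow> real) \<Rightarrow> real ^ 'n \<Rightarrow> real ^ 'n ^ 'n" where
  "hessian F x = (\<chi> i j.
     frechet_derivative (\<lambda>y. frechet_derivative F (at y) (axis i 1)) (at x) (axis j 1))"

text \<open>For a smooth function, the conditions on \<open>p\<close> below do not depend on the chart around
  \<open>p\<close> (for the second one because \<open>p\<close> is critical).\<close>

definition critical_point ::
    "('a, 'n::finite) chart set \<Rightarrow> ('a \<Rightarrow> real) \<Rightarrow> 'a \<Rightarrow> bool" where
  "critical_point A f p \<longleftrightarrow>
     (\<exists>(U, \<phi>) \<in> A. p \<in> U \<and> ((f \<circ> inv_into U \<phi>) has_derivative (\<lambda>_. 0)) (at (\<phi> p)))"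

definition nondegenerate_critical_point ::
    "('a, 'n::finite) chart set \<Rightarrow> ('a \<Rightarrow> real) \<Rightarrow> 'a \<Rightarrow> bool" where
  "nondegenerate_critical_point A f p \<longleftrightarrow>
     (\<exists>(U, \<phi>) \<in> A. p \<in> U \<and> ((f \<circ> inv_into U \<phi>) has_derivative (\<lambda>_. 0)) (at (\<phi> p)) \<and>
        invertible (hessian (f \<circ> inv_into U \<phi>) (\<phi> p)))"

definition morse_function :: "('a, 'n::finite) chart set \<Rightarrow> ('a \<Rightarrow> real) \<Rightarrow> bool" where
  "morse_function A f \<longleftrightarrow> smooth_function A f \<and>
     (\<forall>p. critical_point A f p \<longrightarrow> nondegenerate_critical_point A f p)"


section \<open>Reeb graphs\<close>

definition quotient_topology :: "'a topology \<Rightarrow> ('a \<Rightarrow> 'b) \<Rightarrow> 'b topology" where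
  "quotient_topology X q =
     topology (\<lambda>U. U \<subseteq> q ` topspace X \<and> openin X {x \<in> topspace X. q x \<in> U})"

lemma istopology_coinduced:
  "istopology (\<lambda>U. U \<subseteq> P \<and> (\<forall>i\<in>I. openin (Y i) {t \<in> topspace (Y i). h i t \<in> U}))"
proof -
  have 1: "openin Z {t \<in> topspace Z. k t \<in> S \<inter> T}"
    if "openin Z {t \<in> topspace Z. k t \<in> S}" "openin Z {t \<in> topspace Z. k t \<in> T}"
    for Z :: "'c topology" and k :: "'c \<Rightarrow> 'a" and S T
  proof -
    have "{t \<in> topspace Z. k t \<in> S \<inter> T} =
        {t \<in> topspace Z. k t \<in> S} \<inter> {t \<in> topspace Z. k t \<in> T}" by blast
    then show ?thesis using openin_Int[OF that] by (simp only:)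
  qed
  have 2: "openin Z {t \<in> topspace Z. k t \<in> \<Union>K}"
    if "\<forall>S\<in>K. openin Z {t \<in> topspace Z. k t \<in> S}"
    for Z :: "'c topology" and k :: "'c \<Rightarrow> 'a" and K
  proof -
    have "{t \<in> topspace Z. k t \<in> \<Union>K} = \<Union>((\<lambda>S. {t \<in> topspace Z. k t \<in> S}) ` K)" by blast
    moreover have "openin Z (\<Union>((\<lambda>S. {t \<in> topspace Z. k t \<in> S}) ` K))"
      by (rule openin_Union) (use that in blast)
    ultimately show ?thesis by (simp only:)
  qed
  show ?thesis (is "istopology ?L")
    unfolding istopology_def
  proof (rule conjI; intro allI impI)
    fix S T assume "?L S" "?L T"
    then show "?L (S \<inter> T)" using 1[of "Y _" "h _" S T] by (meson Int_lower1 subset_trans)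
  next
    fix K assume K: "\<forall>S\<in>K. ?L S"
    show "?L (\<Union>K)"
    proof (rule conjI)
      show "\<Union>K \<subseteq> P" using K by (meson Union_least)
      show "\<forall>i\<in>I. openin (Y i) {t \<in> topspace (Y i). h i t \<in> \<Union>K}"
        by (rule ballI, rule 2) (use K in blast)
    qed
  qed
qed

lemma openin_quotient_topology:
  "openin (quotient_topology X q) U \<longleftrightarrow>
     U \<subseteq> q ` topspace X \<and> openin X {x \<in> topspace X. q x \<in> U}"
  using istopology_coinduced[of "q ` topspace X" "{()}" "\<lambda>_. X" "\<lambda>_. q"]
  by (simp add: quotient_topology_def)

lemma topspace_quotient_topology [simp]:
  "topspace (quotient_topology X q) = q ` topspace X"
proof
  show "topspace (quotient_topology X q) \<subseteq> q ` topspace X"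
    using openin_topspace[of "quotient_topology X q"]
    unfolding openin_quotient_topology by (rule conjunct1)
  have "{x \<in> topspace X. q x \<in> q ` topspace X} = topspace X" by auto
  then have "openin (quotient_topology X q) (q ` topspace X)"
    by (simp add: openin_quotient_topology)
  then show "q ` topspace X \<subseteq> topspace (quotient_topology X q)" by (rule openin_subset)
qed

lemma quotient_map_quotient_topology: "quotient_map X (quotient_topology X q) q"
  by (auto simp: quotient_map_def openin_quotient_topology)

definition reeb_relation :: "'a topology \<Rightarrow> ('a \<Rightarrow> real) \<Rightarrow> ('a \<times> 'a) set" where
  "reeb_relation X f = {(x, y). x \<in> topspace X \<and>
     connected_component_of (subtopology X {z \<in> topspace X. f z = f x}) x y}"

definition reeb_proj :: "'a topology \<Rightarrow> ('a \<Rightarrow> real) \<Rightarrow> 'a \<Rightarrow> 'a set" where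
  "reeb_proj X f x = reeb_relation X f `` {x}"

definition reeb_space :: "'a topology \<Rightarrow> ('a \<Rightarrow> real) \<Rightarrow> 'a set topology" where
  "reeb_space X f = quotient_topology X (reeb_proj X f)"

text \<open>The function on the Reeb space induced by \<open>f\<close>, which is constant on each class.\<close>

definition reeb_fun :: "('a \<Rightarrow> real) \<Rightarrow> 'a set \<Rightarrow> real" where
  "reeb_fun f C = the_elem (f ` C)"

definition reeb_verts ::
    "'a topology \<Rightarrow> ('a, 'n::finite) chart set \<Rightarrow> ('a \<Rightarrow> real) \<Rightarrow> 'a set set" where
  "reeb_verts X A f = {C \<in> topspace (reeb_space X f). \<exists>p\<in>C. critical_point A f p}"

definition reeb_arcs ::
    "'a topology \<Rightarrow> ('a, 'n::finite) chart set \<Rightarrow> ('a \<Rightarrow> real) \<Rightarrow> 'a set set set" where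
  "reeb_arcs X A f =
     (\<lambda>K. reeb_space X f closure_of K) ` connected_components_of
       (subtopology (reeb_space X f) (topspace (reeb_space X f) - reeb_verts X A f))"

text \<open>Arcs are directed towards increasing \<^term>\<open>reeb_fun f\<close>: the tail of an arc is its
  lowest point and its head is its highest point.\<close>

definition reeb_graph ::
    "'a topology \<Rightarrow> ('a, 'n::finite) chart set \<Rightarrow> ('a \<Rightarrow> real)
      \<Rightarrow> ('a set, 'a set set) pre_digraph" where
  "reeb_graph X A f =
     \<lparr>verts = reeb_verts X A f,
      arcs = reeb_arcs X A f,
      tail = (\<lambda>e. THE v. v \<in> reeb_verts X A f \<and> v \<in> e \<and> (\<forall>x\<in>e. reeb_fun f v \<le> reeb_fun f x)),
      head = (\<lambda>e. THE v. v \<in> reeb_verts X A f \<and> v \<in> e \<and> (\<forall>x\<in>e. reeb_fun f x \<le> reeb_fun f v))\<rparr>"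


section \<open>Good orientations\<close>

text \<open>The CW complex of a multigraph: points are the vertices \<open>Inl v\<close> and the points
  \<open>Inr (e, t)\<close> with \<open>0 < t < 1\<close> of the open edges. \<open>edge_point G e\<close> on \<open>[0,1]\<close> is the
  characteristic map of the edge \<open>e\<close>, running from its tail to its head, and the topology is
  the weak one.\<close>

definition edge_point :: "('v, 'e) pre_digraph \<Rightarrow> 'e \<Rightarrow> real \<Rightarrow> 'v + 'e \<times> real" where
  "edge_point G e t =
     (if t = 0 then Inl (tail G e) else if t = 1 then Inl (head G e) else Inr (e, t))"

definition realization_points :: "('v, 'e) pre_digraph \<Rightarrow> ('v + 'e \<times> real) set" where
  "realization_points G = Inl ` verts G \<union> Inr ` (arcs G \<times> {0<..<1})"

definition realization :: "('v, 'e) pre_digraph \<Rightarrow> ('v + 'e \<times> real) topology" where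
  "realization G = topology (\<lambda>U. U \<subseteq> realization_points G \<and>
     (\<forall>e\<in>arcs G. openin (top_of_set {0..1}) {t \<in> {0..1}. edge_point G e t \<in> U}))"

lemma openin_realization:
  "openin (realization G) U \<longleftrightarrow> U \<subseteq> realization_points G \<and>
     (\<forall>e\<in>arcs G. openin (top_of_set {0..1}) {t \<in> {0..1}. edge_point G e t \<in> U})"
  using istopology_coinduced[of "realization_points G" "arcs G" "\<lambda>_. top_of_set {0..1}" "edge_point G"]
  by (simp only: realization_def topspace_euclidean_subtopology topology_inverse')

lemma (in wf_digraph) topspace_realization [simp]:
  "topspace (realization G) = realization_points G"
proof
  show "topspace (realization G) \<subseteq> realization_points G"
    using openin_topspace[of "realization G"] unfolding openin_realization by (rule conjunct1)
  have "{t \<in> {0..1}. edge_point G e t \<in> realization_points G} = {0..1}" if "e \<in> arcs G" for e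
    using that by (auto simp: edge_point_def realization_points_def)
  then have "openin (realization G) (realization_points G)"
    by (simp add: openin_realization)
  then show "realization_points G \<subseteq> topspace (realization G)" by (rule openin_subset)
qed

definition local_extremum :: "'a topology \<Rightarrow> ('a \<Rightarrow> real) \<Rightarrow> 'a \<Rightarrow> bool" where
  "local_extremum X g x \<longleftrightarrow> x \<in> topspace X \<and>
     (\<exists>U. openin X U \<and> x \<in> U \<and> ((\<forall>y\<in>U. g x \<le> g y) \<or> (\<forall>y\<in>U. g y \<le> g x)))"

text \<open>The orientation given by tails and heads is the one induced by \<open>g\<close>: along each edge,
  \<open>g\<close> is strictly monotonic and increases from the tail to the head.\<close>

definition induces_orientation ::
    "('v + 'e \<times> real \<Rightarrow> real) \<Rightarrow> ('v, 'e) pre_digraph \<Rightarrow> bool" where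
  "induces_orientation g G \<longleftrightarrow>
     continuous_map (realization G) euclideanreal g \<and>
     (\<forall>e\<in>arcs G. strict_mono_on {0..1} (\<lambda>t. g (edge_point G e t)))"

definition good_orientation :: "('v, 'e) pre_digraph \<Rightarrow> bool" where
  "good_orientation G \<longleftrightarrow>
     (\<exists>g. induces_orientation g G \<and>
        (\<forall>x. local_extremum (realization G) g x \<longrightarrow>
           (\<exists>v\<in>verts G. x = Inl v \<and> in_degree G v + out_degree G v = 1)))"

end

theory Submission
  imports Defs
begin

text \<open>
  Let \<open>g\<close> be the heights of the vertices. A vertex is either a cap (of degree one) or interior, with
  \<open>k > 0\<close> incoming and \<open>l > 0\<close> outgoing edges. Over an edge the manifold is \<open>S\<^bsup>n-1\<^esup>\<close> times an open
  interval and \<open>f\<close> is the height; a cap closes it with a ball, on which \<open>f\<close> is \<open>g v\<close> plus or minus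
  \<open>|z|\<^sup>2\<close>. Near an interior vertex the manifold is the part of small height of
  the set of \<open>(\<theta>, s, Y)\<close>, with \<open>\<theta>\<close> in the circle \<open>\<real> / \<int>\<close> and \<open>Y\<close> in \<open>\<real>\<^bsup>n-1\<^esup>\<close>, such that
  \<open>|Y|\<^sup>2 = (\<phi>\<^sub>+(\<theta>) - s) (\<phi>\<^sub>-(\<theta>) + s)\<close>
  with both factors nonnegative, where \<open>\<phi>\<^sub>+ = sin\<^sup>2(\<pi> l \<theta>)\<close> and
  \<open>\<phi>\<^sub>- = sin\<^sup>2(\<pi> (k \<theta> + 1 / (2 l)))\<close> have \<open>l\<close> and \<open>k\<close> zeros and no common zero. For \<open>s > 0\<close> the
  circle is cut at the zeros of \<open>\<phi>\<^sub>+\<close>, so the level set consists of \<open>l\<close> spheres, and similarly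
  of \<open>k\<close> spheres for \<open>s < 0\<close>; for \<open>s = 0\<close> it is connected. In the charts \<open>(\<theta>, y)\<close> with
  \<open>y = Y / sqrt (\<phi>\<^sub>- + s)\<close> the height is \<open>s = \<phi>\<^sub>+(\<theta>) - |y|\<^sup>2\<close>, and symmetrically for \<open>\<phi>\<^sub>-\<close>, so
  the only critical points are saddles on the level \<open>s = 0\<close>. Since
  \<open>1 - s = cos\<^sup>2(\<pi> l \<theta>) + |y|\<^sup>2\<close>, the level sets over an arm are round spheres in the coordinates
  \<open>(cos (\<pi> l \<theta>), y)\<close>, which glues the arms to the edges.
\<close>

section \<open>Calculus of smooth functions\<close>

text \<open>For fixed \<theta> the model equation describes a round sphere in the coordinates (s,
  Y), of diameter \<open>\<phi>\<^sub>+ + \<phi>\<^sub>-\<close> and with poles at the heights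
  \<open>\<phi>\<^sub>+\<close> and \<open>- \<phi>\<^sub>-\<close>. So the model at an interior
  vertex is the slab |s| < \<delta> of a product of a circle and a sphere, and its two kinds of
  charts behave like the two stereographic projections, each omitting one pole. The absence of
  common zeros keeps the diameter positive. On the full product the height is also critical where
  \<open>\<phi>\<^sub>+\<close> or \<open>\<phi>\<^sub>-\<close> equals 1; the bound \<delta> \<le>
  1/2 cuts these points away. The obstacle is that any positive numbers of incoming and outgoing
  edges must meet in one connected critical level that carries only nondegenerate points; several
  saddles on the same level achieve this. A good orientation provides heights that increase along
  edges, and it guarantees that a vertex with edges on one side only has degree one, so that a ball
  can close it. The manifold is a set of explicit codes of points rather than a quotient:
  parametrizations are injective maps into codes, and the transition maps have closed
  formulas.\<close>

lemma Ck_on_cong: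
  assumes "open S" "\<And>x. x \<in> S \<Longrightarrow> f x = g x"
  shows "Ck_on k S f \<longleftrightarrow> Ck_on k S g"
  using assms(2)
proof (induction k arbitrary: f g)
  case 0
  then show ?case using continuous_on_cong[of S S f g] by auto
next
  case (Suc k)
  have hd: "(f has_derivative D) (at x) \<longleftrightarrow> (g has_derivative D) (at x)" if "x \<in> S" for x D
    using has_derivative_transform_within_open[OF _ \<open>open S\<close> that, of f D UNIV g]
      has_derivative_transform_within_open[OF _ \<open>open S\<close> that, of g D UNIV f] Suc.prems by metis
  have "f differentiable_on S \<longleftrightarrow> g differentiable_on S"
    using hd \<open>open S\<close> by (simp add: differentiable_on_def differentiable_def at_within_open_NO_MATCH)
  moreover have "Ck_on k S (\<lambda>x. frechet_derivative f (at x) v) \<longleftrightarrow>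
      Ck_on k S (\<lambda>x. frechet_derivative g (at x) v)" for v
    by (rule Suc.IH) (simp add: frechet_derivative_def hd)
  ultimately show ?case by simp
qed

lemma Ck_on_subset:
  assumes "Ck_on k S f" "T \<subseteq> S"
  shows "Ck_on k T f"
  using assms
  by (induction k arbitrary: f) (auto intro: continuous_on_subset differentiable_on_subset)

lemma Ck_on_imp_continuous_on: "Ck_on k S f \<Longrightarrow> continuous_on S f"
  by (cases k) (auto intro: differentiable_imp_continuous_on)

lemma Ck_on_Suc_imp: "Ck_on (Suc k) S f \<Longrightarrow> Ck_on k S f"
  by (induction k arbitrary: f) (auto intro: differentiable_imp_continuous_on)

text \<open>Replaces the opaque \<open>frechet_derivative\<close> by an explicit derivative
  \<open>D\<close> on an open set; the inductive steps for sums, products and compositions go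
  through it.\<close>

lemma Ck_on_SucI:
  assumes "open S" "\<And>x. x \<in> S \<Longrightarrow> (f has_derivative D x) (at x)"
    and "\<And>v. Ck_on k S (\<lambda>x. D x v)"
  shows "Ck_on (Suc k) S f"
proof -
  have "f differentiable_on S"
    using assms(1,2) by (auto simp: differentiable_on_def differentiable_def at_within_open_NO_MATCH)
  moreover have "Ck_on k S (\<lambda>x. frechet_derivative f (at x) v)" for v
    using assms(3)[of v] Ck_on_cong[OF \<open>open S\<close>, of "\<lambda>x. frechet_derivative f (at x) v" "\<lambda>x. D x v"]
    by (metis assms(2) frechet_derivative_at)
  ultimately show ?thesis by simp
qed

lemma Ck_on_SucD:
  assumes "open S" "Ck_on (Suc k) S f" "x \<in> S"
  shows "(f has_derivative frechet_derivative f (at x)) (at x)"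
  using assms by (simp add: differentiable_on_def at_within_open_NO_MATCH frechet_derivative_works[symmetric])

lemma Ck_on_const: "Ck_on k S (\<lambda>x. c)"
proof (induction k arbitrary: c)
  case (Suc k)
  show ?case using Suc[of 0] by (simp add: frechet_derivative_const)
qed simp

lemma Ck_on_bounded_linear:
  assumes "open S" "bounded_linear f"
  shows "Ck_on k S f"
proof (cases k)
  case 0
  then show ?thesis using assms by (simp add: linear_continuous_on)
next
  case (Suc m)
  show ?thesis unfolding Suc
    by (rule Ck_on_SucI[OF assms(1), where D="\<lambda>_. f"])
      (auto intro: Ck_on_const bounded_linear_imp_has_derivative[OF assms(2)])
qed

lemma Ck_on_add:
  assumes "open S" "Ck_on k S f" "Ck_on k S g"
  shows "Ck_on k S (\<lambda>x. f x + g x)"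
  using assms(2,3)
proof (induction k arbitrary: f g)
  case (Suc k)
  show ?case
    by (rule Ck_on_SucI[OF assms(1) has_derivative_add[OF Ck_on_SucD[OF assms(1) Suc.prems(1)]
            Ck_on_SucD[OF assms(1) Suc.prems(2)]]])
      (use Suc in auto)
qed (auto intro: continuous_intros)

lemma Ck_on_sum:
  assumes "open S" "finite I" "\<And>i. i \<in> I \<Longrightarrow> Ck_on k S (f i)"
  shows "Ck_on k S (\<lambda>x. \<Sum>i\<in>I. f i x)"
  using assms(2,3) by (induction I rule: finite_induct) (auto intro: Ck_on_const Ck_on_add[OF assms(1)])

lemma Ck_on_bilinear:
  assumes "open S" "bounded_bilinear h" "Ck_on k S f" "Ck_on k S g"
  shows "Ck_on k S (\<lambda>x. h (f x) (g x))"
  using assms(3,4)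
proof (induction k arbitrary: f g)
  case 0
  then show ?case by (auto intro: bounded_bilinear.continuous_on[OF assms(2)])
next
  case (Suc k)
  show ?case
    by (rule Ck_on_SucI[OF assms(1) bounded_bilinear.FDERIV[OF assms(2)
          Ck_on_SucD[OF assms(1) Suc.prems(1)] Ck_on_SucD[OF assms(1) Suc.prems(2)]]])
      (use Suc in \<open>auto intro!: Ck_on_add[OF assms(1)] Suc.IH Ck_on_Suc_imp[of k S f] Ck_on_Suc_imp[of k S g]\<close>)
qed

text \<open>The derivative is \<open>g'(f x)\<close> applied to the direction
  \<open>f'(x) v\<close>, which moves with \<open>x\<close>, whereas the induction hypothesis covers
  \<open>g'\<close> in fixed directions. Expanding the direction along \<open>Basis\<close> gives a
  finite sum of scalar functions times derivatives of \<open>g\<close> in fixed directions.\<close>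

lemma Ck_on_compose:
  fixes f :: "'a::euclidean_space \<Rightarrow> 'b::euclidean_space"
  assumes "open S" "open T" "Ck_on k T g" "Ck_on k S f" "f ` S \<subseteq> T"
  shows "Ck_on k S (\<lambda>x. g (f x))"
  using assms(3,4)
proof (induction k arbitrary: g)
  case 0
  then show ?case using assms(5) by (auto intro: continuous_on_compose2)
next
  case (Suc k)
  let ?D = "\<lambda>x v. \<Sum>b\<in>Basis. (frechet_derivative f (at x) v \<bullet> b) *\<^sub>R frechet_derivative g (at (f x)) b"
  show ?case
  proof (rule Ck_on_SucI[OF assms(1), where D = ?D])
    fix x assume x: "x \<in> S"
    have g': "(g has_derivative frechet_derivative g (at (f x))) (at (f x))"
      using Ck_on_SucD[OF assms(2) Suc.prems(1)] assms(5) x by blast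
    then have lin: "linear (frechet_derivative g (at (f x)))" by (rule has_derivative_linear)
    have "?D x v = frechet_derivative g (at (f x)) (frechet_derivative f (at x) v)" for v
      by (subst (3) euclidean_representation[symmetric])
        (simp add: linear_sum[OF lin] linear_cmul[OF lin])
    then show "((\<lambda>x. g (f x)) has_derivative ?D x) (at x)"
      using has_derivative_compose[OF Ck_on_SucD[OF assms(1) Suc.prems(2) x] g'] by simp
  next
    fix v
    have "Ck_on k S (\<lambda>x. (frechet_derivative f (at x) v \<bullet> b))" for b
      using Suc.prems(2) by (auto intro: Ck_on_bilinear[OF assms(1) bounded_bilinear_inner] Ck_on_const)
    moreover have "Ck_on k S (\<lambda>x. frechet_derivative g (at (f x)) b)" for b
      using Suc.IH[of "\<lambda>y. frechet_derivative g (at y) b"] Suc.prems Ck_on_Suc_imp by auto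
    ultimately show "Ck_on k S (\<lambda>x. ?D x v)"
      by (intro Ck_on_sum[OF assms(1)] Ck_on_bilinear[OF assms(1) bounded_bilinear_scaleR]) auto
  qed
qed

lemma smooth_on_cong:
  "open S \<Longrightarrow> (\<And>x. x \<in> S \<Longrightarrow> f x = g x) \<Longrightarrow> smooth_on S f \<longleftrightarrow> smooth_on S g"
  by (simp add: smooth_on_def Ck_on_cong[of S f g])

lemma smooth_on_subset: "smooth_on S f \<Longrightarrow> T \<subseteq> S \<Longrightarrow> smooth_on T f"
  by (auto simp: smooth_on_def intro: Ck_on_subset)

lemma smooth_on_imp_continuous_on: "smooth_on S f \<Longrightarrow> continuous_on S f"
  by (auto simp: smooth_on_def intro: Ck_on_imp_continuous_on)

lemma smooth_on_const: "smooth_on S (\<lambda>x. c)"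
  by (simp add: smooth_on_def Ck_on_const)

lemma smooth_on_bounded_linear: "open S \<Longrightarrow> bounded_linear f \<Longrightarrow> smooth_on S f"
  by (simp add: smooth_on_def Ck_on_bounded_linear)

lemma smooth_on_id: "open S \<Longrightarrow> smooth_on S (\<lambda>x. x)"
  by (rule smooth_on_bounded_linear[OF _ bounded_linear_ident])

lemma smooth_on_add:
  "open S \<Longrightarrow> smooth_on S f \<Longrightarrow> smooth_on S g \<Longrightarrow> smooth_on S (\<lambda>x. f x + g x)"
  by (simp add: smooth_on_def Ck_on_add)

lemma smooth_on_compose:
  fixes f :: "'a::euclidean_space \<Rightarrow> 'b::euclidean_space"
  assumes "open S" "open T" "smooth_on T g" "smooth_on S f" "f ` S \<subseteq> T"
  shows "smooth_on S (\<lambda>x. g (f x))"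
  using assms by (auto simp: smooth_on_def intro: Ck_on_compose)

lemma smooth_on_scaleR:
  "open S \<Longrightarrow> smooth_on S f \<Longrightarrow> smooth_on S g \<Longrightarrow> smooth_on S (\<lambda>x. f x *\<^sub>R g x)"
  by (simp add: smooth_on_def Ck_on_bilinear[OF _ bounded_bilinear_scaleR])

lemma smooth_on_mult:
  fixes f g :: "'a::euclidean_space \<Rightarrow> real"
  shows "open S \<Longrightarrow> smooth_on S f \<Longrightarrow> smooth_on S g \<Longrightarrow> smooth_on S (\<lambda>x. f x * g x)"
  by (simp add: smooth_on_def Ck_on_bilinear[OF _ bounded_bilinear_mult])

lemma smooth_on_inner:
  fixes f g :: "'a::euclidean_space \<Rightarrow> 'b::euclidean_space"
  shows "open S \<Longrightarrow> smooth_on S f \<Longrightarrow> smooth_on S g \<Longrightarrow> smooth_on S (\<lambda>x. f x \<bullet> g x)"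
  by (simp add: smooth_on_def Ck_on_bilinear[OF _ bounded_bilinear_inner])

lemma smooth_on_minus:
  fixes f :: "'a::euclidean_space \<Rightarrow> 'b::real_normed_vector"
  assumes "open S" "smooth_on S f"
  shows "smooth_on S (\<lambda>x. - f x)"
  using smooth_on_scaleR[OF assms(1) smooth_on_const[of _ "-1"] assms(2)] by simp

lemma smooth_on_diff:
  fixes f g :: "'a::euclidean_space \<Rightarrow> 'b::real_normed_vector"
  assumes "open S" "smooth_on S f" "smooth_on S g"
  shows "smooth_on S (\<lambda>x. f x - g x)"
  using smooth_on_add[OF assms(1,2) smooth_on_minus[OF assms(1,3)]] by simp

section \<open>Smooth functions of one real variable\<close>

lemma Ck_on_Suc_real:
  fixes f :: "real \<Rightarrow> real"
  assumes "open S" "\<And>x. x \<in> S \<Longrightarrow> (f has_real_derivative f' x) (at x)" "Ck_on k S f'"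
  shows "Ck_on (Suc k) S f"
  by (rule Ck_on_SucI[OF assms(1), where D="\<lambda>x v. f' x * v"])
    (use assms in \<open>auto simp: has_field_derivative_def intro!: Ck_on_const
      Ck_on_bilinear[OF assms(1) bounded_bilinear_mult]\<close>)

lemma smooth_on_real:
  fixes f :: "real \<Rightarrow> real"
  assumes "open S" "\<And>x. x \<in> S \<Longrightarrow> (f has_real_derivative f' x) (at x)" "smooth_on S f'"
  shows "smooth_on S f"
  using Ck_on_Suc_imp[OF Ck_on_Suc_real[OF assms(1,2)]] assms(3) unfolding smooth_on_def by simp

text \<open>The derivative \<open>- (1/x)^2\<close> is a polynomial in the function itself, so order
  \<open>k\<close> yields order \<open>k + 1\<close>. The same bootstrapping works for
  \<open>sqrt\<close>, and for \<open>sin\<close> and \<open>cos\<close> once they are treated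
  together.\<close>

lemma smooth_on_inverse_real: "smooth_on (- {0}) (inverse :: real \<Rightarrow> real)"
  unfolding smooth_on_def
proof
  fix k show "Ck_on k (- {0}) (inverse :: real \<Rightarrow> real)"
  proof (induction k)
    case (Suc k)
    have "Ck_on k (- {0::real}) (\<lambda>x. (- 1) * (inverse x * inverse x))"
      by (intro Ck_on_bilinear[OF _ bounded_bilinear_mult] Suc Ck_on_const) auto
    then show ?case
      by (intro Ck_on_Suc_real[where f'="\<lambda>x. (- 1) * (inverse x * inverse x)"])
        (auto intro!: derivative_eq_intros)
  qed (auto intro!: continuous_intros)
qed

lemma smooth_on_sqrt_real: "smooth_on {0<..} sqrt"
  unfolding smooth_on_def
proof
  fix k show "Ck_on k {0<..} sqrt"
  proof (induction k)
    case (Suc k)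
    have "Ck_on k (- {0::real}) inverse"
      using smooth_on_inverse_real by (simp add: smooth_on_def)
    then have "Ck_on k {0<..} (\<lambda>x. inverse (sqrt x) * (1/2))"
      by (intro Ck_on_bilinear[OF _ bounded_bilinear_mult] Ck_on_const
          Ck_on_compose[OF _ _ _ Suc, of "- {0}" inverse]) auto
    then show ?case
      by (intro Ck_on_Suc_real[where f'="\<lambda>x. inverse (sqrt x) * (1/2)"])
        (auto intro!: DERIV_real_sqrt_generic)
  qed (auto intro!: continuous_intros)
qed

lemma Ck_on_sin_cos: "Ck_on k UNIV (sin :: real \<Rightarrow> real) \<and> Ck_on k UNIV (cos :: real \<Rightarrow> real)"
proof (induction k)
  case (Suc k)
  then have "Ck_on k UNIV (\<lambda>x::real. (-1) * sin x)"
    by (intro Ck_on_bilinear[OF _ bounded_bilinear_mult] Ck_on_const) auto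
  then show ?case
    using Suc Ck_on_Suc_real[OF open_UNIV DERIV_sin]
      Ck_on_Suc_real[of UNIV cos "\<lambda>x. (-1) * sin x" k] by (auto simp del: Ck_on.simps)
qed (auto intro!: continuous_intros)

lemma smooth_on_inverse:
  fixes f :: "'a::euclidean_space \<Rightarrow> real"
  assumes "open S" "smooth_on S f" "\<And>x. x \<in> S \<Longrightarrow> f x \<noteq> 0"
  shows "smooth_on S (\<lambda>x. inverse (f x))"
  by (rule smooth_on_compose[OF assms(1) _ smooth_on_inverse_real assms(2)]) (use assms(3) in auto)

lemma smooth_on_divide:
  fixes f g :: "'a::euclidean_space \<Rightarrow> real"
  assumes "open S" "smooth_on S f" "smooth_on S g" "\<And>x. x \<in> S \<Longrightarrow> g x \<noteq> 0"
  shows "smooth_on S (\<lambda>x. f x / g x)"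
  using smooth_on_mult[OF assms(1,2) smooth_on_inverse[OF assms(1,3,4)]]
  by (simp add: divide_inverse)

lemma smooth_on_sqrt:
  fixes f :: "'a::euclidean_space \<Rightarrow> real"
  assumes "open S" "smooth_on S f" "\<And>x. x \<in> S \<Longrightarrow> 0 < f x"
  shows "smooth_on S (\<lambda>x. sqrt (f x))"
  by (rule smooth_on_compose[OF assms(1) _ smooth_on_sqrt_real assms(2)]) (use assms(3) in auto)

lemma smooth_on_sin:
  assumes "open S" "smooth_on S f" shows "smooth_on S (\<lambda>x. sin (f x :: real))"
  by (rule smooth_on_compose[OF assms(1) open_UNIV _ assms(2)]) (simp_all add: smooth_on_def Ck_on_sin_cos)

lemma smooth_on_cos:
  assumes "open S" "smooth_on S f" shows "smooth_on S (\<lambda>x. cos (f x :: real))"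
  by (rule smooth_on_compose[OF assms(1) open_UNIV _ assms(2)]) (simp_all add: smooth_on_def Ck_on_sin_cos)

lemma smooth_on_arccos_real: "smooth_on {-1<..<1} arccos"
proof (rule smooth_on_real[where f'="\<lambda>x. inverse (- sqrt (1 - x * x))"])
  have sq: "0 < 1 - x * x" if "x \<in> {-1<..<1}" for x :: real
    using that abs_square_less_1[of x] by (simp add: power2_eq_square abs_less_iff)
  show "smooth_on {-1<..<1} (\<lambda>x::real. inverse (- sqrt (1 - x * x)))"
    by (intro smooth_on_inverse smooth_on_minus smooth_on_sqrt smooth_on_diff smooth_on_const
        smooth_on_mult smooth_on_id open_greaterThanLessThan) (use sq in force)+
  show "(arccos has_real_derivative inverse (- sqrt (1 - x * x))) (at x)"
    if "x \<in> {-1<..<1}" for x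
    using that DERIV_arccos[of x] by (simp add: power2_eq_square)
qed simp

lemma smooth_on_arccos:
  assumes "open S" "smooth_on S f" "\<And>x. x \<in> S \<Longrightarrow> \<bar>f x\<bar> < 1"
  shows "smooth_on S (\<lambda>x. arccos (f x :: real))"
  by (rule smooth_on_compose[OF assms(1) _ smooth_on_arccos_real assms(2)])
    (use assms(3) in \<open>force simp: abs_less_iff\<close>)+

lemma open_not_Ints: "open {x::real. x \<notin> \<int>}"
  using closed_Ints[where 'a=real] by (simp add: closed_def Compl_eq)

text \<open>Off the integers the floor is locally constant, so \<open>frac\<close> is locally a
  translation.\<close>

lemma frac_has_derivative:
  fixes x :: real assumes "x \<notin> \<int>"
  shows "(frac has_real_derivative 1) (at x)"
proof -
  have lin: "((\<lambda>y. y - of_int \<lfloor>x\<rfloor>) has_real_derivative 1) (at x)"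
    by (auto intro!: derivative_eq_intros)
  have x: "x \<in> {of_int \<lfloor>x\<rfloor> <..< of_int \<lfloor>x\<rfloor> + 1}"
  proof -
    have "of_int \<lfloor>x\<rfloor> \<noteq> x" using assms Ints_of_int[of "\<lfloor>x\<rfloor>"] by metis
    then have "of_int \<lfloor>x\<rfloor> < x" by (rule order.not_eq_order_implies_strict) (rule of_int_floor_le)
    then show ?thesis using real_of_int_floor_add_one_gt[of x] by simp
  qed
  show ?thesis
  proof (rule has_field_derivative_transform_within_open[OF lin open_greaterThanLessThan x])
    fix y :: real assume "y \<in> {of_int \<lfloor>x\<rfloor> <..< of_int \<lfloor>x\<rfloor> + 1}"
    then have "\<lfloor>y\<rfloor> = \<lfloor>x\<rfloor>" by (intro floor_unique) auto
    then show "y - of_int \<lfloor>x\<rfloor> = frac y" by (simp only: frac_def)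
  qed
qed

lemma smooth_on_frac:
  assumes "open S" "smooth_on S f" "\<And>x. x \<in> S \<Longrightarrow> f x \<notin> \<int>"
  shows "smooth_on S (\<lambda>x. frac (f x :: real))"
  by (rule smooth_on_compose[OF assms(1) open_not_Ints _ assms(2)])
    (use assms(3) smooth_on_real[OF open_not_Ints frac_has_derivative smooth_on_const] in auto)

lemmas smooth_on_intros = smooth_on_const smooth_on_id smooth_on_add smooth_on_diff smooth_on_minus
  smooth_on_scaleR smooth_on_mult smooth_on_inner smooth_on_divide smooth_on_inverse
  smooth_on_sqrt smooth_on_sin smooth_on_cos smooth_on_frac smooth_on_arccos

section \<open>Manifolds glued from parametrizations\<close>

text \<open>A certificate without inverse functions: an explicit smooth \<open>t\<close> rewrites
  parameters of chart \<open>i\<close> as parameters of chart \<open>j\<close>. The last clause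
  forces \<open>W\<close> to be the whole overlap, so that a formula valid on a part of it does not
  suffice.\<close>

definition smooth_transition ::
    "('i \<Rightarrow> 'a::euclidean_space set) \<Rightarrow> ('i \<Rightarrow> 'a \<Rightarrow> 'p) \<Rightarrow> 'i \<Rightarrow> 'i \<Rightarrow> bool" where
  "smooth_transition V \<psi> i j \<longleftrightarrow> (\<exists>W t. open W \<and> W \<subseteq> V i \<and> smooth_on W t \<and> t ` W \<subseteq> V j \<and>
     (\<forall>x\<in>W. \<psi> j (t x) = \<psi> i x) \<and> (\<forall>x\<in>V i. \<psi> i x \<in> \<psi> j ` V j \<longrightarrow> x \<in> W))"

lemma smooth_transitionI:
  assumes "open W" "W \<subseteq> V i" "smooth_on W t" "t ` W \<subseteq> V j" "\<And>x. x \<in> W \<Longrightarrow> \<psi> j (t x) = \<psi> i x"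
    and "\<And>x y. x \<in> V i \<Longrightarrow> y \<in> V j \<Longrightarrow> \<psi> i x = \<psi> j y \<Longrightarrow> x \<in> W"
  shows "smooth_transition V \<psi> i j"
  unfolding smooth_transition_def using assms by (intro exI[of _ W] exI[of _ t]) auto

lemma smooth_transition_refl: "open (V i) \<Longrightarrow> smooth_transition V \<psi> i i"
  by (rule smooth_transitionI[of "V i" _ _ "\<lambda>x. x"]) (auto intro: smooth_on_id)

lemma smooth_transition_disjoint:
  "\<psi> i ` V i \<inter> \<psi> j ` V j = {} \<Longrightarrow> smooth_transition V \<psi> i j"
  by (rule smooth_transitionI[of "{}" _ _ "\<lambda>x. 0"]) (auto intro: smooth_on_const)

text \<open>Chart \<open>k\<close> sees the whole overlap of \<open>i\<close> and \<open>j\<close>,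
  so the composite through \<open>k\<close> is defined on all of it. This keeps the number of
  explicit transition formulas small.\<close>

lemma smooth_transition_trans:
  assumes "smooth_transition V \<psi> i k" "smooth_transition V \<psi> k j"
    and "\<psi> i ` V i \<inter> \<psi> j ` V j \<subseteq> \<psi> k ` V k" and inj: "inj_on (\<psi> k) (V k)"
  shows "smooth_transition V \<psi> i j"
proof -
  obtain W t where W: "open W" "W \<subseteq> V i" "smooth_on W t" "t ` W \<subseteq> V k"
    "\<And>x. x \<in> W \<Longrightarrow> \<psi> k (t x) = \<psi> i x" "\<And>x. x \<in> V i \<Longrightarrow> \<psi> i x \<in> \<psi> k ` V k \<Longrightarrow> x \<in> W"
    using assms(1) unfolding smooth_transition_def by metis
  obtain W' t' where W': "open W'" "W' \<subseteq> V k" "smooth_on W' t'" "t' ` W' \<subseteq> V j"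
    "\<And>x. x \<in> W' \<Longrightarrow> \<psi> j (t' x) = \<psi> k x" "\<And>x. x \<in> V k \<Longrightarrow> \<psi> k x \<in> \<psi> j ` V j \<Longrightarrow> x \<in> W'"
    using assms(2) unfolding smooth_transition_def by metis
  show ?thesis
  proof (rule smooth_transitionI[of "W \<inter> t -` W'" _ _ "\<lambda>x. t' (t x)"])
    show op: "open (W \<inter> t -` W')"
      using W(1,3) W'(1) by (meson continuous_on_open_vimage smooth_on_imp_continuous_on continuous_open_preimage)
    show "smooth_on (W \<inter> t -` W') (\<lambda>x. t' (t x))"
      by (rule smooth_on_compose[OF op W'(1,3)]) (use W(3) in \<open>auto intro: smooth_on_subset\<close>)
    fix x y assume xy: "x \<in> V i" "y \<in> V j" "\<psi> i x = \<psi> j y"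
    then have x: "x \<in> W" using assms(3) W(6) by blast
    moreover have "\<psi> k (t x) \<in> \<psi> j ` V j" using W(5)[OF x] xy by auto
    ultimately show "x \<in> W \<inter> t -` W'" using W(4) W'(6) by auto
  qed (use W W' in auto)
qed

lemma frechet_derivative_cong:
  assumes "open S" "x \<in> S" "\<And>y. y \<in> S \<Longrightarrow> f y = g y"
  shows "frechet_derivative f (at x) = frechet_derivative g (at x)"
  unfolding frechet_derivative_def
  using has_derivative_transform_within_open[OF _ assms(1,2), of f _ UNIV g]
    has_derivative_transform_within_open[OF _ assms(1,2), of g _ UNIV f] assms(3) by metis

lemma hessian_cong:
  assumes "open S" "x \<in> S" "\<And>y. y \<in> S \<Longrightarrow> F y = G y"
  shows "hessian F x = hessian G x"
proof -
  have "frechet_derivative (\<lambda>y. frechet_derivative F (at y) v) (at x) =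
      frechet_derivative (\<lambda>y. frechet_derivative G (at y) v) (at x)" for v
    by (rule frechet_derivative_cong[OF assms(1,2)])
      (use frechet_derivative_cong[OF assms(1) _ assms(3)] in simp)
  then show ?thesis by (simp add: hessian_def)
qed

locale param_atlas =
  fixes I :: "'i set" and V :: "'i \<Rightarrow> (real ^ 'n::finite) set" and \<psi> :: "'i \<Rightarrow> real ^ 'n \<Rightarrow> 'p"
  assumes finite_I: "finite I"
    and open_V: "i \<in> I \<Longrightarrow> open (V i)"
    and inj_param: "i \<in> I \<Longrightarrow> inj_on (\<psi> i) (V i)"
    and transition: "i \<in> I \<Longrightarrow> j \<in> I \<Longrightarrow> smooth_transition V \<psi> i j"
begin

definition "M = (\<Union>i\<in>I. \<psi> i ` V i)"

definition "X = topology (\<lambda>S. S \<subseteq> M \<and>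
  (\<forall>i\<in>I. openin (top_of_set (V i)) {x \<in> V i. \<psi> i x \<in> S}))"

definition "A = (\<lambda>i. (\<psi> i ` V i, inv_into (V i) (\<psi> i))) ` I"

lemma openin_X: "openin X S \<longleftrightarrow> S \<subseteq> M \<and> (\<forall>i\<in>I. open {x \<in> V i. \<psi> i x \<in> S})"
proof -
  have "openin X S \<longleftrightarrow> S \<subseteq> M \<and> (\<forall>i\<in>I. openin (top_of_set (V i)) {x \<in> V i. \<psi> i x \<in> S})"
    using istopology_coinduced[of M I "\<lambda>i. top_of_set (V i)" \<psi>]
    by (simp only: X_def topspace_euclidean_subtopology topology_inverse')
  then show ?thesis using open_V by (auto simp: openin_open_eq)
qed

lemma topspace_X: "topspace X = M"
proof
  show "topspace X \<subseteq> M" using openin_X[of "topspace X"] by simp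
  have "{x \<in> V i. \<psi> i x \<in> M} = V i" if "i \<in> I" for i using that by (auto simp: M_def)
  then have "openin X M" using open_V by (simp add: openin_X)
  then show "M \<subseteq> topspace X" by (rule openin_subset)
qed

text \<open>Read in chart \<open>j\<close>, the image of \<open>W\<close> is the preimage of
  \<open>W\<close> under the transition map, hence open. Injectivity of \<open>\<psi> i\<close>
  identifies \<open>t x\<close> with the point of \<open>W\<close> that has the same image.\<close>

lemma openin_param_image:
  assumes "i \<in> I" "open W" "W \<subseteq> V i"
  shows "openin X (\<psi> i ` W)"
  unfolding openin_X
proof (intro conjI ballI)
  show "\<psi> i ` W \<subseteq> M" using assms by (auto simp: M_def)
  fix j assume j: "j \<in> I"
  obtain U t where U: "open U" "U \<subseteq> V j" "smooth_on U t" "t ` U \<subseteq> V i"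
    "\<And>x. x \<in> U \<Longrightarrow> \<psi> i (t x) = \<psi> j x" "\<And>x. x \<in> V j \<Longrightarrow> \<psi> j x \<in> \<psi> i ` V i \<Longrightarrow> x \<in> U"
    using transition[OF j assms(1)] unfolding smooth_transition_def by metis
  have "x \<in> U \<inter> t -` W" if xj: "x \<in> V j" "\<psi> j x \<in> \<psi> i ` W" for x
  proof -
    have x: "x \<in> U" using U(6) xj assms(3) by blast
    obtain w where w: "w \<in> W" "\<psi> j x = \<psi> i w" using xj(2) by auto
    then have "\<psi> i (t x) = \<psi> i w" using U(5)[OF x] by simp
    then have "t x = w" using inj_onD[OF inj_param[OF assms(1)]] U(4) x w(1) assms(3) by blast
    then show ?thesis using x w by simp
  qed
  moreover have "x \<in> V j \<and> \<psi> j x \<in> \<psi> i ` W" if "x \<in> U \<inter> t -` W" for x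
    using U(2) U(5)[of x, symmetric] that by auto
  ultimately have "{x \<in> V j. \<psi> j x \<in> \<psi> i ` W} = U \<inter> t -` W" by blast
  moreover have "open (U \<inter> t -` W)"
    using U(1,3) assms(2) by (meson smooth_on_imp_continuous_on continuous_open_preimage)
  ultimately show "open {x \<in> V j. \<psi> j x \<in> \<psi> i ` W}" by simp
qed

lemma continuous_param: "i \<in> I \<Longrightarrow> continuous_map (top_of_set (V i)) X (\<psi> i)"
  using open_V by (auto simp: continuous_map_def topspace_X openin_X openin_open_eq M_def)

lemma homeomorphic_chart:
  assumes "i \<in> I"
  shows "homeomorphic_map (subtopology X (\<psi> i ` V i)) (top_of_set (V i)) (inv_into (V i) (\<psi> i))"
proof -
  have sub: "\<psi> i ` V i \<subseteq> topspace X" using assms by (auto simp: topspace_X M_def)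
  have "continuous_map (top_of_set (V i)) (subtopology X (\<psi> i ` V i)) (\<psi> i)"
    using continuous_param[OF assms] by (simp add: continuous_map_into_subtopology)
  moreover have "continuous_map (subtopology X (\<psi> i ` V i)) (top_of_set (V i)) (inv_into (V i) (\<psi> i))"
    unfolding continuous_map_def
  proof (intro conjI allI impI)
    show "inv_into (V i) (\<psi> i) \<in> topspace (subtopology X (\<psi> i ` V i)) \<rightarrow> topspace (top_of_set (V i))"
      using sub by (auto intro: inv_into_into)
    fix U assume "openin (top_of_set (V i)) U"
    then have U: "open U" "U \<subseteq> V i" using open_V[OF assms] by (auto simp: openin_open_eq)
    have "{x \<in> topspace (subtopology X (\<psi> i ` V i)). inv_into (V i) (\<psi> i) x \<in> U} = \<psi> i ` U"
      using sub U(2) inj_param[OF assms] by (auto simp: inv_into_f_f subset_iff)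
    then show "openin (subtopology X (\<psi> i ` V i))
        {x \<in> topspace (subtopology X (\<psi> i ` V i)). inv_into (V i) (\<psi> i) x \<in> U}"
      using openin_param_image[OF assms U] U(2) by (auto simp: openin_subtopology intro!: exI[of _ "\<psi> i ` U"])
  qed
  ultimately have "homeomorphic_maps (top_of_set (V i)) (subtopology X (\<psi> i ` V i)) (\<psi> i)
      (inv_into (V i) (\<psi> i))"
    using inj_param[OF assms] sub by (auto simp: homeomorphic_maps_def f_inv_into_f)
  then show ?thesis using homeomorphic_maps_map by blast
qed

lemma chart_image: "i \<in> I \<Longrightarrow> inv_into (V i) (\<psi> i) ` \<psi> i ` V i = V i"
  using inj_param by (force simp: image_image inv_into_f_f)

text \<open>A chart is the inverse of a parametrization, and the definitions for manifolds invert
  charts once more. Here the double inversion cancels, so that smoothness and criticality can be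
  checked directly on \<open>\<psi> i\<close>.\<close>

lemma inv_into_chart:
  assumes "i \<in> I" "x \<in> V i"
  shows "inv_into (\<psi> i ` V i) (inv_into (V i) (\<psi> i)) x = \<psi> i x"
proof (rule inv_into_f_eq)
  show "inj_on (inv_into (V i) (\<psi> i)) (\<psi> i ` V i)" by (rule inj_on_inv_into) simp
qed (use assms inj_param in \<open>auto simp: inv_into_f_f\<close>)

lemma smooth_atlas_A: "smooth_atlas X A"
  unfolding smooth_atlas_def A_def
proof (intro conjI ballI)
  show "(\<Union>(U, \<phi>)\<in>(\<lambda>i. (\<psi> i ` V i, inv_into (V i) (\<psi> i))) ` I. U) = topspace X"
    by (auto simp: topspace_X M_def)
next
  fix c assume "c \<in> (\<lambda>i. (\<psi> i ` V i, inv_into (V i) (\<psi> i))) ` I"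
  then obtain i where i: "i \<in> I" "c = (\<psi> i ` V i, inv_into (V i) (\<psi> i))" by auto
  show "case c of (U, \<phi>) \<Rightarrow> is_chart X U \<phi>"
    using i openin_param_image[OF i(1) open_V[OF i(1)]] homeomorphic_chart[OF i(1)] open_V
    by (simp add: is_chart_def chart_image)
  have "smooth_on (inv_into (V i) (\<psi> i) ` (\<psi> i ` V i \<inter> \<psi> j ` V j))
      (inv_into (V j) (\<psi> j) \<circ> inv_into (\<psi> i ` V i) (inv_into (V i) (\<psi> i)))" if j: "j \<in> I" for j
  proof -
    obtain W t where W: "open W" "W \<subseteq> V i" "smooth_on W t" "t ` W \<subseteq> V j"
      "\<And>x. x \<in> W \<Longrightarrow> \<psi> j (t x) = \<psi> i x" "\<And>x. x \<in> V i \<Longrightarrow> \<psi> i x \<in> \<psi> j ` V j \<Longrightarrow> x \<in> W"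
      using transition[OF i(1) j] unfolding smooth_transition_def by metis
    have 1: "inv_into (V i) (\<psi> i) ` (\<psi> i ` V i \<inter> \<psi> j ` V j) \<subseteq> W"
      using W(6) inj_param[OF i(1)] by (auto simp: inv_into_f_f) (metis image_eqI inv_into_f_f)
    have "w \<in> inv_into (V i) (\<psi> i) ` (\<psi> i ` V i \<inter> \<psi> j ` V j)" if "w \<in> W" for w
    proof (rule image_eqI)
      show "w = inv_into (V i) (\<psi> i) (\<psi> i w)" using that W(2) inj_param[OF i(1)]
        by (auto simp: inv_into_f_f)
      show "\<psi> i w \<in> \<psi> i ` V i \<inter> \<psi> j ` V j" using that W(2,4) W(5)[OF that]
        by (metis IntI image_eqI image_subset_iff subsetD)
    qed
    with 1 have eq: "inv_into (V i) (\<psi> i) ` (\<psi> i ` V i \<inter> \<psi> j ` V j) = W" by blast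
    have "(inv_into (V j) (\<psi> j) \<circ> inv_into (\<psi> i ` V i) (inv_into (V i) (\<psi> i))) w = t w"
      if "w \<in> W" for w
    proof -
      have "t w \<in> V j" "w \<in> V i" using that W(2,4) by auto
      then show ?thesis
        using W(5)[OF that] inv_into_chart[OF i(1), of w] inj_param[OF j]
        by (metis comp_apply inv_into_f_f)
    qed
    then show ?thesis unfolding eq using W(1,3) by (subst smooth_on_cong[where g=t]) auto
  qed
  then show "case c of (U, \<phi>) \<Rightarrow> \<forall>(V', \<psi>')\<in>(\<lambda>i. (\<psi> i ` V i, inv_into (V i) (\<psi> i))) ` I.
      smooth_on (\<phi> ` (U \<inter> V')) (\<psi>' \<circ> inv_into U \<phi>)"
    using i(2) by auto
qed

text \<open>The finitely many parametrizations are open maps, so they carry a countable base of the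
  Euclidean space to a countable base of \<open>X\<close>.\<close>

lemma second_countable_X: "second_countable X"
proof -
  obtain \<B> :: "(real ^ 'n) set set" where B: "countable \<B>" "\<And>U. U \<in> \<B> \<Longrightarrow> open U"
    "\<And>S. open S \<Longrightarrow> \<exists>U. U \<subseteq> \<B> \<and> S = \<Union>U"
    by (rule univ_second_countable) auto
  let ?\<C> = "\<Union>i\<in>I. (\<lambda>W. \<psi> i ` (W \<inter> V i)) ` \<B>"
  have 1: "countable ?\<C>" using B(1) finite_I by (auto intro: countable_finite)
  have 2: "openin X C" if "C \<in> ?\<C>" for C
    using that B(2) open_V by (auto intro!: openin_param_image)
  have 3: "\<exists>C\<in>?\<C>. p \<in> C \<and> C \<subseteq> S" if S: "openin X S" and p: "p \<in> S" for S p
  proof -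
    have "p \<in> M" using S p by (auto simp: openin_X)
    then obtain i x where ix: "i \<in> I" "x \<in> V i" "p = \<psi> i x" by (auto simp: M_def)
    have "open {x \<in> V i. \<psi> i x \<in> S}" using S ix(1) by (simp add: openin_X)
    then obtain U where "U \<subseteq> \<B>" "{x \<in> V i. \<psi> i x \<in> S} = \<Union>U" using B(3) by metis
    moreover have "x \<in> {x \<in> V i. \<psi> i x \<in> S}" using ix p by simp
    ultimately obtain W where W: "W \<in> \<B>" "x \<in> W" "W \<subseteq> {x \<in> V i. \<psi> i x \<in> S}" by blast
    then have "\<psi> i ` (W \<inter> V i) \<in> ?\<C>" "p \<in> \<psi> i ` (W \<inter> V i)" "\<psi> i ` (W \<inter> V i) \<subseteq> S"
      using ix by auto
    then show ?thesis by blast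
  qed
  show ?thesis unfolding second_countable_def
    by (intro exI[of _ ?\<C>] conjI ballI allI impI 1 2) (assumption, elim conjE, rule 3)
qed

lemma continuous_map_from_X:
  assumes "f ` M \<subseteq> topspace Y" "\<And>i. i \<in> I \<Longrightarrow> continuous_map (top_of_set (V i)) Y (f \<circ> \<psi> i)"
  shows "continuous_map X Y f"
  unfolding continuous_map_def topspace_X
proof (intro conjI allI impI)
  show "f \<in> M \<rightarrow> topspace Y" using assms(1) by auto
  fix U assume U: "openin Y U"
  have "open {x \<in> V i. \<psi> i x \<in> {x \<in> M. f x \<in> U}}" if i: "i \<in> I" for i
  proof -
    have "{x \<in> V i. \<psi> i x \<in> {x \<in> M. f x \<in> U}} = {x \<in> V i. (f \<circ> \<psi> i) x \<in> U}"
      using i by (auto simp: M_def)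
    then show ?thesis
      using openin_continuous_map_preimage[OF assms(2)[OF i] U] open_V[OF i]
      by (simp add: openin_open_eq)
  qed
  then show "openin X {x \<in> M. f x \<in> U}" by (simp add: openin_X)
qed

lemma compactin_param_image:
  assumes "i \<in> I" "compact K" "K \<subseteq> V i"
  shows "compactin X (\<psi> i ` K)"
  using assms by (intro image_compactin[OF _ continuous_param]) (auto simp: compactin_subtopology)

lemma connectedin_param_image:
  assumes "i \<in> I" "connectedin euclidean K" "K \<subseteq> V i"
  shows "connectedin X (\<psi> i ` K)"
  using assms by (intro connectedin_continuous_map_image[OF continuous_param])
    (auto simp: connectedin_subtopology)

lemma smooth_function_A:
  assumes "\<And>i. i \<in> I \<Longrightarrow> smooth_on (V i) (\<lambda>x. f (\<psi> i x))"
  shows "smooth_function A f"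
proof -
  have "smooth_on (V i) (f \<circ> inv_into (\<psi> i ` V i) (inv_into (V i) (\<psi> i)))" if "i \<in> I" for i
    using assms[OF that] smooth_on_cong[OF open_V[OF that], of "\<lambda>x. f (\<psi> i x)"
        "f \<circ> inv_into (\<psi> i ` V i) (inv_into (V i) (\<psi> i))"] inv_into_chart[OF that]
    by (metis comp_apply)
  then show ?thesis by (auto simp: smooth_function_def A_def chart_image)
qed

lemma critical_point_A:
  "critical_point A f p \<longleftrightarrow>
    (\<exists>i\<in>I. \<exists>x\<in>V i. p = \<psi> i x \<and> ((\<lambda>x. f (\<psi> i x)) has_derivative (\<lambda>_. 0)) (at x))"
proof -
  have *: "((f \<circ> inv_into (\<psi> i ` V i) (inv_into (V i) (\<psi> i))) has_derivative D) (at x) \<longleftrightarrow>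
      ((\<lambda>x. f (\<psi> i x)) has_derivative D) (at x)" (is "(?F has_derivative _) _ \<longleftrightarrow> (?G has_derivative _) _")
    if ix: "i \<in> I" "x \<in> V i" for i x D
  proof -
    have "?F y = ?G y" if "y \<in> V i" for y using inv_into_chart[OF ix(1) that] by simp
    then show ?thesis
      using has_derivative_transform_within_open[OF _ open_V[OF ix(1)] ix(2), of ?F D UNIV ?G]
        has_derivative_transform_within_open[OF _ open_V[OF ix(1)] ix(2), of ?G D UNIV ?F] by metis
  qed
  have "(p \<in> \<psi> i ` V i \<and> ((f \<circ> inv_into (\<psi> i ` V i) (inv_into (V i) (\<psi> i)))
        has_derivative (\<lambda>_. 0)) (at (inv_into (V i) (\<psi> i) p))) \<longleftrightarrow>
      (\<exists>x\<in>V i. p = \<psi> i x \<and> ((\<lambda>x. f (\<psi> i x)) has_derivative (\<lambda>_. 0)) (at x))" if "i \<in> I" for i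
    using *[OF that] inj_param[OF that] by (auto simp: inv_into_f_f)
  then show ?thesis unfolding critical_point_def A_def by simp
qed

lemma morse_function_A:
  assumes "\<And>i. i \<in> I \<Longrightarrow> smooth_on (V i) (\<lambda>x. f (\<psi> i x))"
    and nd: "\<And>i x. i \<in> I \<Longrightarrow> x \<in> V i \<Longrightarrow> ((\<lambda>x. f (\<psi> i x)) has_derivative (\<lambda>_. 0)) (at x) \<Longrightarrow>
      invertible (hessian (\<lambda>x. f (\<psi> i x)) x)"
  shows "morse_function A f"
  unfolding morse_function_def
proof (intro conjI allI impI)
  show "smooth_function A f" using smooth_function_A assms(1) by blast
  fix p assume "critical_point A f p"
  then obtain i x where ix: "i \<in> I" "x \<in> V i" "p = \<psi> i x"
    "((\<lambda>x. f (\<psi> i x)) has_derivative (\<lambda>_. 0)) (at x)" unfolding critical_point_A by blast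
  let ?F = "f \<circ> inv_into (\<psi> i ` V i) (inv_into (V i) (\<psi> i))"
  have eq: "?F y = f (\<psi> i y)" if "y \<in> V i" for y using inv_into_chart[OF ix(1) that] by simp
  have "hessian ?F x = hessian (\<lambda>x. f (\<psi> i x)) x"
    by (rule hessian_cong[OF open_V[OF ix(1)] ix(2)]) (rule eq)
  moreover have "(?F has_derivative (\<lambda>_. 0)) (at x)"
    by (rule has_derivative_transform_within_open[OF ix(4) open_V[OF ix(1)] ix(2)]) (rule eq[symmetric])
  moreover have "inv_into (V i) (\<psi> i) p = x" using ix inj_param by (simp add: inv_into_f_f)
  ultimately show "nondegenerate_critical_point A f p"
    using nd[OF ix(1,2,4)] ix unfolding nondegenerate_critical_point_def A_def by auto
qed

end

section \<open>Reeb graphs of partitioned spaces\<close>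

text \<open>The complement of a piece is a union of open pieces, so every piece is clopen; a
  nonempty connected clopen set is a component.\<close>

lemma connected_components_of_open_partition:
  assumes "\<Union>\<U> = topspace Y" "disjoint \<U>"
    and U: "\<And>U. U \<in> \<U> \<Longrightarrow> openin Y U \<and> connectedin Y U \<and> U \<noteq> {}"
  shows "U \<in> \<U> \<Longrightarrow> x \<in> U \<Longrightarrow> connected_component_of_set Y x = U"
    and "connected_components_of Y = \<U>"
proof -
  have *: "connected_component_of_set Y x = U" if "U \<in> \<U>" "x \<in> U" for U x
  proof
    show "U \<subseteq> connected_component_of_set Y x"
      using U that by (intro connected_component_of_maximal) auto
    have "topspace Y - U = \<Union>(\<U> - {U})"
      using assms(1,2) that(1) by (auto simp: disjoint_def)
    moreover have "openin Y (\<Union>(\<U> - {U}))" using U by (intro openin_Union) auto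
    ultimately have "closedin Y U" using U[OF that(1)] by (simp add: closedin_def openin_subset)
    then have "connected_component_of_set Y x \<subseteq> U \<or> disjnt (connected_component_of_set Y x) U"
      using U that connectedin_connected_component_of by (intro connectedin_clopen_cases) auto
    moreover have "x \<in> connected_component_of_set Y x"
      using that assms(1) by (auto simp: connected_component_of_refl)
    ultimately show "connected_component_of_set Y x \<subseteq> U" using that by (auto simp: disjnt_def)
  qed
  show "U \<in> \<U> \<Longrightarrow> x \<in> U \<Longrightarrow> connected_component_of_set Y x = U" by (rule *)
  show "connected_components_of Y = \<U>"
  proof
    show "connected_components_of Y \<subseteq> \<U>"
      using * assms(1) by (auto simp: connected_components_of_def) (metis UnionE)
    show "\<U> \<subseteq> connected_components_of Y"
    proof
      fix U' assume U': "U' \<in> \<U>"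
      then obtain x where "x \<in> U'" using U by blast
      then show "U' \<in> connected_components_of Y"
        using *[OF U'] U' assms(1) unfolding connected_components_of_def by blast
    qed
  qed
qed

text \<open>Collects what the Reeb graph depends on: one connected level piece \<open>F v\<close>
  per vertex and one open connected piece \<open>E e\<close> per edge, with connected level sets
  inside \<open>E e\<close>. \<open>open_star\<close> isolates \<open>F v\<close> within its level,
  and the two closure conditions attach an edge to its end vertices.\<close>

locale reeb_partition = wf_digraph G
  for G :: "('v, 'e) pre_digraph" +
  fixes X :: "'p topology" and A :: "('p, 'n::finite) chart set" and f :: "'p \<Rightarrow> real"
    and F :: "'v \<Rightarrow> 'p set" and E :: "'e \<Rightarrow> 'p set" and g :: "'v \<Rightarrow> real"
  assumes cont_f: "continuous_map X euclideanreal f"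
    and cover: "topspace X = (\<Union>v\<in>verts G. F v) \<union> (\<Union>e\<in>arcs G. E e)"
    and disjoint_FF: "v \<in> verts G \<Longrightarrow> w \<in> verts G \<Longrightarrow> v \<noteq> w \<Longrightarrow> F v \<inter> F w = {}"
    and disjoint_EE: "a \<in> arcs G \<Longrightarrow> e \<in> arcs G \<Longrightarrow> a \<noteq> e \<Longrightarrow> E a \<inter> E e = {}"
    and disjoint_FE: "v \<in> verts G \<Longrightarrow> e \<in> arcs G \<Longrightarrow> F v \<inter> E e = {}"
    and f_F: "v \<in> verts G \<Longrightarrow> p \<in> F v \<Longrightarrow> f p = g v"
    and f_E: "e \<in> arcs G \<Longrightarrow> p \<in> E e \<Longrightarrow> g (tail G e) < f p \<and> f p < g (head G e)"
    and connected_F: "v \<in> verts G \<Longrightarrow> connectedin X (F v)"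
    and F_nonempty: "v \<in> verts G \<Longrightarrow> F v \<noteq> {}"
    and connected_E: "e \<in> arcs G \<Longrightarrow> connectedin X (E e)"
    and E_nonempty: "e \<in> arcs G \<Longrightarrow> E e \<noteq> {}"
    and connected_fibre: "e \<in> arcs G \<Longrightarrow> connectedin X {p \<in> E e. f p = t}"
    and open_E: "e \<in> arcs G \<Longrightarrow> openin X (E e)"
    and open_star: "v \<in> verts G \<Longrightarrow>
      openin X (F v \<union> (\<Union>e\<in>{e \<in> arcs G. tail G e = v \<or> head G e = v}. E e))"
    and tail_closure: "e \<in> arcs G \<Longrightarrow> F (tail G e) \<inter> X closure_of E e \<noteq> {}"
    and head_closure: "e \<in> arcs G \<Longrightarrow> F (head G e) \<inter> X closure_of E e \<noteq> {}"
    and critical_F: "p \<in> topspace X \<Longrightarrow> critical_point A f p \<Longrightarrow> \<exists>v\<in>verts G. p \<in> F v"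
    and F_critical: "v \<in> verts G \<Longrightarrow> \<exists>p\<in>F v. critical_point A f p"
begin

definition "star v = F v \<union> (\<Union>e\<in>{e \<in> arcs G. tail G e = v \<or> head G e = v}. E e)"

definition "fibre e t = {p \<in> E e. f p = t}"

definition "q = reeb_proj X f"

definition "R = reeb_space X f"

lemma F_sub: "v \<in> verts G \<Longrightarrow> F v \<subseteq> topspace X" and E_sub: "e \<in> arcs G \<Longrightarrow> E e \<subseteq> topspace X"
  using cover by auto

lemma points_cases:
  assumes "p \<in> topspace X"
  obtains (vert) v where "v \<in> verts G" "p \<in> F v" | (arc) e where "e \<in> arcs G" "p \<in> E e"
  using assms cover by auto

lemma star_level: "v \<in> verts G \<Longrightarrow> {p \<in> star v. f p = g v} = F v"
  using f_F f_E by (fastforce simp: star_def)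

text \<open>The edges of the star of \<open>v\<close> lie strictly above or strictly below
  \<open>v\<close>, so the open star meets the level of \<open>v\<close> in \<open>F v\<close>
  alone; and an open piece \<open>E e\<close> meets a level in one fibre. The pieces of a level are
  therefore relatively open and connected, hence its components.\<close>

lemma level_partition:
  fixes t :: real
  defines "L \<equiv> {z \<in> topspace X. f z = t}"
  defines "\<U> \<equiv> F ` {v \<in> verts G. g v = t} \<union> {C. \<exists>e\<in>arcs G. C = fibre e t \<and> C \<noteq> {}}"
  assumes "U \<in> \<U>" "x \<in> U"
  shows "connected_component_of_set (subtopology X L) x = U"
proof (rule connected_components_of_open_partition(1)[OF _ _ _ assms(3,4)])
  show "\<Union>\<U> = topspace (subtopology X L)"
  proof
    show "\<Union>\<U> \<subseteq> topspace (subtopology X L)"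
      using F_sub E_sub f_F by (auto simp: \<U>_def L_def fibre_def)
    show "topspace (subtopology X L) \<subseteq> \<Union>\<U>"
    proof
      fix p assume p: "p \<in> topspace (subtopology X L)"
      then have pt: "p \<in> topspace X" "f p = t" by (auto simp: L_def)
      from pt(1) show "p \<in> \<Union>\<U>"
      proof (cases rule: points_cases)
        case (vert v)
        then show ?thesis using f_F pt(2) by (auto simp: \<U>_def)
      next
        case (arc e)
        then have "p \<in> fibre e t" using pt(2) by (simp add: fibre_def)
        then show ?thesis using arc by (auto simp: \<U>_def)
      qed
    qed
  qed
  show "disjoint \<U>"
  proof (rule disjointI)
    fix a b assume ab: "a \<in> \<U>" "b \<in> \<U>" "a \<noteq> b"
    then show "a \<inter> b = {}"
      using disjoint_FF disjoint_EE disjoint_FE unfolding \<U>_def fibre_def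
      by (elim UnE imageE CollectE conjE bexE) (fast+)
  qed
  fix U assume "U \<in> \<U>"
  then consider v where "v \<in> verts G" "g v = t" "U = F v"
    | e where "e \<in> arcs G" "U = fibre e t" "U \<noteq> {}" by (auto simp: \<U>_def)
  then show "openin (subtopology X L) U \<and> connectedin (subtopology X L) U \<and> U \<noteq> {}"
  proof cases
    case 1
    have "F v = star v \<inter> L" using star_level[OF 1(1)] 1 open_star[OF 1(1)] openin_subset
      by (fastforce simp: L_def star_def[symmetric])
    moreover have "F v \<subseteq> L" using F_sub f_F 1 by (auto simp: L_def)
    ultimately show ?thesis
      using 1 open_star[OF 1(1), folded star_def] connected_F[OF 1(1)] F_nonempty[OF 1(1)]
      unfolding openin_subtopology connectedin_subtopology by blast
  next
    case 2
    have "fibre e t = E e \<inter> L" using E_sub[OF 2(1)] by (auto simp: fibre_def L_def)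
    then show ?thesis using 2 open_E[OF 2(1)] connected_fibre[OF 2(1), of t]
      by (auto simp: openin_subtopology connectedin_subtopology fibre_def)
  qed
qed

lemma q_eq: "p \<in> topspace X \<Longrightarrow>
    q p = connected_component_of_set (subtopology X {z \<in> topspace X. f z = f p}) p"
  by (auto simp: q_def reeb_proj_def reeb_relation_def)

lemma q_F: "v \<in> verts G \<Longrightarrow> p \<in> F v \<Longrightarrow> q p = F v"
  using F_sub f_F by (subst q_eq) (auto intro!: level_partition)

lemma q_E: "e \<in> arcs G \<Longrightarrow> p \<in> E e \<Longrightarrow> q p = fibre e (f p)"
  using E_sub by (subst q_eq) (auto intro!: level_partition simp: fibre_def)

lemma quotient_q: "quotient_map X R q"
  unfolding R_def reeb_space_def q_def by (rule quotient_map_quotient_topology)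

lemma topspace_R: "topspace R = q ` topspace X"
  by (simp add: R_def reeb_space_def q_def)

lemma F_not_fibre: "v \<in> verts G \<Longrightarrow> e \<in> arcs G \<Longrightarrow> F v \<noteq> fibre e t"
  using disjoint_FE[of v e] F_nonempty[of v] by (auto simp: fibre_def)

lemma F_notin_q_E: "v \<in> verts G \<Longrightarrow> e \<in> arcs G \<Longrightarrow> F v \<notin> q ` E e"
  using q_E F_not_fibre by fastforce

lemma inj_F: "inj_on F (verts G)"
  using disjoint_FF F_nonempty by (fastforce intro!: inj_onI)

lemma reeb_verts_eq: "reeb_verts X A f = F ` verts G"
proof -
  have "C \<in> F ` verts G" if C: "C \<in> topspace R" "p \<in> C" "critical_point A f p" for C p
  proof -
    obtain r where r: "r \<in> topspace X" "C = q r" using C(1) topspace_R by auto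
    from r(1) show ?thesis
    proof (cases rule: points_cases)
      case (vert v)
      then show ?thesis using q_F r(2) by auto
    next
      case (arc e)
      then have "p \<in> E e" using q_E r(2) C(2) by (auto simp: fibre_def)
      then show ?thesis using critical_F[OF _ C(3)] E_sub[OF arc(1)] disjoint_FE arc(1) by blast
    qed
  qed
  moreover have "F v \<in> topspace R" if "v \<in> verts G" for v
    using q_F[OF that] F_nonempty[OF that] F_sub[OF that] unfolding topspace_R by fast
  ultimately show ?thesis using F_critical unfolding reeb_verts_def R_def[symmetric] by blast
qed

lemma disjoint_q_E: "a \<in> arcs G \<Longrightarrow> e \<in> arcs G \<Longrightarrow> a \<noteq> e \<Longrightarrow> q ` E a \<inter> q ` E e = {}"
proof (rule ccontr)
  assume ae: "a \<in> arcs G" "e \<in> arcs G" "a \<noteq> e" "q ` E a \<inter> q ` E e \<noteq> {}"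
  then obtain p r where "p \<in> E a" "r \<in> E e" "q p = q r" by blast
  then have "p \<in> fibre e (f r)" using q_E[OF ae(1)] q_E[OF ae(2)] by (auto simp: fibre_def)
  then show False using disjoint_EE[OF ae(1,2,3)] \<open>p \<in> E a\<close> by (auto simp: fibre_def)
qed

section \<open>Open sets, closures and arcs of the Reeb space\<close>

lemma openin_R_saturated:
  assumes "openin X S" "\<And>p. p \<in> topspace X \<Longrightarrow> q p \<in> q ` S \<Longrightarrow> p \<in> S"
  shows "openin R (q ` S)"
proof -
  have "{x \<in> topspace X. q x \<in> q ` S} = S" using assms openin_subset by blast
  then show ?thesis
    using assms(1) openin_subset[OF assms(1)]
    unfolding R_def reeb_space_def q_def[symmetric] openin_quotient_topology by auto
qed

lemma mem_q_self: "p \<in> topspace X \<Longrightarrow> p \<in> q p"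
  by (cases rule: points_cases) (auto simp: q_F q_E fibre_def)

lemma saturated_E:
  assumes "e \<in> arcs G" "p \<in> topspace X" "q p \<in> q ` E e"
  shows "p \<in> E e"
  using assms mem_q_self[OF assms(2)] q_E by (auto simp: fibre_def)

lemma open_q_E: "e \<in> arcs G \<Longrightarrow> openin R (q ` E e)"
  using open_E saturated_E by (intro openin_R_saturated)

lemma open_q_star: "v \<in> verts G \<Longrightarrow> openin R (q ` star v)"
proof (rule openin_R_saturated)
  assume v: "v \<in> verts G"
  show "openin X (star v)" using open_star[OF v] by (simp add: star_def)
  fix p assume p: "p \<in> topspace X" "q p \<in> q ` star v"
  then obtain r where r: "r \<in> star v" "q p = q r" by auto
  then have "p \<in> q r" using mem_q_self[OF p(1)] by simp
  then show "p \<in> star v" using r(1) v by (auto simp: star_def q_F q_E fibre_def)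
qed

lemma arcs_complement:
  "topspace R - reeb_verts X A f = (\<Union>e\<in>arcs G. q ` E e)"
proof
  show "(\<Union>e\<in>arcs G. q ` E e) \<subseteq> topspace R - reeb_verts X A f"
    using E_sub F_notin_q_E unfolding topspace_R reeb_verts_eq by fast
  show "topspace R - reeb_verts X A f \<subseteq> (\<Union>e\<in>arcs G. q ` E e)"
    unfolding topspace_R reeb_verts_eq using q_F by (auto elim!: points_cases)
qed

lemma components_complement:
  "connected_components_of (subtopology R (topspace R - reeb_verts X A f)) = (\<lambda>e. q ` E e) ` arcs G"
proof (rule connected_components_of_open_partition(2))
  show "\<Union> ((\<lambda>e. q ` E e) ` arcs G) = topspace (subtopology R (topspace R - reeb_verts X A f))"
    using arcs_complement by auto
  show "disjoint ((\<lambda>e. q ` E e) ` arcs G)"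
    using disjoint_q_E by (auto intro!: disjointI)
  fix U assume "U \<in> (\<lambda>e. q ` E e) ` arcs G"
  then obtain e where e: "e \<in> arcs G" "U = q ` E e" by auto
  moreover have "connectedin R (q ` E e)"
    using connectedin_continuous_map_image[OF quotient_imp_continuous_map[OF quotient_q] connected_E[OF e(1)]] .
  moreover have "q ` E e \<subseteq> topspace R - reeb_verts X A f" using e arcs_complement by auto
  ultimately show "openin (subtopology R (topspace R - reeb_verts X A f)) U \<and>
      connectedin (subtopology R (topspace R - reeb_verts X A f)) U \<and> U \<noteq> {}"
    using open_q_E[OF e(1)] E_nonempty[OF e(1)]
    by (auto simp: connectedin_subtopology openin_subset_topspace_eq openin_subtopology
        intro!: exI[of _ "q ` E e"])
qed

definition "cl e = R closure_of (q ` E e)"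

text \<open>Continuity of \<open>q\<close> carries the points given by \<open>tail_closure\<close>
  and \<open>head_closure\<close> into the closure. Nothing else is added: any other point has a
  neighbourhood, the image of another open edge or of the star of a nonincident vertex, that misses
  the image of \<open>E e\<close>.\<close>

lemma cl_eq:
  assumes e: "e \<in> arcs G"
  shows "cl e = q ` E e \<union> {F (tail G e), F (head G e)}"
proof
  have "F v \<in> cl e" if v: "v \<in> verts G" "F v \<inter> X closure_of E e \<noteq> {}" for v
  proof -
    obtain p where "p \<in> F v" "p \<in> X closure_of E e" using v(2) by blast
    then show ?thesis
      using continuous_map_image_closure_subset[OF quotient_imp_continuous_map[OF quotient_q], of "E e"]
        q_F[OF v(1)] unfolding cl_def by blast
  qed
  moreover have "q ` E e \<subseteq> cl e"
    using E_sub[OF e] unfolding cl_def by (intro closure_of_subset) (auto simp: topspace_R)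
  ultimately show "q ` E e \<union> {F (tail G e), F (head G e)} \<subseteq> cl e"
    using tail_closure[OF e] head_closure[OF e] e by auto
  show "cl e \<subseteq> q ` E e \<union> {F (tail G e), F (head G e)}"
  proof
    fix C assume C: "C \<in> cl e"
    then have cl: "\<And>T. openin R T \<Longrightarrow> C \<in> T \<Longrightarrow> T \<inter> q ` E e \<noteq> {}"
      unfolding cl_def in_closure_of by blast
    obtain p where p: "p \<in> topspace X" "C = q p"
      using C unfolding cl_def in_closure_of topspace_R by auto
    from p(1) show "C \<in> q ` E e \<union> {F (tail G e), F (head G e)}"
    proof (cases rule: points_cases)
      case (vert v)
      then have "C \<in> q ` star v" using p by (auto simp: star_def)
      then obtain r s where rs: "r \<in> star v" "s \<in> E e" "q r = q s"
        using cl[OF open_q_star[OF vert(1)]] by blast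
      then have "s \<in> q r" using mem_q_self E_sub[OF e] by auto
      then have "s \<in> star v" using rs(1) vert(1) by (auto simp: star_def q_F q_E fibre_def)
      then have "tail G e = v \<or> head G e = v"
        using rs(2) disjoint_EE[OF e] disjoint_FE[OF vert(1) e] unfolding star_def by blast
      then show ?thesis using q_F[OF vert] p(2) by auto
    next
      case (arc a)
      then have "q ` E a \<inter> q ` E e \<noteq> {}" using cl[OF open_q_E[OF arc(1)]] p(2) by blast
      then have "a = e" using disjoint_q_E[OF arc(1) e] by blast
      then show ?thesis using arc p by auto
    qed
  qed
qed

text \<open>Parallel edges share both end points, so closures must be told apart by interior points:
  the images of different edge pieces are disjoint and contain no vertex class.\<close>

lemma inj_cl: "inj_on cl (arcs G)"
proof (rule inj_onI, rule ccontr)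
  fix a e assume ae: "a \<in> arcs G" "e \<in> arcs G" "cl a = cl e" "a \<noteq> e"
  obtain p where p: "p \<in> E a" using E_nonempty[OF ae(1)] by blast
  have "q p \<notin> q ` E e" using disjoint_q_E[OF ae(1,2,4)] p by blast
  moreover have "q p \<in> cl e" using ae(3) cl_eq[OF ae(1)] p by blast
  moreover have "q p \<noteq> F v" if "v \<in> verts G" for v using F_notin_q_E[OF that ae(1)] p by blast
  ultimately show False using cl_eq[OF ae(2)] ae(2) by auto
qed

lemma reeb_arcs_eq: "reeb_arcs X A f = cl ` arcs G"
  unfolding reeb_arcs_def R_def[symmetric] components_complement cl_def by (simp add: image_image)

lemma reeb_fun_F: "v \<in> verts G \<Longrightarrow> reeb_fun f (F v) = g v"
proof -
  assume v: "v \<in> verts G"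
  then have "f ` F v = {g v}" using f_F[OF v] F_nonempty[OF v] by auto
  then show ?thesis by (simp add: reeb_fun_def)
qed

lemma reeb_fun_q: 
  assumes "e \<in> arcs G" "p \<in> E e"
  shows "reeb_fun f (q p) = f p"
proof -
  have "f ` q p = {f p}" using assms by (auto simp: q_E fibre_def)
  then show ?thesis by (simp add: reeb_fun_def)
qed

lemma tail_less_head: "e \<in> arcs G \<Longrightarrow> g (tail G e) < g (head G e)"
  using E_nonempty f_E by fastforce

lemma verts_cl: "e \<in> arcs G \<Longrightarrow> C \<in> reeb_verts X A f \<and> C \<in> cl e \<longleftrightarrow> C = F (tail G e) \<or> C = F (head G e)"
  using F_notin_q_E by (auto simp: cl_eq reeb_verts_eq)

text \<open>The strict inequality between the two end heights makes the lowest vertex of the arc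
  unique, so the definite description denotes it; the head is symmetric.\<close>

lemma reeb_tail:
  assumes e: "e \<in> arcs G"
  shows "tail (reeb_graph X A f) (cl e) = F (tail G e)"
proof -
  have "(THE v. v \<in> reeb_verts X A f \<and> v \<in> cl e \<and> (\<forall>x\<in>cl e. reeb_fun f v \<le> reeb_fun f x)) = F (tail G e)"
  proof (rule the_equality)
    have "reeb_fun f (F (tail G e)) \<le> reeb_fun f C" if "C \<in> cl e" for C
      using that e f_E[OF e] tail_less_head[OF e] reeb_fun_q[OF e]
      by (auto simp: cl_eq reeb_fun_F less_imp_le)
    then show "F (tail G e) \<in> reeb_verts X A f \<and> F (tail G e) \<in> cl e \<and>
        (\<forall>x\<in>cl e. reeb_fun f (F (tail G e)) \<le> reeb_fun f x)" using verts_cl[OF e] by blast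
    fix C assume C: "C \<in> reeb_verts X A f \<and> C \<in> cl e \<and> (\<forall>x\<in>cl e. reeb_fun f C \<le> reeb_fun f x)"
    moreover have "F (tail G e) \<in> cl e" by (simp add: cl_eq[OF e])
    ultimately show "C = F (tail G e)"
      using verts_cl[OF e, of C] tail_less_head[OF e] e by (auto simp: reeb_fun_F)
  qed
  then show ?thesis by (simp add: reeb_graph_def)
qed

lemma reeb_head:
  assumes e: "e \<in> arcs G"
  shows "head (reeb_graph X A f) (cl e) = F (head G e)"
proof -
  have "(THE v. v \<in> reeb_verts X A f \<and> v \<in> cl e \<and> (\<forall>x\<in>cl e. reeb_fun f x \<le> reeb_fun f v)) = F (head G e)"
  proof (rule the_equality)
    have "reeb_fun f C \<le> reeb_fun f (F (head G e))" if "C \<in> cl e" for C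
      using that e f_E[OF e] tail_less_head[OF e] reeb_fun_q[OF e]
      by (auto simp: cl_eq reeb_fun_F less_imp_le)
    then show "F (head G e) \<in> reeb_verts X A f \<and> F (head G e) \<in> cl e \<and>
        (\<forall>x\<in>cl e. reeb_fun f x \<le> reeb_fun f (F (head G e)))" using verts_cl[OF e] by blast
    fix C assume C: "C \<in> reeb_verts X A f \<and> C \<in> cl e \<and> (\<forall>x\<in>cl e. reeb_fun f x \<le> reeb_fun f C)"
    moreover have "F (head G e) \<in> cl e" by (simp add: cl_eq[OF e])
    ultimately show "C = F (head G e)"
      using verts_cl[OF e, of C] tail_less_head[OF e] e by (auto simp: reeb_fun_F)
  qed
  then show ?thesis by (simp add: reeb_graph_def)
qed

lemma digraph_iso_reeb_graph: "digraph_iso (reeb_graph X A f) G"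
proof -
  let ?R = "reeb_graph X A f"
  have verts: "verts ?R = F ` verts G" and arcs: "arcs ?R = cl ` arcs G"
    by (simp_all add: reeb_graph_def reeb_verts_eq reeb_arcs_eq)
  let ?h = "\<lparr>iso_verts = the_inv_into (verts G) F, iso_arcs = the_inv_into (arcs G) cl,
      iso_head = head G, iso_tail = tail G\<rparr>"
  have "wf_digraph ?R"
    by unfold_locales (auto simp: verts arcs reeb_tail reeb_head)
  then have "pre_digraph.digraph_isomorphism ?R ?h"
    unfolding pre_digraph.digraph_isomorphism_def
    by (auto simp: verts arcs reeb_tail reeb_head the_inv_into_f_f inj_F inj_cl
        inj_on_the_inv_into)
  moreover have "G = app_iso ?h ?R"
    by (simp add: app_iso_def verts arcs the_inv_into_onto inj_F inj_cl)
  ultimately show ?thesis unfolding digraph_iso_def by blast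
qed

text \<open>A clopen set contains or misses each connected piece, and an edge agrees with both end
  fibres because these meet its closure. So the vertices whose fibres it contains are closed under
  adjacency, and the hypothesis, a form of connectedness of the graph, leaves only none or all of
  them.\<close>

lemma connected_space_X:
  assumes "\<And>S. S \<subseteq> verts G \<Longrightarrow> S \<noteq> {} \<Longrightarrow>
      (\<And>e. e \<in> arcs G \<Longrightarrow> tail G e \<in> S \<longleftrightarrow> head G e \<in> S) \<Longrightarrow> S = verts G"
  shows "connected_space X"
  unfolding connected_space_clopen_in
proof (intro allI impI)
  fix T assume T: "openin X T \<and> closedin X T"
  have 1: "(F v \<subseteq> T \<longleftrightarrow> E e \<subseteq> T) \<and> (E e \<subseteq> T \<or> E e \<inter> T = {})"
    if e: "e \<in> arcs G" and v: "v \<in> verts G" and cl: "F v \<inter> X closure_of E e \<noteq> {}" for v e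
  proof -
    have "E e \<subseteq> T \<or> disjnt (E e) T" and F: "F v \<subseteq> T \<or> disjnt (F v) T"
      using T connectedin_clopen_cases[OF connected_E[OF e]] connectedin_clopen_cases[OF connected_F[OF v]]
      by blast+
    then consider "E e \<subseteq> T" | "E e \<inter> T = {}" by (auto simp: disjnt_def)
    then show ?thesis
    proof cases
      case 1
      then have "X closure_of E e \<subseteq> T" using T by (simp add: closure_of_minimal)
      then show ?thesis using F cl 1 by (auto simp: disjnt_def)
    next
      case 2
      then have "X closure_of E e \<subseteq> topspace X - T"
        using T E_sub[OF e] by (intro closure_of_minimal) auto
      then have "\<not> F v \<subseteq> T" using cl by blast
      then show ?thesis using 2 E_nonempty[OF e] by auto
    qed
  qed
  let ?S = "{v \<in> verts G. F v \<subseteq> T}"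
  have 2: "tail G e \<in> ?S \<longleftrightarrow> head G e \<in> ?S" if "e \<in> arcs G" for e
    using 1[OF that _ tail_closure[OF that]] 1[OF that _ head_closure[OF that]] that by auto
  show "T = {} \<or> T = topspace X"
  proof (cases "?S = {}")
    case True
    have "p \<notin> T" if "p \<in> topspace X" for p
      using that
    proof (cases rule: points_cases)
      case (vert v)
      have "F v \<subseteq> T \<or> disjnt (F v) T"
        using T connectedin_clopen_cases[OF connected_F[OF vert(1)]] by blast
      then show ?thesis using vert True by (auto simp: disjnt_def)
    next
      case (arc e)
      then show ?thesis using 1[OF arc(1) _ tail_closure[OF arc(1)]] True by auto
    qed
    then show ?thesis using T openin_subset by blast
  next
    case False
    then have S: "?S = verts G" by (intro assms 2) auto
    have "p \<in> T" if "p \<in> topspace X" for p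
      using that
    proof (cases rule: points_cases)
      case (vert v)
      then show ?thesis using S by blast
    next
      case (arc e)
      then show ?thesis using 1[OF arc(1) _ tail_closure[OF arc(1)]] S tail_in_verts[OF arc(1)] by blast
    qed
    then show ?thesis using T openin_subset by blast
  qed
qed

end

section \<open>The manifold of a graph with prescribed vertex heights\<close>

lemma sin_sq_shift: "(sin (pi * (x + of_int k)))\<^sup>2 = (sin (pi * x))\<^sup>2"
proof -
  have "sin (pi * of_int k) = 0" by (simp add: sin_npi_int mult.commute)
  then have "(cos (pi * of_int k))\<^sup>2 = 1" using sin_cos_squared_add[of "pi * of_int k"] by simp
  then show ?thesis
    using \<open>sin (pi * of_int k) = 0\<close> by (simp add: distrib_left sin_add power_mult_distrib)
qed

lemma sin_sq_frac: "(sin (pi * frac x))\<^sup>2 = (sin (pi * x))\<^sup>2"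
  using sin_sq_shift[of "frac x" "\<lfloor>x\<rfloor>"] by (simp add: frac_def)

lemma sin_sq_Ints: "x \<in> \<int> \<Longrightarrow> (sin (pi * x))\<^sup>2 = 0"
  using sin_sq_shift[of 0] by (auto elim!: Ints_cases)

lemma frac_eq_iff: "frac (x :: real) = frac y \<longleftrightarrow> x - y \<in> \<int>"
proof
  assume "frac x = frac y"
  then have "x - y = of_int (\<lfloor>x\<rfloor> - \<lfloor>y\<rfloor>)" by (simp add: frac_def algebra_simps)
  then show "x - y \<in> \<int>" by (metis Ints_of_int)
next
  assume "x - y \<in> \<int>"
  then obtain k where "x = y + of_int k" by (auto elim!: Ints_cases simp: algebra_simps)
  then show "frac x = frac y" by (simp add: frac_def)
qed

definition sg :: "bool \<Rightarrow> real" where "sg \<sigma> = (if \<sigma> then 1 else -1)"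

lemma sg_simps [simp]: "sg True = 1" "sg False = -1" "sg \<sigma> * sg \<sigma> = 1" "sg \<sigma> * (sg \<sigma> * x) = x"
  "sg (\<not> \<sigma>) = - sg \<sigma>" "\<bar>sg \<sigma> * x\<bar> = \<bar>x\<bar>" "sg \<sigma> \<noteq> 0" "sg \<sigma> * x = 0 \<longleftrightarrow> x = 0"
  by (auto simp: sg_def)

text \<open>The side \<open>True\<close> of a vertex is that of its outgoing edges, the end \<open>True\<close> of an edge is its
  tail. \<open>EI \<sigma> e\<close> is polar coordinates on the edge \<open>e\<close> around its end \<open>\<sigma>\<close> and \<open>QI \<sigma> \<alpha> v\<close> is the chart
  \<open>(\<theta>, y)\<close> at \<open>v\<close> built on \<open>\<phi> \<sigma>\<close>, with the circle cut at \<open>\<alpha>\<close>.\<close>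

datatype ('v, 'e) chart_index = EI bool 'e | QI bool real 'v

text \<open>Points are codes \<open>mk l t x\<close> of a label, a number and a vector, kept
  abstract so that the carrier type can be chosen at the end. The gap \<open>2 * \<delta>\<close>
  keeps the neighbourhoods of the two ends of an edge apart; \<open>\<delta> \<le> 1 / 2\<close>
  keeps \<open>1 - \<bar>s\<bar>\<close> positive and the maxima of \<open>\<phi>\<close> out of
  reach.\<close>

locale reeb_construction = fin_digraph G
  for G :: "('v, 'e) pre_digraph" +
  fixes g :: "'v \<Rightarrow> real" and \<delta> :: real and i0 :: "'n::finite"
    and mk :: "'v + 'e \<Rightarrow> real \<Rightarrow> real ^ 'n \<Rightarrow> 'p"
    and lab :: "'p \<Rightarrow> 'v + 'e" and hgt :: "'p \<Rightarrow> real" and vec :: "'p \<Rightarrow> real ^ 'n"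
  assumes \<delta>: "0 < \<delta>" "\<delta> \<le> 1 / 2"
    and g_gap: "e \<in> arcs G \<Longrightarrow> g (tail G e) + 2 * \<delta> \<le> g (head G e)"
    and degrees: "v \<in> verts G \<Longrightarrow>
      out_arcs G v \<noteq> {} \<and> in_arcs G v \<noteq> {} \<or> in_degree G v + out_degree G v = 1"
    and card_ge_2: "CARD('n) \<ge> 2"
    and mk: "l \<in> Inl ` verts G \<union> Inr ` arcs G \<Longrightarrow> lab (mk l t x) = l"
      "l \<in> Inl ` verts G \<union> Inr ` arcs G \<Longrightarrow> hgt (mk l t x) = t"
      "l \<in> Inl ` verts G \<union> Inr ` arcs G \<Longrightarrow> vec (mk l t x) = x"
begin

abbreviation b :: "real ^ 'n" where "b \<equiv> axis i0 1"

definition perp :: "real ^ 'n \<Rightarrow> real ^ 'n" where "perp z = z - (z \<bullet> b) *\<^sub>R b"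

definition "harcs \<sigma> v = (if \<sigma> then out_arcs G v else in_arcs G v)"

definition "base \<sigma> e = (if \<sigma> then tail G e else head G e)"

definition "len e = g (head G e) - g (tail G e)"

definition "interior_vert v \<longleftrightarrow> v \<in> verts G \<and> (\<forall>\<sigma>. harcs \<sigma> v \<noteq> {})"

definition "m \<sigma> v = card (harcs \<sigma> v)"

text \<open>\<open>\<phi> True v\<close> and \<open>\<phi> False v\<close> are \<open>\<phi>\<^sub>+\<close> and \<open>\<phi>\<^sub>-\<close>. The shift by \<open>1 / (2 * m True v)\<close> makes
  their zeros disjoint.\<close>

definition phase :: "bool \<Rightarrow> 'v \<Rightarrow> real \<Rightarrow> real" where
  "phase \<sigma> v \<theta> = real (m \<sigma> v) * \<theta> + (if \<sigma> then 0 else 1 / (2 * real (m True v)))"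

definition \<phi> :: "bool \<Rightarrow> 'v \<Rightarrow> real \<Rightarrow> real" where "\<phi> \<sigma> v \<theta> = (sin (pi * phase \<sigma> v \<theta>))\<^sup>2"

text \<open>The two factors of the model equation: \<open>h True\<close> is
  \<open>\<phi>\<^sub>+ - s\<close> and \<open>h False\<close> is
  \<open>\<phi>\<^sub>- + s\<close>.\<close>

definition h :: "bool \<Rightarrow> 'v \<Rightarrow> real \<Rightarrow> real \<Rightarrow> real" where "h \<sigma> v \<theta> s = \<phi> \<sigma> v \<theta> - sg \<sigma> * s"

definition arm :: "bool \<Rightarrow> 'v \<Rightarrow> nat \<Rightarrow> 'e" where
  "arm \<sigma> v = (SOME f. bij_betw f {..<m \<sigma> v} (harcs \<sigma> v))"

text \<open>The integer part of the phase numbers the arcs of the circle between consecutive zeros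
  of \<open>\<phi> \<sigma> v\<close>. One turn of the circle raises it by
  \<open>m \<sigma> v\<close>, hence the reduction modulo \<open>m \<sigma> v\<close>.\<close>

definition armZ :: "bool \<Rightarrow> 'v \<Rightarrow> int \<Rightarrow> 'e" where
  "armZ \<sigma> v k = arm \<sigma> v (nat (k mod int (m \<sigma> v)))"

definition admissible :: "'v \<Rightarrow> real \<Rightarrow> real \<Rightarrow> real ^ 'n \<Rightarrow> bool" where
  "admissible v \<theta> s Y \<longleftrightarrow> Y \<bullet> b = 0 \<and> \<bar>s\<bar> < \<delta> \<and> Y \<bullet> Y = h True v \<theta> s * h False v \<theta> s \<and> (\<forall>\<sigma>. 0 \<le> h \<sigma> v \<theta> s)"

text \<open>The point \<open>(cos, y)\<close> of the round sphere of radius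
  \<open>sqrt (1 - \<bar>s\<bar>)\<close>, normalised. The fractional part makes it a function on
  the circle: one turn adds an integer to the phase, and an odd one would flip the sign of the
  cosine.\<close>

definition direction :: "bool \<Rightarrow> 'v \<Rightarrow> real \<Rightarrow> real \<Rightarrow> real ^ 'n \<Rightarrow> real ^ 'n" where
  "direction \<sigma> v \<theta> s Y = (1 / sqrt (1 - \<bar>s\<bar>)) *\<^sub>R
     (cos (pi * frac (phase \<sigma> v \<theta>)) *\<^sub>R b + (1 / sqrt (h (\<not> \<sigma>) v \<theta> s)) *\<^sub>R Y)"

text \<open>The point of the manifold with coordinates \<open>(\<theta>, s, Y)\<close> at \<open>v\<close>. Points are labelled by the open
  edge or the vertex fibre containing them: \<open>mk (Inr e) \<tau> \<omega>\<close> has height \<open>\<tau>\<close> and direction \<open>\<omega>\<close> on the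
  unit sphere, \<open>mk (Inl v) \<theta> Y\<close> lies on the fibre \<open>s = 0\<close>.\<close>

definition N :: "'v \<Rightarrow> real \<Rightarrow> real \<Rightarrow> real ^ 'n \<Rightarrow> 'p" where
  "N v \<theta> s Y = (if s = 0 then mk (Inl v) (frac \<theta>) Y
     else mk (Inr (armZ (0 < s) v \<lfloor>phase (0 < s) v \<theta>\<rfloor>)) (g v + s) (direction (0 < s) v \<theta> s Y))"

text \<open>In \<open>EI\<close> the squared radius is the height difference to the end
  \<open>\<sigma>\<close>, so the ball stops just before the opposite end; its centre belongs to the
  domain only at a cap. In \<open>QI\<close> the bound by the sum of the two \<phi> says that the
  factor opposite to \<open>\<sigma>\<close> is positive, which omits one pole.\<close>

fun V :: "('v, 'e) chart_index \<Rightarrow> (real ^ 'n) set" where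
  "V (EI \<sigma> e) = {z. z \<bullet> z < len e \<and> (z \<noteq> 0 \<or> \<not> interior_vert (base \<sigma> e))}"
| "V (QI \<sigma> \<alpha> v) = {z. \<alpha> < z \<bullet> b \<and> z \<bullet> b < \<alpha> + 1 \<and>
     perp z \<bullet> perp z < \<phi> True v (z \<bullet> b) + \<phi> False v (z \<bullet> b) \<and> \<bar>\<phi> \<sigma> v (z \<bullet> b) - perp z \<bullet> perp z\<bar> < \<delta>}"

text \<open>In \<open>QI\<close> the factor \<open>h \<sigma>\<close> equals \<open>|y|^2\<close>,
  and the opposite factor is what remains of the sum of the two \<phi>; its root times
  \<open>y\<close> gives back \<open>Y\<close>.\<close>

fun \<psi> :: "('v, 'e) chart_index \<Rightarrow> real ^ 'n \<Rightarrow> 'p" where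
  "\<psi> (EI \<sigma> e) z = (if z = 0 then mk (Inl (base \<sigma> e)) 0 0
     else mk (Inr e) (g (base \<sigma> e) + sg \<sigma> * (z \<bullet> z)) ((1 / sqrt (z \<bullet> z)) *\<^sub>R z))"
| "\<psi> (QI \<sigma> \<alpha> v) z = N v (z \<bullet> b) (sg \<sigma> * (\<phi> \<sigma> v (z \<bullet> b) - perp z \<bullet> perp z))
     (sqrt (\<phi> True v (z \<bullet> b) + \<phi> False v (z \<bullet> b) - perp z \<bullet> perp z) *\<^sub>R perp z)"

text \<open>Two cuts of the circle suffice, since no angle is congruent to both 0 and 1/2 modulo
  1.\<close>

definition "I = {EI \<sigma> e | \<sigma> e. e \<in> arcs G} \<union>
  {QI \<sigma> \<alpha> v | \<sigma> \<alpha> v. interior_vert v \<and> \<alpha> \<in> {0, 1 / 2}}"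

declare V.simps [simp del] \<psi>.simps [simp del]

section \<open>Edge ends, numbered arms and the model hypersurface\<close>

lemma b_b [simp]: "b \<bullet> b = 1"
  by (simp add: inner_axis_axis)

lemma perp_b [simp]: "perp z \<bullet> b = 0" "b \<bullet> perp z = 0"
  by (auto simp: perp_def inner_diff_left inner_diff_right inner_commute)

lemma decomp: "(z \<bullet> b) *\<^sub>R b + perp z = z"
  by (simp add: perp_def)

lemma decomp_inner: "z \<bullet> z = (z \<bullet> b)\<^sup>2 + perp z \<bullet> perp z"
  by (simp add: perp_def inner_diff_left inner_diff_right inner_commute power2_eq_square algebra_simps)

lemma compose_b [simp]: "y \<bullet> b = 0 \<Longrightarrow> (t *\<^sub>R b + y) \<bullet> b = t" "y \<bullet> b = 0 \<Longrightarrow> perp (t *\<^sub>R b + y) = y"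
  by (simp_all add: perp_def inner_add_left)

lemma finite_harcs: "finite (harcs \<sigma> v)"
  by (simp add: harcs_def finite_in_arcs finite_out_arcs)

lemma harcs_iff: "v \<in> verts G \<Longrightarrow> e \<in> harcs \<sigma> v \<longleftrightarrow> e \<in> arcs G \<and> base \<sigma> e = v"
  by (auto simp: harcs_def base_def)

lemma harcs_arcs: "e \<in> harcs \<sigma> v \<Longrightarrow> e \<in> arcs G \<and> base \<sigma> e = v"
  by (auto simp: harcs_def base_def split: if_splits)

lemma base_in_verts: "e \<in> arcs G \<Longrightarrow> base \<sigma> e \<in> verts G"
  by (simp add: base_def)

lemma interior_in_verts: "interior_vert v \<Longrightarrow> v \<in> verts G"
  by (simp add: interior_vert_def)

lemma m_pos: "interior_vert v \<Longrightarrow> 0 < m \<sigma> v"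
  by (simp add: m_def interior_vert_def finite_harcs card_gt_0_iff)

lemma base_neq: "e \<in> arcs G \<Longrightarrow> base True e \<noteq> base False e"
  using g_gap[of e] \<delta> by (auto simp: base_def)

lemma len_ge: "e \<in> arcs G \<Longrightarrow> 2 * \<delta> \<le> len e"
  using g_gap[of e] by (simp add: len_def)

lemma len_pos: "e \<in> arcs G \<Longrightarrow> 0 < len e"
  using len_ge[of e] \<delta> by simp

lemma g_base: "g (base (\<not> \<sigma>) e) = g (base \<sigma> e) + sg \<sigma> * len e"
  by (cases \<sigma>) (auto simp: base_def len_def)

text \<open>Total degree one leaves a single edge on a single side. Consequently the centre of a
  ball is reached by one edge chart only.\<close>

lemma cap_unique:
  assumes "e \<in> arcs G" "e' \<in> arcs G" "base \<sigma> e = v" "base \<sigma>' e' = v" "\<not> interior_vert v"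
  shows "e = e' \<and> \<sigma> = \<sigma>'"
proof -
  have v: "v \<in> verts G" using assms base_in_verts by auto
  then have 1: "card (in_arcs G v) + card (out_arcs G v) = 1"
    using degrees[OF v] assms(5) by (auto simp: interior_vert_def harcs_def in_degree_def out_degree_def split: if_splits)
  have fin: "finite (in_arcs G v)" "finite (out_arcs G v)" by auto
  have mem: "e \<in> harcs \<sigma> v" "e' \<in> harcs \<sigma>' v" using assms v by (auto simp: harcs_iff)
  consider "card (in_arcs G v) = 0" "card (out_arcs G v) = 1" | "card (in_arcs G v) = 1" "card (out_arcs G v) = 0"
    using 1 by linarith
  then show ?thesis
  proof cases
    case 1
    obtain x where "out_arcs G v = {x}" by (rule card_1_singletonE[OF 1(2)])
    moreover have "in_arcs G v = {}" using 1(1) fin(1) by (rule card_0_eq[THEN iffD1, rotated])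
    ultimately show ?thesis
      using mem by (cases \<sigma>; cases \<sigma>'; simp add: harcs_def del: in_in_arcs_conv in_out_arcs_conv)
  next
    case 2
    obtain x where "in_arcs G v = {x}" by (rule card_1_singletonE[OF 2(1)])
    moreover have "out_arcs G v = {}" using 2(2) fin(2) by (rule card_0_eq[THEN iffD1, rotated])
    ultimately show ?thesis
      using mem by (cases \<sigma>; cases \<sigma>'; simp add: harcs_def del: in_in_arcs_conv in_out_arcs_conv)
  qed
qed

lemma arm_bij: "bij_betw (arm \<sigma> v) {..<m \<sigma> v} (harcs \<sigma> v)"
proof -
  obtain f where "bij_betw f {..<m \<sigma> v} (harcs \<sigma> v)"
    using ex_bij_betw_nat_finite[OF finite_harcs[of \<sigma> v]] by (auto simp: m_def atLeast0LessThan)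
  then show ?thesis unfolding arm_def by (rule someI[where P="\<lambda>f. bij_betw f _ _"])
qed

lemma armZ_in: "interior_vert v \<Longrightarrow> armZ \<sigma> v k \<in> harcs \<sigma> v"
  using bij_betwE[OF arm_bij[of \<sigma> v]] m_pos[of v \<sigma>] by (auto simp: armZ_def nat_less_iff)

lemma armZ_eq_iff:
  assumes "interior_vert v"
  shows "armZ \<sigma> v k = armZ \<sigma> v l \<longleftrightarrow> k mod int (m \<sigma> v) = l mod int (m \<sigma> v)"
proof -
  have "inj_on (arm \<sigma> v) {..<m \<sigma> v}" using arm_bij by (simp add: bij_betw_def)
  then show ?thesis
    using m_pos[OF assms, of \<sigma>] by (auto simp: armZ_def inj_on_eq_iff nat_less_iff nat_eq_iff2)
qed

lemma armZ_surj:
  assumes "interior_vert v" "e \<in> harcs \<sigma> v"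
  obtains k where "armZ \<sigma> v k = e"
proof -
  obtain j where j: "j < m \<sigma> v" "arm \<sigma> v j = e"
    using assms(2) arm_bij[of \<sigma> v] unfolding bij_betw_def by (metis imageE lessThan_iff)
  then have "armZ \<sigma> v (int j) = e" by (simp add: armZ_def)
  then show ?thesis using that by blast
qed

lemma phase_shift: "phase \<sigma> v (\<theta> + of_int k) = phase \<sigma> v \<theta> + of_int (int (m \<sigma> v) * k)"
  by (simp add: phase_def algebra_simps)

lemma \<phi>_shift: "\<phi> \<sigma> v (\<theta> + of_int k) = \<phi> \<sigma> v \<theta>"
  by (simp add: \<phi>_def phase_shift sin_sq_shift del: of_int_mult)

lemma h_shift: "h \<sigma> v (\<theta> + of_int k) s = h \<sigma> v \<theta> s"
  by (simp add: h_def \<phi>_shift)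

lemma admissible_shift: "admissible v (\<theta> + of_int k) s Y = admissible v \<theta> s Y"
  by (simp add: admissible_def h_shift)

lemma N_shift:
  assumes "interior_vert v"
  shows "N v (\<theta> + of_int k) s Y = N v \<theta> s Y"
proof -
  have 1: "frac (x + of_int k) = frac x" for x :: real and k by (simp add: frac_def)
  have "armZ \<sigma> v \<lfloor>phase \<sigma> v (\<theta> + of_int k)\<rfloor> = armZ \<sigma> v \<lfloor>phase \<sigma> v \<theta>\<rfloor>" for \<sigma>
    by (simp add: phase_shift armZ_eq_iff[OF assms] del: of_int_mult)
  then show ?thesis by (simp add: N_def direction_def h_shift phase_shift 1 del: of_int_mult)
qed

lemma \<phi>_nonneg: "0 \<le> \<phi> \<sigma> v \<theta>" and \<phi>_le_1: "\<phi> \<sigma> v \<theta> \<le> 1"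
  by (simp_all add: \<phi>_def abs_square_le_1)

text \<open>At a common zero, \<open>l * \<theta> = i\<close> and
  \<open>k * \<theta> + 1 / (2 * l) = j\<close> are integers, where \<open>l = m True v\<close> and
  \<open>k = m False v\<close>. Multiplying the second by \<open>2 * l\<close> gives
  \<open>2 * k * i + 1 = 2 * l * j\<close>, an odd number equal to an even one.\<close>

lemma \<phi>_sum_pos:
  assumes v: "interior_vert v"
  shows "0 < \<phi> True v \<theta> + \<phi> False v \<theta>"
proof (rule ccontr)
  assume "\<not> ?thesis"
  then have "\<phi> True v \<theta> = 0" "\<phi> False v \<theta> = 0"
    using \<phi>_nonneg[of True v \<theta>] \<phi>_nonneg[of False v \<theta>] by auto
  then obtain i j :: int where "pi * phase True v \<theta> = of_int i * pi" "pi * phase False v \<theta> = of_int j * pi"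
    by (auto simp: \<phi>_def sin_zero_iff_int2)
  then have ij: "real (m True v) * \<theta> = of_int i" "real (m False v) * \<theta> + 1 / (2 * real (m True v)) = of_int j"
    by (simp_all add: phase_def)
  have "0 < real (m True v)" using m_pos[OF v] by simp
  then have "2 * real (m True v) * of_int j = 2 * real (m False v) * (real (m True v) * \<theta>) + 1"
    unfolding ij(2)[symmetric] by (simp add: field_simps)
  then have "2 * real (m False v) * of_int i + 1 = 2 * real (m True v) * of_int j"
    by (simp add: ij(1))
  then have "real_of_int (2 * (int (m False v) * i) + 1) = real_of_int (2 * (int (m True v) * j))" by simp
  then have "2 * (int (m False v) * i) + 1 = 2 * (int (m True v) * j)" by (simp only: of_int_eq_iff)
  then show False by presburger
qed

lemma h_sum: "h \<sigma> v \<theta> s + h (\<not> \<sigma>) v \<theta> s = \<phi> True v \<theta> + \<phi> False v \<theta>"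
  by (cases \<sigma>) (auto simp: h_def)

lemma admissibleD:
  assumes "admissible v \<theta> s Y"
  shows "Y \<bullet> b = 0" "b \<bullet> Y = 0" "\<bar>s\<bar> < \<delta>" "Y \<bullet> Y = h \<sigma> v \<theta> s * h (\<not> \<sigma>) v \<theta> s" "0 \<le> h \<sigma> v \<theta> s"
  using assms by (cases \<sigma>; auto simp: admissible_def inner_commute)+

text \<open>Off the level 0, the factor on the side of \<open>s\<close> is
  \<open>\<phi> \<sigma> v \<theta> - \<bar>s\<bar>\<close> and nonnegative, so \<theta> is not a
  zero of \<phi>. This is the cutting of the circle into arms.\<close>

lemma admissible_side:
  assumes "admissible v \<theta> s Y" "s \<noteq> 0" "\<sigma> = (0 < s)"
  shows "\<bar>s\<bar> \<le> \<phi> \<sigma> v \<theta>" "phase \<sigma> v \<theta> \<notin> \<int>" "0 < h (\<not> \<sigma>) v \<theta> s" "h \<sigma> v \<theta> s = \<phi> \<sigma> v \<theta> - \<bar>s\<bar>"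
proof -
  show 1: "h \<sigma> v \<theta> s = \<phi> \<sigma> v \<theta> - \<bar>s\<bar>" using assms by (auto simp: h_def sg_def)
  then show 2: "\<bar>s\<bar> \<le> \<phi> \<sigma> v \<theta>" using admissibleD(5)[OF assms(1), of \<sigma>] by simp
  show "phase \<sigma> v \<theta> \<notin> \<int>" using sin_sq_Ints[of "phase \<sigma> v \<theta>"] 2 assms(2) by (auto simp: \<phi>_def)
  show "0 < h (\<not> \<sigma>) v \<theta> s"
    using \<phi>_nonneg[of "\<not> \<sigma>" v \<theta>] assms(2,3) by (auto simp: h_def sg_def)
qed

text \<open>The squared cosine is \<open>1 - \<phi>\<close> and \<open>|y|^2\<close> is the factor
  \<open>\<phi> - \<bar>s\<bar>\<close>; they add up to \<open>1 - \<bar>s\<bar>\<close>.\<close>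

lemma direction_unit:
  assumes "admissible v \<theta> s Y" "s \<noteq> 0" "\<sigma> = (0 < s)"
  shows "direction \<sigma> v \<theta> s Y \<bullet> direction \<sigma> v \<theta> s Y = 1"
proof -
  note side = admissible_side[OF assms]
  let ?u = "cos (pi * frac (phase \<sigma> v \<theta>))" and ?r = "1 / sqrt (h (\<not> \<sigma>) v \<theta> s)"
  have s1: "\<bar>s\<bar> < 1" using admissibleD(3)[OF assms(1)] \<delta> by simp
  have u: "?u\<^sup>2 = 1 - \<phi> \<sigma> v \<theta>"
    using sin_sq_frac[of "phase \<sigma> v \<theta>"] by (simp add: \<phi>_def cos_squared_eq)
  have "(?r *\<^sub>R Y) \<bullet> (?r *\<^sub>R Y) = ?r * ?r * (h \<sigma> v \<theta> s * h (\<not> \<sigma>) v \<theta> s)"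
    using admissibleD(4)[OF assms(1), of \<sigma>] by simp
  also have "\<dots> = h \<sigma> v \<theta> s" using side(3) by (simp add: field_simps)
  finally have "(?u *\<^sub>R b + ?r *\<^sub>R Y) \<bullet> (?u *\<^sub>R b + ?r *\<^sub>R Y) = 1 - \<bar>s\<bar>"
    using admissibleD(1,2)[OF assms(1)] u side(4)
    by (simp add: inner_add_left inner_add_right power2_eq_square)
  then show ?thesis using s1 unfolding direction_def inner_scaleR_left inner_scaleR_right by simp
qed

definition "labels = Inl ` verts G \<union> Inr ` arcs G"

lemma labels [simp]: "Inl v \<in> labels \<longleftrightarrow> v \<in> verts G" "Inr e \<in> labels \<longleftrightarrow> e \<in> arcs G"
  by (auto simp: labels_def)

lemmas mk_sel = mk[folded labels_def]

lemma mk_eq_iff: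
  assumes "l \<in> labels" "l' \<in> labels"
  shows "mk l t x = mk l' t' x' \<longleftrightarrow> l = l' \<and> t = t' \<and> x = x'"
  using mk_sel[OF assms(1), of t x] mk_sel[OF assms(2), of t' x'] by metis

lemma armZ_arcs: "interior_vert v \<Longrightarrow> armZ \<sigma> v k \<in> arcs G" "interior_vert v \<Longrightarrow> base \<sigma> (armZ \<sigma> v k) = v"
  using armZ_in harcs_arcs by blast+

text \<open>Off the zero level the label gives the integer part of the phase modulo
  \<open>m \<sigma> v\<close>, and the direction gives its fractional part because the cosine is
  injective on [0, pi]. So the phase is known modulo \<open>m \<sigma> v\<close>, that is, \<theta>
  modulo 1. On the zero level the code stores \<open>frac \<theta>\<close> and \<open>Y\<close>
  themselves.\<close>

lemma N_inj:
  assumes v: "interior_vert v" and T: "admissible v \<theta> s Y" "admissible v \<theta>' s' Y'" and eq: "N v \<theta> s Y = N v \<theta>' s' Y'"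
  shows "s = s'" "Y = Y'" "\<theta> - \<theta>' \<in> \<int>"
proof -
  note lab = armZ_arcs(1)[OF v] interior_in_verts[OF v]
  show s: "s = s'" using eq by (auto simp: N_def mk_eq_iff lab split: if_splits)
  have "Y = Y' \<and> \<theta> - \<theta>' \<in> \<int>"
  proof (cases "s = 0")
    case True
    then show ?thesis using eq s by (simp add: N_def mk_eq_iff lab frac_eq_iff)
  next
    case False
    define \<sigma> where "\<sigma> = (0 < s)"
    have \<sigma>': "\<sigma> = (0 < s')" using s by (simp add: \<sigma>_def)
    note side = admissible_side[OF T(1) False \<sigma>_def]
    have s1: "\<bar>s\<bar> < 1" using admissibleD(3)[OF T(1)] \<delta> by simp
    have arm: "armZ \<sigma> v \<lfloor>phase \<sigma> v \<theta>\<rfloor> = armZ \<sigma> v \<lfloor>phase \<sigma> v \<theta>'\<rfloor>" and om: "direction \<sigma> v \<theta> s Y = direction \<sigma> v \<theta>' s Y'"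
      using eq False s by (simp_all add: N_def mk_eq_iff lab \<sigma>_def)
    let ?u = "\<lambda>\<theta>. cos (pi * frac (phase \<sigma> v \<theta>))" and ?r = "\<lambda>\<theta>. 1 / sqrt (h (\<not> \<sigma>) v \<theta> s)"
    have om': "?u \<theta> *\<^sub>R b + ?r \<theta> *\<^sub>R Y = ?u \<theta>' *\<^sub>R b + ?r \<theta>' *\<^sub>R Y'"
      using om s1 by (simp add: direction_def)
    have u: "?u \<theta> = ?u \<theta>'"
      using arg_cong[OF om', of "\<lambda>z. z \<bullet> b"] admissibleD(1)[OF T(1)] admissibleD(1)[OF T(2)] by (simp add: inner_add_left)
    have "0 \<le> pi * frac x" "pi * frac x \<le> pi" for x :: real
      using frac_ge_0[of x] frac_lt_1[of x] by simp_all
    from cos_inj_pi[OF this this u] have "pi * frac (phase \<sigma> v \<theta>) = pi * frac (phase \<sigma> v \<theta>')" .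
    then have fr: "frac (phase \<sigma> v \<theta>) = frac (phase \<sigma> v \<theta>')" by simp
    have "int (m \<sigma> v) dvd \<lfloor>phase \<sigma> v \<theta>\<rfloor> - \<lfloor>phase \<sigma> v \<theta>'\<rfloor>"
      using arm by (simp add: armZ_eq_iff[OF v] mod_eq_dvd_iff)
    then obtain k where "\<lfloor>phase \<sigma> v \<theta>\<rfloor> - \<lfloor>phase \<sigma> v \<theta>'\<rfloor> = int (m \<sigma> v) * k"
      by (rule dvdE)
    then have "real_of_int (\<lfloor>phase \<sigma> v \<theta>\<rfloor> - \<lfloor>phase \<sigma> v \<theta>'\<rfloor>) = real_of_int (int (m \<sigma> v) * k)"
      by (rule arg_cong)
    then have "phase \<sigma> v \<theta> = phase \<sigma> v \<theta>' + real (m \<sigma> v) * of_int k"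
      using fr by (simp add: frac_def algebra_simps)
    then have "real (m \<sigma> v) * (\<theta> - \<theta>') = real (m \<sigma> v) * of_int k" by (simp add: phase_def algebra_simps)
    then have k: "\<theta> = \<theta>' + of_int k" using m_pos[OF v, of \<sigma>] by simp
    \<comment> \<open>Angles that agree modulo 1 have equal factors, so the vector part of
      \<open>om'\<close> can be divided by the common \<open>?r\<close>.\<close>
    then have "?r \<theta> = ?r \<theta>'" by (simp add: h_shift)
    moreover have "?r \<theta> \<noteq> 0" using side(3) by simp
    ultimately show ?thesis using om' u k by simp
  qed
  then show "Y = Y'" "\<theta> - \<theta>' \<in> \<int>" by auto
qed

lemma N_point:
  assumes v: "interior_vert v" and T: "admissible v \<theta> s Y"
  shows "s = 0 \<Longrightarrow> lab (N v \<theta> s Y) = Inl v"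
    and "s \<noteq> 0 \<Longrightarrow> lab (N v \<theta> s Y) = Inr (armZ (0 < s) v \<lfloor>phase (0 < s) v \<theta>\<rfloor>)"
    and "s \<noteq> 0 \<Longrightarrow> hgt (N v \<theta> s Y) = g v + s"
  using armZ_arcs[OF v] interior_in_verts[OF v] by (auto simp: N_def mk_sel)


section \<open>Regularity of the coordinate functions; domains and inverses of the charts\<close>

lemma continuous_on_phase [continuous_intros]:
  "continuous_on S f \<Longrightarrow> continuous_on S (\<lambda>x. phase \<sigma> v (f x))"
  unfolding phase_def by (intro continuous_on_add continuous_on_mult continuous_on_const)

lemma continuous_on_\<phi> [continuous_intros]:
  fixes f :: "'x::t2_space \<Rightarrow> real"
  shows "continuous_on S f \<Longrightarrow> continuous_on S (\<lambda>x. \<phi> \<sigma> v (f x))"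
  unfolding \<phi>_def by (intro continuous_intros)

lemma continuous_on_perp [continuous_intros]:
  "continuous_on S f \<Longrightarrow> continuous_on S (\<lambda>x. perp (f x))"
  unfolding perp_def by (intro continuous_intros)

lemma smooth_on_phase: "open S \<Longrightarrow> smooth_on S f \<Longrightarrow> smooth_on S (\<lambda>x. phase \<sigma> v (f x))"
  unfolding phase_def by (intro smooth_on_intros)

lemma smooth_on_\<phi>: "open S \<Longrightarrow> smooth_on S f \<Longrightarrow> smooth_on S (\<lambda>x. \<phi> \<sigma> v (f x))"
  unfolding \<phi>_def power2_eq_square by (intro smooth_on_intros smooth_on_phase)

lemma smooth_on_perp: "open S \<Longrightarrow> smooth_on S f \<Longrightarrow> smooth_on S (\<lambda>x. perp (f x))"
  unfolding perp_def by (intro smooth_on_intros)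

lemma open_V: "open (V i)"
proof (cases i)
  case (EI \<sigma> e)
  have "open {z :: real ^ 'n. z \<bullet> z < len e}" "open (- {0 :: real ^ 'n})"
    by (auto intro!: open_Collect_less continuous_intros)
  moreover have "V i = (if interior_vert (base \<sigma> e) then {z. z \<bullet> z < len e} \<inter> - {0} else {z. z \<bullet> z < len e})"
    by (auto simp: EI V.simps)
  ultimately show ?thesis by auto
next
  case (QI \<sigma> \<alpha> v)
  show ?thesis unfolding QI V.simps
    by (intro open_Collect_conj open_Collect_less continuous_intros)
qed

text \<open>The representative of \<theta> modulo 1 in the window that starts at the cut \<alpha>;
  it is smooth in \<theta> away from the cut.\<close>

definition "lift \<alpha> \<theta> = (\<alpha> :: real) + frac (\<theta> - \<alpha>)"

lemma lift_shift: obtains k where "lift \<alpha> \<theta> = \<theta> + of_int k"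
  by (rule that[of "- \<lfloor>\<theta> - \<alpha>\<rfloor>"]) (simp add: lift_def frac_def)

lemma lift_bounds: "\<theta> - \<alpha> \<notin> \<int> \<Longrightarrow> \<alpha> < lift \<alpha> \<theta> \<and> lift \<alpha> \<theta> < \<alpha> + 1"
  using frac_lt_1[of "\<theta> - \<alpha>"] frac_gt_0_iff[of "\<theta> - \<alpha>"] by (simp add: lift_def)

lemma lift_notin: "\<alpha> < (\<theta> :: real) \<Longrightarrow> \<theta> < \<alpha> + 1 \<Longrightarrow> \<theta> - \<theta>' \<in> \<int> \<Longrightarrow> \<theta>' - \<alpha> \<notin> \<int>"
proof
  assume *: "\<alpha> < \<theta>" "\<theta> < \<alpha> + 1" "\<theta> - \<theta>' \<in> \<int>" "\<theta>' - \<alpha> \<in> \<int>"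
  then have "\<theta> - \<alpha> \<in> \<int>" using Ints_add[of "\<theta> - \<theta>'" "\<theta>' - \<alpha>"] by simp
  then obtain k where "\<theta> - \<alpha> = of_int k" by (auto elim: Ints_cases)
  then have "0 < real_of_int k" "real_of_int k < 1" using *(1,2) by linarith+
  then show False by simp
qed

lemma vertex_chart_admissible:
  assumes v: "interior_vert v" and z: "z \<in> V (QI \<sigma> \<alpha> v)"
  defines "s \<equiv> sg \<sigma> * (\<phi> \<sigma> v (z \<bullet> b) - perp z \<bullet> perp z)"
    and "Y \<equiv> sqrt (\<phi> True v (z \<bullet> b) + \<phi> False v (z \<bullet> b) - perp z \<bullet> perp z) *\<^sub>R perp z"
  shows "admissible v (z \<bullet> b) s Y" "h \<sigma> v (z \<bullet> b) s = perp z \<bullet> perp z" "0 < h (\<not> \<sigma>) v (z \<bullet> b) s"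
    "\<psi> (QI \<sigma> \<alpha> v) z = N v (z \<bullet> b) s Y" "(1 / sqrt (h (\<not> \<sigma>) v (z \<bullet> b) s)) *\<^sub>R Y = perp z"
    "Y = sqrt (h (\<not> \<sigma>) v (z \<bullet> b) s) *\<^sub>R perp z" "\<bar>s\<bar> < \<delta>"
proof -
  show 1: "h \<sigma> v (z \<bullet> b) s = perp z \<bullet> perp z" by (simp add: h_def s_def)
  then have 2: "h (\<not> \<sigma>) v (z \<bullet> b) s = \<phi> True v (z \<bullet> b) + \<phi> False v (z \<bullet> b) - perp z \<bullet> perp z"
    using h_sum[of \<sigma> v "z \<bullet> b" s] by simp
  show 3: "0 < h (\<not> \<sigma>) v (z \<bullet> b) s" using z 2 by (simp add: V.simps)
  show 4: "Y = sqrt (h (\<not> \<sigma>) v (z \<bullet> b) s) *\<^sub>R perp z" by (simp add: Y_def 2)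
  show "(1 / sqrt (h (\<not> \<sigma>) v (z \<bullet> b) s)) *\<^sub>R Y = perp z" using 3 by (simp add: 4)
  show "\<psi> (QI \<sigma> \<alpha> v) z = N v (z \<bullet> b) s Y" by (simp add: \<psi>.simps s_def Y_def)
  show 5: "\<bar>s\<bar> < \<delta>" using z by (simp add: V.simps s_def)
  have "Y \<bullet> Y = h \<sigma> v (z \<bullet> b) s * h (\<not> \<sigma>) v (z \<bullet> b) s" using 3 by (simp add: 1 4)
  moreover have "0 \<le> h \<sigma>' v (z \<bullet> b) s" for \<sigma>' using 1 3 by (cases "\<sigma>' = \<sigma>") auto
  moreover have "Y \<bullet> b = 0" by (simp add: Y_def)
  ultimately show "admissible v (z \<bullet> b) s Y"
    using 5 unfolding admissible_def by (cases \<sigma>) (auto simp: mult.commute)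
qed

text \<open>Dividing \<open>Y\<close> by the root of the opposite factor inverts the
  parametrization, so the chart reaches every point of its window at which that factor is
  positive.\<close>

lemma vertex_chart_inverse:
  assumes T: "admissible v \<theta> s Y" and \<theta>: "\<alpha> < \<theta>" "\<theta> < \<alpha> + 1" and pos: "0 < h (\<not> \<sigma>) v \<theta> s"
  defines "z \<equiv> \<theta> *\<^sub>R b + (1 / sqrt (h (\<not> \<sigma>) v \<theta> s)) *\<^sub>R Y"
  shows "z \<in> V (QI \<sigma> \<alpha> v)" "\<psi> (QI \<sigma> \<alpha> v) z = N v \<theta> s Y"
    "z \<bullet> b = \<theta>" "perp z = (1 / sqrt (h (\<not> \<sigma>) v \<theta> s)) *\<^sub>R Y"
proof -
  show 1: "z \<bullet> b = \<theta>" "perp z = (1 / sqrt (h (\<not> \<sigma>) v \<theta> s)) *\<^sub>R Y"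
    using admissibleD(1)[OF T] unfolding z_def by (subst compose_b; simp)+
  have 2: "perp z \<bullet> perp z = h \<sigma> v \<theta> s"
    using admissibleD(4)[OF T, of \<sigma>] pos by (simp add: 1(2) field_simps)
  have s: "sg \<sigma> * (\<phi> \<sigma> v \<theta> - perp z \<bullet> perp z) = s" by (simp add: 2 h_def)
  have 3: "\<phi> True v \<theta> + \<phi> False v \<theta> - perp z \<bullet> perp z = h (\<not> \<sigma>) v \<theta> s"
    using h_sum[of \<sigma> v \<theta> s] by (simp add: 2)
  have "\<bar>\<phi> \<sigma> v \<theta> - perp z \<bullet> perp z\<bar> = \<bar>s\<bar>" by (simp add: 2 h_def)
  then show "z \<in> V (QI \<sigma> \<alpha> v)"
    using \<theta> admissibleD(3)[OF T] 3 pos by (simp add: V.simps 1(1))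
  show "\<psi> (QI \<sigma> \<alpha> v) z = N v \<theta> s Y"
    using pos by (simp add: \<psi>.simps 1(1) s 3) (simp add: 1(2))
qed

lemma inj_edge_chart:
  assumes e: "e \<in> arcs G"
  shows "inj_on (\<psi> (EI \<sigma> e)) (V (EI \<sigma> e))"
proof (rule inj_onI)
  fix z z' assume z: "z \<in> V (EI \<sigma> e)" "z' \<in> V (EI \<sigma> e)" "\<psi> (EI \<sigma> e) z = \<psi> (EI \<sigma> e) z'"
  consider "z = 0" "z' = 0" | "z \<noteq> 0" "z' \<noteq> 0"
    using z(3) e base_in_verts[OF e] by (cases "z = 0"; cases "z' = 0"; simp add: \<psi>.simps mk_eq_iff)
  then show "z = z'"
  proof cases
    case 2
    then have "z \<bullet> z = z' \<bullet> z'" "(1 / sqrt (z \<bullet> z)) *\<^sub>R z = (1 / sqrt (z' \<bullet> z')) *\<^sub>R z'"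
      using z(3) e by (auto simp: \<psi>.simps mk_eq_iff)
    then show ?thesis using 2 by simp
  qed simp
qed

text \<open>Equal points have angles that differ by an integer, and the open window has length
  1.\<close>

lemma inj_vertex_chart:
  assumes v: "interior_vert v"
  shows "inj_on (\<psi> (QI \<sigma> \<alpha> v)) (V (QI \<sigma> \<alpha> v))"
proof (rule inj_onI)
  fix z z' assume z: "z \<in> V (QI \<sigma> \<alpha> v)" "z' \<in> V (QI \<sigma> \<alpha> v)" "\<psi> (QI \<sigma> \<alpha> v) z = \<psi> (QI \<sigma> \<alpha> v) z'"
  define s where "s = sg \<sigma> * (\<phi> \<sigma> v (z \<bullet> b) - perp z \<bullet> perp z)"
  define s' where "s' = sg \<sigma> * (\<phi> \<sigma> v (z' \<bullet> b) - perp z' \<bullet> perp z')"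
  define Y where "Y = sqrt (\<phi> True v (z \<bullet> b) + \<phi> False v (z \<bullet> b) - perp z \<bullet> perp z) *\<^sub>R perp z"
  define Y' where "Y' = sqrt (\<phi> True v (z' \<bullet> b) + \<phi> False v (z' \<bullet> b) - perp z' \<bullet> perp z') *\<^sub>R perp z'"
  note Q = vertex_chart_admissible[OF v z(1), folded s_def Y_def] and Q' = vertex_chart_admissible[OF v z(2), folded s'_def Y'_def]
  note inj = N_inj[OF v Q(1) Q'(1) z(3)[unfolded Q(4) Q'(4)]]
  obtain k where k: "z \<bullet> b - z' \<bullet> b = of_int k" using inj(3) by (auto elim: Ints_cases)
  have "\<bar>z \<bullet> b - z' \<bullet> b\<bar> < 1" using z(1,2) by (auto simp: V.simps)
  then have "real_of_int \<bar>k\<bar> < 1" unfolding k by simp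
  then have "k = 0" by linarith
  then have 1: "z \<bullet> b = z' \<bullet> b" using k by simp
  have "perp z = (1 / sqrt (h (\<not> \<sigma>) v (z \<bullet> b) s)) *\<^sub>R Y" by (rule Q(5)[symmetric])
  also have "\<dots> = (1 / sqrt (h (\<not> \<sigma>) v (z' \<bullet> b) s')) *\<^sub>R Y'" by (simp only: 1 inj)
  also have "\<dots> = perp z'" by (rule Q'(5))
  finally have "perp z = perp z'" .
  then show "z = z'" using 1 decomp[of z] decomp[of z'] by metis
qed

lemma inj_\<psi>: "i \<in> I \<Longrightarrow> inj_on (\<psi> i) (V i)"
  using inj_edge_chart inj_vertex_chart by (auto simp: I_def)

text \<open>Height differences to the two ends add up to \<open>len e\<close>, so changing ends
  keeps the direction and replaces the squared radius \<open>d\<close> by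
  \<open>len e - d\<close>.\<close>

lemma edge_chart_flip:
  assumes e: "e \<in> arcs G" and z: "z \<in> V (EI \<sigma> e)" "z \<noteq> 0"
  defines "z' \<equiv> (sqrt (len e - z \<bullet> z) / sqrt (z \<bullet> z)) *\<^sub>R z"
  shows "z' \<in> V (EI (\<not> \<sigma>) e)" "\<psi> (EI (\<not> \<sigma>) e) z' = \<psi> (EI \<sigma> e) z"
proof -
  have pos: "0 < z \<bullet> z" "0 < len e - z \<bullet> z" using z by (auto simp: V.simps)
  then have zz: "z' \<bullet> z' = len e - z \<bullet> z" by (simp add: z'_def field_simps)
  have nz: "z' \<noteq> 0" using zz pos by auto
  then show "z' \<in> V (EI (\<not> \<sigma>) e)" using pos zz by (auto simp: V.simps)
  have "(1 / sqrt (z' \<bullet> z')) *\<^sub>R z' = (1 / sqrt (z \<bullet> z)) *\<^sub>R z" unfolding zz using pos by (simp add: z'_def)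
  then show "\<psi> (EI (\<not> \<sigma>) e) z' = \<psi> (EI \<sigma> e) z"
    using nz z(2) by (simp add: \<psi>.simps zz g_base algebra_simps)
qed

lemma edge_chart_image: "e \<in> arcs G \<Longrightarrow> z \<in> V (EI \<sigma> e) \<Longrightarrow> z \<noteq> 0 \<Longrightarrow>
    \<psi> (EI \<sigma> e) z \<in> \<psi> (EI \<rho> e) ` V (EI \<rho> e)"
  using edge_chart_flip[of e z \<sigma>] by (cases "\<rho> = \<sigma>") (auto intro: rev_image_eqI)

section \<open>Explicit transition maps\<close>

lemma transition_edge_ends: 
  assumes e: "e \<in> arcs G"
  shows "smooth_transition V \<psi> (EI \<sigma> e) (EI (\<not> \<sigma>) e)"
proof (rule smooth_transitionI)
  let ?W = "V (EI \<sigma> e) \<inter> - {0}"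
  show op: "open ?W" using open_V by auto
  have "0 < z \<bullet> z \<and> 0 < len e - z \<bullet> z" if "z \<in> ?W" for z using that by (auto simp: V.simps)
  then show "smooth_on ?W (\<lambda>z. (sqrt (len e - z \<bullet> z) / sqrt (z \<bullet> z)) *\<^sub>R z)"
    using op by (intro smooth_on_intros) (auto simp: less_imp_neq)
  fix x y assume "x \<in> V (EI \<sigma> e)" "y \<in> V (EI (\<not> \<sigma>) e)" "\<psi> (EI \<sigma> e) x = \<psi> (EI (\<not> \<sigma>) e) y"
  then show "x \<in> ?W"
    using e base_in_verts[OF e] base_neq[OF e]
    by (cases \<sigma>; cases "x = 0"; cases "y = 0"; simp add: \<psi>.simps mk_eq_iff)
qed (use edge_chart_flip[OF e] in auto)

text \<open>The overlap consists of the points whose angle avoids the cut \<beta>; there the angle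
  moves by an integer, under which the model is invariant.\<close>

lemma transition_change_cut:
  assumes v: "interior_vert v"
  shows "smooth_transition V \<psi> (QI \<sigma> \<alpha> v) (QI \<sigma> \<beta> v)"
proof (rule smooth_transitionI)
  let ?W = "V (QI \<sigma> \<alpha> v) \<inter> (\<lambda>z. z \<bullet> b - \<beta>) -` {x. x \<notin> \<int>}"
  let ?t = "\<lambda>z. lift \<beta> (z \<bullet> b) *\<^sub>R b + perp z"
  show op: "open ?W"
    by (intro continuous_open_preimage open_V open_not_Ints continuous_intros)
  show "smooth_on ?W ?t"
    unfolding lift_def by (intro smooth_on_intros smooth_on_perp op) auto
  have *: "?t z \<in> V (QI \<sigma> \<beta> v) \<and> \<psi> (QI \<sigma> \<beta> v) (?t z) = \<psi> (QI \<sigma> \<alpha> v) z" if z: "z \<in> ?W" for z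
  proof -
    have zV: "z \<in> V (QI \<sigma> \<alpha> v)" using z by auto
    define s where "s = sg \<sigma> * (\<phi> \<sigma> v (z \<bullet> b) - perp z \<bullet> perp z)"
    define Y where "Y = sqrt (\<phi> True v (z \<bullet> b) + \<phi> False v (z \<bullet> b) - perp z \<bullet> perp z) *\<^sub>R perp z"
    note Q = vertex_chart_admissible[OF v zV, folded s_def Y_def]
    obtain k where k: "lift \<beta> (z \<bullet> b) = z \<bullet> b + of_int k" using lift_shift .
    have bd: "\<beta> < lift \<beta> (z \<bullet> b)" "lift \<beta> (z \<bullet> b) < \<beta> + 1" using lift_bounds z by auto
    have h: "h (\<not> \<sigma>) v (lift \<beta> (z \<bullet> b)) s = h (\<not> \<sigma>) v (z \<bullet> b) s" by (simp only: k h_shift)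
    have T: "admissible v (lift \<beta> (z \<bullet> b)) s Y" using Q(1) by (simp only: k admissible_shift)
    have "0 < h (\<not> \<sigma>) v (lift \<beta> (z \<bullet> b)) s" unfolding h by (rule Q(3))
    from vertex_chart_inverse(1,2)[OF T bd this, unfolded h Q(5)] show ?thesis
      unfolding Q(4) by (simp only: k N_shift[OF v])
  qed
  then show "?t ` ?W \<subseteq> V (QI \<sigma> \<beta> v)" "\<And>x. x \<in> ?W \<Longrightarrow> \<psi> (QI \<sigma> \<beta> v) (?t x) = \<psi> (QI \<sigma> \<alpha> v) x"
    by blast+
  fix x y assume xy: "x \<in> V (QI \<sigma> \<alpha> v)" "y \<in> V (QI \<sigma> \<beta> v)" "\<psi> (QI \<sigma> \<alpha> v) x = \<psi> (QI \<sigma> \<beta> v) y"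
  note Q = vertex_chart_admissible[OF v xy(1)] and Q' = vertex_chart_admissible[OF v xy(2)]
  have "y \<bullet> b - x \<bullet> b \<in> \<int>"
    by (rule N_inj(3)[OF v Q'(1) Q(1)]) (simp only: Q(4)[symmetric] Q'(4)[symmetric] xy(3))
  moreover have "\<beta> < y \<bullet> b" "y \<bullet> b < \<beta> + 1" using xy(2) by (auto simp: V.simps)
  ultimately show "x \<in> ?W" using lift_notin xy(1) by auto
qed auto

text \<open>As between two stereographic projections, \<open>Y\<close> is shared and
  \<open>y\<close> is rescaled by the quotient of the roots of the two factors. The factor that has
  to be positive in the new chart is \<open>|y|^2\<close>, so the overlap is given by
  \<open>y \<noteq> 0\<close>.\<close>

lemma transition_change_side:
  assumes v: "interior_vert v"
  shows "smooth_transition V \<psi> (QI \<sigma> \<alpha> v) (QI (\<not> \<sigma>) \<alpha> v)"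
proof (rule smooth_transitionI)
  let ?W = "V (QI \<sigma> \<alpha> v) \<inter> perp -` (- {0})"
  let ?\<Phi> = "\<lambda>z. \<phi> True v (z \<bullet> b) + \<phi> False v (z \<bullet> b) - perp z \<bullet> perp z"
  let ?t = "\<lambda>z. (z \<bullet> b) *\<^sub>R b + (sqrt (?\<Phi> z) / sqrt (perp z \<bullet> perp z)) *\<^sub>R perp z"
  show op: "open ?W"
    using continuous_on_perp[OF continuous_on_id] by (intro continuous_open_preimage open_V) (auto simp: id_def)
  have pos: "0 < ?\<Phi> z \<and> 0 < perp z \<bullet> perp z" if "z \<in> ?W" for z using that by (auto simp: V.simps)
  show "smooth_on ?W ?t"
    by (intro smooth_on_intros smooth_on_perp smooth_on_\<phi> op) (use pos in \<open>auto simp: less_imp_neq\<close>)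
  have *: "?t z \<in> V (QI (\<not> \<sigma>) \<alpha> v) \<and> \<psi> (QI (\<not> \<sigma>) \<alpha> v) (?t z) = \<psi> (QI \<sigma> \<alpha> v) z" if z: "z \<in> ?W" for z
  proof -
    have zV: "z \<in> V (QI \<sigma> \<alpha> v)" using z by auto
    note Q = vertex_chart_admissible[OF v zV]
    have bd: "\<alpha> < z \<bullet> b" "z \<bullet> b < \<alpha> + 1" using zV by (auto simp: V.simps)
    have h: "0 < h (\<not> \<not> \<sigma>) v (z \<bullet> b) (sg \<sigma> * (\<phi> \<sigma> v (z \<bullet> b) - perp z \<bullet> perp z))"
      using Q(2) pos[OF z] by simp
    show ?thesis
      using vertex_chart_inverse(1,2)[OF Q(1) bd h] Q(2,4) by (simp del: \<psi>.simps)
  qed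
  then show "?t ` ?W \<subseteq> V (QI (\<not> \<sigma>) \<alpha> v)"
    "\<And>x. x \<in> ?W \<Longrightarrow> \<psi> (QI (\<not> \<sigma>) \<alpha> v) (?t x) = \<psi> (QI \<sigma> \<alpha> v) x" by blast+
  fix x y assume xy: "x \<in> V (QI \<sigma> \<alpha> v)" "y \<in> V (QI (\<not> \<sigma>) \<alpha> v)" "\<psi> (QI \<sigma> \<alpha> v) x = \<psi> (QI (\<not> \<sigma>) \<alpha> v) y"
  note Q = vertex_chart_admissible[OF v xy(1)] and Q' = vertex_chart_admissible[OF v xy(2)]
  note inj = N_inj[OF v Q(1) Q'(1) xy(3)[unfolded Q(4) Q'(4)]]
  obtain k where "x \<bullet> b = y \<bullet> b + of_int k" using inj(3) by (auto elim!: Ints_cases simp: algebra_simps)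
  then have "0 < perp x \<bullet> perp x" using Q(2) Q'(3) inj(1) by (simp add: h_shift)
  then show "x \<in> ?W" using xy(1) by auto
qed auto

text \<open>The floor is locally constant off the integers, so which arm a phase selects is an open
  condition.\<close>

lemma open_floor_eq:
  obtains S where "open S" "\<And>x :: real. x \<notin> \<int> \<Longrightarrow> x \<in> S \<longleftrightarrow> P \<lfloor>x\<rfloor>"
proof (rule that)
  let ?S = "\<Union>k\<in>{k. P k}. {real_of_int k <..< real_of_int k + 1}"
  show "open ?S" by auto
  fix x :: real assume x: "x \<notin> \<int>"
  have 1: "x \<in> {of_int k <..< of_int k + 1} \<longleftrightarrow> k = \<lfloor>x\<rfloor>" for k
  proof
    assume "x \<in> {of_int k <..< of_int k + 1}"
    then show "k = \<lfloor>x\<rfloor>" by (intro floor_unique[symmetric]) auto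
  next
    assume k: "k = \<lfloor>x\<rfloor>"
    have "of_int \<lfloor>x\<rfloor> \<noteq> x" using x Ints_of_int[of "\<lfloor>x\<rfloor>"] by metis
    then have "of_int \<lfloor>x\<rfloor> < x" by (rule order.not_eq_order_implies_strict) (rule of_int_floor_le)
    then show "x \<in> {of_int k <..< of_int k + 1}" using real_of_int_floor_add_one_gt[of x] k by simp
  qed
  show "x \<in> ?S \<longleftrightarrow> P \<lfloor>x\<rfloor>" using 1 by auto
qed

text \<open>On the edge the radius is \<open>sqrt \<bar>s\<bar>\<close>; times the unit direction,
  and with \<open>d = \<bar>s\<bar>\<close>, this is \<open>(cos, y)\<close> scaled by
  \<open>sqrt (d / (1 - d))\<close>. Positivity of \<open>d\<close> selects the side and the integer
  part of the phase selects the arm.\<close>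

lemma transition_vertex_arm:
  assumes v: "interior_vert v" and e: "e \<in> harcs \<sigma> v"
  shows "smooth_transition V \<psi> (QI \<sigma> \<alpha> v) (EI \<sigma> e)"
proof -
  obtain S where S: "open S" "\<And>x :: real. x \<notin> \<int> \<Longrightarrow> x \<in> S \<longleftrightarrow> armZ \<sigma> v \<lfloor>x\<rfloor> = e"
    by (rule open_floor_eq[of "\<lambda>k. armZ \<sigma> v k = e"]) blast
  have eG: "e \<in> arcs G" "base \<sigma> e = v" using harcs_arcs[OF e] by auto
  let ?d = "\<lambda>z. \<phi> \<sigma> v (z \<bullet> b) - perp z \<bullet> perp z"
  let ?W = "V (QI \<sigma> \<alpha> v) \<inter> {z. 0 < ?d z} \<inter> (\<lambda>z. phase \<sigma> v (z \<bullet> b)) -` S"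
  let ?t = "\<lambda>z. (sqrt (?d z) / sqrt (1 - ?d z)) *\<^sub>R (cos (pi * frac (phase \<sigma> v (z \<bullet> b))) *\<^sub>R b + perp z)"
  show ?thesis
  proof (rule smooth_transitionI)
    have "open (V (QI \<sigma> \<alpha> v) \<inter> {z. 0 < ?d z})"
      by (intro open_Int open_V open_Collect_less continuous_intros)
    then show op: "open ?W"
      by (intro continuous_open_preimage S(1) continuous_intros)
    have bd: "0 < ?d z" "0 < 1 - ?d z" "phase \<sigma> v (z \<bullet> b) \<notin> \<int>" if z: "z \<in> ?W" for z
    proof -
      show "0 < ?d z" using z by auto
      moreover have "\<bar>?d z\<bar> < \<delta>" using z by (auto simp: V.simps)
      ultimately show "0 < 1 - ?d z" using \<delta> by auto
      have "0 < \<phi> \<sigma> v (z \<bullet> b)" using \<open>0 < ?d z\<close> inner_ge_zero[of "perp z"] by linarith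
      then show "phase \<sigma> v (z \<bullet> b) \<notin> \<int>" using sin_sq_Ints[of "phase \<sigma> v (z \<bullet> b)"] by (auto simp: \<phi>_def)
    qed
    show "smooth_on ?W ?t"
      by (intro smooth_on_intros smooth_on_perp smooth_on_\<phi> smooth_on_phase op) (use bd in \<open>auto simp: less_imp_neq\<close>)
    have *: "?t z \<in> V (EI \<sigma> e) \<and> \<psi> (EI \<sigma> e) (?t z) = \<psi> (QI \<sigma> \<alpha> v) z" if z: "z \<in> ?W" for z
    proof -
      have zV: "z \<in> V (QI \<sigma> \<alpha> v)" using z by auto
      define s where "s = sg \<sigma> * ?d z"
      define Y where "Y = sqrt (\<phi> True v (z \<bullet> b) + \<phi> False v (z \<bullet> b) - perp z \<bullet> perp z) *\<^sub>R perp z"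
      note Q = vertex_chart_admissible[OF v zV, folded s_def Y_def]
      have s: "s \<noteq> 0" "\<sigma> = (0 < s)" "\<bar>s\<bar> = ?d z" using bd(1)[OF z] by (auto simp: s_def sg_def)
      let ?o = "direction \<sigma> v (z \<bullet> b) s Y"
      have t: "?t z = sqrt (?d z) *\<^sub>R ?o" unfolding direction_def Q(5) s(3) by simp
      have oo: "?o \<bullet> ?o = 1" by (rule direction_unit[OF Q(1) s(1,2)])
      have tt: "?t z \<bullet> ?t z = ?d z" unfolding t using bd(1)[OF z] oo by simp
      then have nz: "?t z \<noteq> 0" using bd(1)[OF z] by auto
      have "?d z < len e" using Q(7) s(3) len_ge[OF eG(1)] \<delta> by simp
      then have 1: "?t z \<in> V (EI \<sigma> e)" using nz tt by (simp add: V.simps)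
      have "armZ \<sigma> v \<lfloor>phase \<sigma> v (z \<bullet> b)\<rfloor> = e" using z S(2)[OF bd(3)[OF z]] by auto
      then have "\<psi> (QI \<sigma> \<alpha> v) z = mk (Inr e) (g v + s) ?o"
        unfolding Q(4) N_def using s(1,2) by auto
      moreover have "(1 / sqrt (?t z \<bullet> ?t z)) *\<^sub>R ?t z = ?o" unfolding tt using bd(1)[OF z] by (simp add: t)
      ultimately have "\<psi> (EI \<sigma> e) (?t z) = \<psi> (QI \<sigma> \<alpha> v) z"
        using nz eG(2) unfolding \<psi>.simps(1) tt s_def by simp
      with 1 show ?thesis by blast
    qed
    then show "?t ` ?W \<subseteq> V (EI \<sigma> e)" "\<And>x. x \<in> ?W \<Longrightarrow> \<psi> (EI \<sigma> e) (?t x) = \<psi> (QI \<sigma> \<alpha> v) x" by blast+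
    fix x y assume xy: "x \<in> V (QI \<sigma> \<alpha> v)" "y \<in> V (EI \<sigma> e)" "\<psi> (QI \<sigma> \<alpha> v) x = \<psi> (EI \<sigma> e) y"
    define s where "s = sg \<sigma> * ?d x"
    note Q = vertex_chart_admissible[OF v xy(1), folded s_def]
    have y: "y \<noteq> 0" using xy(2) eG v by (auto simp: V.simps)
    then have l: "lab (\<psi> (EI \<sigma> e) y) = Inr e" "hgt (\<psi> (EI \<sigma> e) y) = g v + sg \<sigma> * (y \<bullet> y)"
      using eG by (simp_all add: \<psi>.simps mk_sel)
    then have s0: "s \<noteq> 0" using N_point(1)[OF v Q(1)] Q(4) xy(3) by auto
    then have s: "s = sg \<sigma> * (y \<bullet> y)" using N_point(3)[OF v Q(1)] Q(4) xy(3) l by simp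
    have "0 < y \<bullet> y" using y by simp
    moreover have "?d x = y \<bullet> y" using arg_cong[OF s, of "\<lambda>s. sg \<sigma> * s"] unfolding s_def by simp
    ultimately have d: "0 < ?d x" "(0 < s) = \<sigma>"
      unfolding s by (simp, cases \<sigma>) (auto simp: not_less)
    then have "armZ \<sigma> v \<lfloor>phase \<sigma> v (x \<bullet> b)\<rfloor> = e" using N_point(2)[OF v Q(1) s0] Q(4) xy(3) l by simp
    moreover have "phase \<sigma> v (x \<bullet> b) \<notin> \<int>" using admissible_side(2)[OF Q(1) s0] d(2) by simp
    ultimately show "x \<in> ?W" using S(2) xy(1) d(1) by auto
  qed auto
qed

text \<open>Solves \<open>phase \<sigma> v \<theta> = k + arccos u / pi\<close> for \<theta>, where
  \<open>u\<close> is the axis coordinate of \<open>z\<close> after rescaling from radius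
  \<open>|z|\<close> to radius \<open>sqrt (1 - |z|^2)\<close>. This recovers the angle from a point
  of the arm numbered \<open>k\<close>.\<close>

definition "arg_of \<sigma> v k z = (of_int k - (if \<sigma> then 0 else 1 / (2 * real (m True v))) +
  arccos (sqrt (1 - z \<bullet> z) / sqrt (z \<bullet> z) * (z \<bullet> b)) / pi) / real (m \<sigma> v)"

text \<open>Multiplication by \<open>\<kappa>\<close> takes the sphere of squared radius
  \<open>d = z \<bullet> z\<close> to that of squared radius \<open>1 - d\<close>, on which the
  model has the coordinates \<open>(cos, y)\<close>. Its axis coordinate satisfies
  \<open>u^2 \<le> 1 - d < 1\<close>, so \<open>arccos u\<close> stays strictly between 0 and pi,
  the integer part of the phase is \<open>k\<close>, and \<open>arccos\<close> is smooth
  there.\<close>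

lemma arm_param:
  assumes v: "interior_vert v" and z: "0 < z \<bullet> z" "z \<bullet> z < \<delta>" and e: "armZ \<sigma> v k = e"
  defines "\<kappa> \<equiv> sqrt (1 - z \<bullet> z) / sqrt (z \<bullet> z)"
    and "\<theta> \<equiv> arg_of \<sigma> v k z" and "s \<equiv> sg \<sigma> * (z \<bullet> z)"
  defines "Y \<equiv> (sqrt (h (\<not> \<sigma>) v \<theta> s) * \<kappa>) *\<^sub>R perp z"
  shows "\<bar>\<kappa> * (z \<bullet> b)\<bar> < 1" "admissible v \<theta> s Y" "0 < h (\<not> \<sigma>) v \<theta> s" "N v \<theta> s Y = \<psi> (EI \<sigma> e) z"
proof -
  define d where "d = z \<bullet> z"
  define u where "u = \<kappa> * (z \<bullet> b)"
  have d: "0 < d" "d < \<delta>" "d < 1" using z \<delta> by (auto simp: d_def)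
  have \<kappa>: "\<kappa> * \<kappa> = (1 - d) / d" "0 < \<kappa>" using d by (auto simp: \<kappa>_def d_def[symmetric] field_simps)
  have yy: "perp z \<bullet> perp z = d - (z \<bullet> b)\<^sup>2" using decomp_inner[of z] by (simp add: d_def)
  then have zb: "(z \<bullet> b)\<^sup>2 \<le> d" using inner_ge_zero[of "perp z"] by linarith
  have "u\<^sup>2 = \<kappa> * \<kappa> * (z \<bullet> b)\<^sup>2" by (simp add: u_def power2_eq_square)
  then have uu: "u\<^sup>2 = (1 - d) / d * (z \<bullet> b)\<^sup>2" unfolding \<kappa>(1) .
  have "(1 - d) / d * (z \<bullet> b)\<^sup>2 \<le> (1 - d) / d * d" using d zb by (intro mult_left_mono) auto
  then have "u\<^sup>2 \<le> 1 - d" unfolding uu using d by simp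
  then have u2: "u\<^sup>2 < 1" using d(1) by linarith
  then show u1: "\<bar>\<kappa> * (z \<bullet> b)\<bar> < 1" using abs_square_less_1[of u] by (simp add: u_def)
  have "real (m \<sigma> v) > 0" using m_pos[OF v] by simp
  then have phase: "phase \<sigma> v \<theta> = of_int k + arccos u / pi"
    by (simp add: phase_def \<theta>_def arg_of_def u_def \<kappa>_def)
  have "0 < arccos u" "arccos u < pi" using arccos_lt_bounded[of u] u1 by (auto simp: u_def abs_less_iff)
  then have fl: "\<lfloor>phase \<sigma> v \<theta>\<rfloor> = k" unfolding phase by (intro floor_unique) auto
  then have fr: "frac (phase \<sigma> v \<theta>) = arccos u / pi" unfolding frac_def by (simp add: phase)
  have cu: "cos (pi * frac (phase \<sigma> v \<theta>)) = u" unfolding fr using u1 by (simp add: u_def abs_less_iff)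
  have \<phi>: "\<phi> \<sigma> v \<theta> = 1 - u\<^sup>2"
    using sin_sq_frac[of "phase \<sigma> v \<theta>"] cu by (simp add: \<phi>_def sin_squared_eq)
  have kyy: "\<kappa> * \<kappa> * (perp z \<bullet> perp z) = 1 - d - u\<^sup>2"
    unfolding yy uu \<kappa>(1) using d by (simp add: field_simps)
  have hs: "h \<sigma> v \<theta> s = \<kappa> * \<kappa> * (perp z \<bullet> perp z)" unfolding kyy by (simp add: h_def \<phi> s_def d_def)
  have "h (\<not> \<sigma>) v \<theta> s = \<phi> (\<not> \<sigma>) v \<theta> + d" by (simp add: h_def s_def d_def)
  then show hn: "0 < h (\<not> \<sigma>) v \<theta> s" using d \<phi>_nonneg[of "\<not> \<sigma>" v \<theta>] by simp
  have s: "\<bar>s\<bar> = d" "s \<noteq> 0" "(0 < s) = \<sigma>" using d(1) unfolding s_def d_def[symmetric] by (auto simp: sg_def)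
  have "Y \<bullet> Y = h \<sigma> v \<theta> s * h (\<not> \<sigma>) v \<theta> s" unfolding hs Y_def using hn by simp
  moreover have "0 \<le> h \<sigma>' v \<theta> s" for \<sigma>'
    using hn hs by (cases "\<sigma>' = \<sigma>") auto
  moreover have "Y \<bullet> b = 0" by (simp add: Y_def)
  ultimately show T: "admissible v \<theta> s Y"
    using s(1) d(2) unfolding admissible_def by (cases \<sigma>) (auto simp: mult.commute)
  have "direction \<sigma> v \<theta> s Y = (1 / sqrt (1 - d)) *\<^sub>R (u *\<^sub>R b + \<kappa> *\<^sub>R perp z)"
    using hn by (simp add: direction_def cu s(1) Y_def)
  also have "u *\<^sub>R b + \<kappa> *\<^sub>R perp z = \<kappa> *\<^sub>R z" using decomp[of z] by (metis scaleR_add_right scaleR_scaleR u_def)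
  also have "(1 / sqrt (1 - d)) *\<^sub>R (\<kappa> *\<^sub>R z) = (1 / sqrt d) *\<^sub>R z" using d by (simp add: \<kappa>_def d_def)
  finally have om: "direction \<sigma> v \<theta> s Y = (1 / sqrt (z \<bullet> z)) *\<^sub>R z" by (simp add: d_def)
  have "base \<sigma> e = v" using armZ_arcs(2)[OF v] e by auto
  moreover have "z \<noteq> 0" using z by auto
  ultimately show "N v \<theta> s Y = \<psi> (EI \<sigma> e) z"
    using s(2) e by (simp add: N_def s(3) fl om \<psi>.simps) (simp add: s_def)
qed

text \<open>The overlap is the shell \<open>0 < z \<bullet> z < \<delta>\<close> without the angles
  at the cut. Comparing heights shows that it is all of the overlap, because a point of the vertex
  chart has \<open>\<bar>s\<bar> < \<delta>\<close>.\<close>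

lemma transition_arm_vertex:
  assumes v: "interior_vert v" and e: "e \<in> harcs \<sigma> v"
  shows "smooth_transition V \<psi> (EI \<sigma> e) (QI \<sigma> \<alpha> v)"
proof -
  have eG: "e \<in> arcs G" "base \<sigma> e = v" using harcs_arcs[OF e] by auto
  obtain k where k: "armZ \<sigma> v k = e" using armZ_surj[OF v e] .
  let ?U = "{z :: real ^ 'n. 0 < z \<bullet> z} \<inter> {z. z \<bullet> z < \<delta>}"
  let ?\<kappa> = "\<lambda>z :: real ^ 'n. sqrt (1 - z \<bullet> z) / sqrt (z \<bullet> z)"
  let ?W = "?U \<inter> (\<lambda>z. arg_of \<sigma> v k z - \<alpha>) -` {x. x \<notin> \<int>}"
  let ?t = "\<lambda>z. lift \<alpha> (arg_of \<sigma> v k z) *\<^sub>R b + ?\<kappa> z *\<^sub>R perp z"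
  have opU: "open ?U" by (intro open_Int open_Collect_less continuous_intros)
  have bd: "0 < 1 - z \<bullet> z" "0 < z \<bullet> z" "\<bar>?\<kappa> z * (z \<bullet> b)\<bar> < 1" if "z \<in> ?U" for z
    using that \<delta> arm_param(1)[OF v _ _ k] by auto
  have \<kappa>: "smooth_on ?U ?\<kappa>"
    by (intro smooth_on_intros opU) (use bd in \<open>auto simp: less_imp_neq\<close>)
  have arg: "smooth_on ?U (arg_of \<sigma> v k)"
    unfolding arg_of_def by (intro smooth_on_intros opU) (use bd m_pos[OF v, of \<sigma>] in \<open>auto simp: less_imp_neq\<close>)
  show ?thesis
  proof (rule smooth_transitionI)
    show op: "open ?W"
      using smooth_on_imp_continuous_on[OF arg]
      by (intro continuous_open_preimage opU open_not_Ints continuous_intros)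
    show "?W \<subseteq> V (EI \<sigma> e)" using len_ge[OF eG(1)] \<delta> by (auto simp: V.simps)
    have "smooth_on ?W (arg_of \<sigma> v k)" "smooth_on ?W ?\<kappa>"
      using arg \<kappa> by (auto intro: smooth_on_subset)
    then show "smooth_on ?W ?t"
      unfolding lift_def by (intro smooth_on_add smooth_on_scaleR smooth_on_frac smooth_on_diff
          smooth_on_const smooth_on_perp smooth_on_id op) auto
    have *: "?t z \<in> V (QI \<sigma> \<alpha> v) \<and> \<psi> (QI \<sigma> \<alpha> v) (?t z) = \<psi> (EI \<sigma> e) z" if z: "z \<in> ?W" for z
    proof -
      have z': "0 < z \<bullet> z" "z \<bullet> z < \<delta>" using z by auto
      note P = arm_param[OF v z' k]
      obtain j where j: "lift \<alpha> (arg_of \<sigma> v k z) = arg_of \<sigma> v k z + of_int j" using lift_shift .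
      have bd': "\<alpha> < lift \<alpha> (arg_of \<sigma> v k z)" "lift \<alpha> (arg_of \<sigma> v k z) < \<alpha> + 1" using lift_bounds z by auto
      have h: "h (\<not> \<sigma>) v (lift \<alpha> (arg_of \<sigma> v k z)) s = h (\<not> \<sigma>) v (arg_of \<sigma> v k z) s" for s
        by (simp only: j h_shift)
      have T: "admissible v (lift \<alpha> (arg_of \<sigma> v k z)) s Y = admissible v (arg_of \<sigma> v k z) s Y" for s Y
        by (simp only: j admissible_shift)
      have N: "N v (lift \<alpha> (arg_of \<sigma> v k z)) s Y = N v (arg_of \<sigma> v k z) s Y" for s Y
        by (simp only: j N_shift[OF v])
      have "(1 / sqrt (h (\<not> \<sigma>) v (arg_of \<sigma> v k z) (sg \<sigma> * (z \<bullet> z)))) *\<^sub>R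
          (sqrt (h (\<not> \<sigma>) v (arg_of \<sigma> v k z) (sg \<sigma> * (z \<bullet> z))) * ?\<kappa> z) *\<^sub>R perp z = ?\<kappa> z *\<^sub>R perp z"
        using P(3) by simp
      with vertex_chart_inverse(1,2)[OF P(2)[folded T] bd' P(3)[folded h], unfolded h N P(4)]
      show ?thesis by (simp only:)
    qed
    then show "?t ` ?W \<subseteq> V (QI \<sigma> \<alpha> v)" "\<And>x. x \<in> ?W \<Longrightarrow> \<psi> (QI \<sigma> \<alpha> v) (?t x) = \<psi> (EI \<sigma> e) x" by blast+
    fix x y assume xy: "x \<in> V (EI \<sigma> e)" "y \<in> V (QI \<sigma> \<alpha> v)" "\<psi> (EI \<sigma> e) x = \<psi> (QI \<sigma> \<alpha> v) y"
    define s where "s = sg \<sigma> * (\<phi> \<sigma> v (y \<bullet> b) - perp y \<bullet> perp y)"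
    note Q = vertex_chart_admissible[OF v xy(2), folded s_def]
    have x: "x \<noteq> 0" using xy(1) eG v by (auto simp: V.simps)
    then have l: "lab (\<psi> (EI \<sigma> e) x) = Inr e" "hgt (\<psi> (EI \<sigma> e) x) = g v + sg \<sigma> * (x \<bullet> x)"
      using eG by (simp_all add: \<psi>.simps mk_sel)
    then have s0: "s \<noteq> 0" using N_point(1)[OF v Q(1)] Q(4) xy(3) by auto
    then have "s = sg \<sigma> * (x \<bullet> x)" using N_point(3)[OF v Q(1)] Q(4) xy(3) l by simp
    then have x': "0 < x \<bullet> x" "x \<bullet> x < \<delta>" using Q(7) x by auto
    note P = arm_param[OF v x' k]
    have "y \<bullet> b - arg_of \<sigma> v k x \<in> \<int>"
      by (rule N_inj(3)[OF v Q(1) P(2)]) (simp only: Q(4)[symmetric] P(4) xy(3))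
    moreover have "\<alpha> < y \<bullet> b" "y \<bullet> b < \<alpha> + 1" using xy(2) by (auto simp: V.simps)
    ultimately show "x \<in> ?W" using lift_notin x' by auto
  qed
qed

end

text \<open>In every chart the height has this shape, a multiple of \<open>|z|^2\<close> plus a
  function of one coordinate. The Hessian is then diagonal, with entry
  \<open>2 * \<kappa> + u''\<close> on the axis and \<open>2 * \<kappa>\<close> elsewhere.\<close>

lemma
  fixes u u' u'' :: "real \<Rightarrow> real" and i0 :: "'n::finite" and \<kappa> C :: real
  defines "F \<equiv> \<lambda>z :: real ^ 'n. C + \<kappa> * (z \<bullet> z) + u (z \<bullet> axis i0 1)"
  assumes u: "\<And>t. (u has_real_derivative u' t) (at t)"
  shows axial_quadratic_derivative:
      "(F has_derivative (\<lambda>h. 2 * \<kappa> * (z \<bullet> h) + u' (z \<bullet> axis i0 1) * (h \<bullet> axis i0 1))) (at z)"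
    and axial_quadratic_hessian_invertible:
      "(\<And>t. (u' has_real_derivative u'' t) (at t)) \<Longrightarrow> \<kappa> \<noteq> 0 \<Longrightarrow>
        2 * \<kappa> + u'' (z \<bullet> axis i0 1) \<noteq> 0 \<Longrightarrow> invertible (hessian F z)"
proof -
  let ?b = "axis i0 1 :: real ^ 'n"
  let ?D = "\<lambda>z h. 2 * \<kappa> * (z \<bullet> h) + u' (z \<bullet> ?b) * (h \<bullet> ?b)"
  have chain: "((\<lambda>z. w (z \<bullet> ?b)) has_derivative (\<lambda>h. w' (z \<bullet> ?b) * (h \<bullet> ?b))) (at z)"
    if "\<And>t. (w has_real_derivative w' t) (at t)" for w w' :: "real \<Rightarrow> real" and z :: "real ^ 'n"
  proof -
    have "((\<lambda>z. z \<bullet> ?b) has_derivative (\<lambda>h. h \<bullet> ?b)) (at z)"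
      by (rule bounded_linear_imp_has_derivative) (rule bounded_linear_inner_left)
    from has_derivative_compose[OF this that[unfolded has_field_derivative_def]]
    show ?thesis by simp
  qed
  show D: "(F has_derivative ?D z) (at z)" for z
  proof -
    have "((\<lambda>z. C + \<kappa> * (z \<bullet> z)) has_derivative (\<lambda>h. 2 * \<kappa> * (z \<bullet> h))) (at z)"
      by (auto intro!: derivative_eq_intros simp: inner_commute algebra_simps)
    from has_derivative_add[OF this chain[OF u]] show ?thesis by (simp add: F_def)
  qed
  assume u': "\<And>t. (u' has_real_derivative u'' t) (at t)" and nz: "\<kappa> \<noteq> 0" "2 * \<kappa> + u'' (z \<bullet> ?b) \<noteq> 0"
  have fD: "frechet_derivative F (at y) = ?D y" for y
    using frechet_derivative_at[OF D[of y]] by simp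
  have D2: "((\<lambda>y. ?D y v) has_derivative (\<lambda>h. 2 * \<kappa> * (h \<bullet> v) + u'' (z \<bullet> ?b) * (h \<bullet> ?b) * (v \<bullet> ?b))) (at z)" for v
  proof -
    have "((\<lambda>y. 2 * \<kappa> * (y \<bullet> v)) has_derivative (\<lambda>h. 2 * \<kappa> * (h \<bullet> v))) (at z)"
      by (intro bounded_linear_imp_has_derivative bounded_linear_const_mult bounded_linear_inner_left)
    moreover have "((\<lambda>y. u' (y \<bullet> ?b) * (v \<bullet> ?b)) has_derivative (\<lambda>h. u'' (z \<bullet> ?b) * (h \<bullet> ?b) * (v \<bullet> ?b))) (at z)"
      by (rule has_derivative_mult_left[OF chain[OF u']])
    ultimately show ?thesis by (rule has_derivative_add)
  qed
  have entry: "hessian F z $ i $ j = 2 * \<kappa> * (axis j 1 \<bullet> (axis i 1 :: real ^ 'n)) +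
      u'' (z \<bullet> ?b) * (axis j 1 \<bullet> ?b) * (axis i 1 \<bullet> ?b)" for i j
    using frechet_derivative_at[OF D2[of "axis i 1"], symmetric] by (simp add: hessian_def fD)
  have "det (hessian F z) = (\<Prod>i\<in>UNIV. hessian F z $ i $ i)"
    by (rule det_diagonal) (auto simp: entry inner_axis_axis)
  also have "\<dots> \<noteq> 0"
    using nz by (auto simp: entry inner_axis_axis)
  finally show "invertible (hessian F z)" by (simp add: invertible_det_nz)
qed

context reeb_construction begin

section \<open>Compatibility of all pairs of charts\<close>

lemma lab_EI: "e \<in> arcs G \<Longrightarrow> lab (\<psi> (EI \<sigma> e) z) = (if z = 0 then Inl (base \<sigma> e) else Inr e)"
  by (simp add: \<psi>.simps mk_sel base_in_verts)

lemma edge_point_in_image: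
  assumes e: "e \<in> arcs G" and \<tau>: "g (tail G e) < \<tau>" "\<tau> < g (head G e)" and \<omega>: "\<omega> \<bullet> \<omega> = 1"
  shows "mk (Inr e) \<tau> \<omega> \<in> \<psi> (EI \<sigma> e) ` (V (EI \<sigma> e) - {0})"
proof (rule image_eqI)
  define d where "d = sg \<sigma> * (\<tau> - g (base \<sigma> e))"
  have d: "0 < d" "d < len e" using \<tau> by (cases \<sigma>; auto simp: d_def base_def len_def)+
  let ?z = "sqrt d *\<^sub>R \<omega>"
  have zz: "?z \<bullet> ?z = d" using d \<omega> by simp
  then have nz: "?z \<noteq> 0" using d by auto
  show "?z \<in> V (EI \<sigma> e) - {0}" using nz zz d by (simp add: V.simps)
  have "g (base \<sigma> e) + sg \<sigma> * d = \<tau>" by (simp add: d_def)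
  moreover have "(1 / sqrt d) *\<^sub>R ?z = \<omega>" using d by simp
  ultimately show "mk (Inr e) \<tau> \<omega> = \<psi> (EI \<sigma> e) ?z"
    using nz unfolding \<psi>.simps zz by simp
qed

lemma N_edge:
  assumes v: "interior_vert v" and T: "admissible v \<theta> s Y" and s: "s \<noteq> 0" and l: "lab (N v \<theta> s Y) = Inr e"
  shows "e \<in> harcs (0 < s) v" "N v \<theta> s Y \<in> \<psi> (EI \<sigma> e) ` (V (EI \<sigma> e) - {0})"
    "0 < h (\<not> (0 < s)) v \<theta> s"
proof -
  have e: "armZ (0 < s) v \<lfloor>phase (0 < s) v \<theta>\<rfloor> = e" using N_point(2)[OF v T s] l by simp
  then show 1: "e \<in> harcs (0 < s) v" using armZ_in[OF v] by auto
  then have eG: "e \<in> arcs G" "base (0 < s) e = v" using harcs_arcs by auto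
  have "\<bar>s\<bar> < len e" using admissibleD(3)[OF T] len_ge[OF eG(1)] \<delta> by simp
  then have "g (tail G e) < g v + s" "g v + s < g (head G e)"
    using eG(2) s by (auto simp: base_def len_def split: if_splits)
  from edge_point_in_image[OF eG(1) this direction_unit[OF T s refl]]
  show "N v \<theta> s Y \<in> \<psi> (EI \<sigma> e) ` (V (EI \<sigma> e) - {0})" using s e by (simp add: N_def)
  show "0 < h (\<not> (0 < s)) v \<theta> s" by (rule admissible_side(3)[OF T s refl])
qed

text \<open>Sorts the points of a vertex chart for the transition maps: off the vertex fibre, a
  point also lies in the vertex chart on the side \<rho> of its edge and in both charts of that
  edge, so that a transition can pass through the pair for which a formula exists.\<close>

lemma Q_cases:
  assumes v: "interior_vert v" and z: "z \<in> V (QI \<sigma> \<alpha> v)"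
  obtains (vert) "lab (\<psi> (QI \<sigma> \<alpha> v) z) = Inl v"
  | (arc) e \<rho> where "lab (\<psi> (QI \<sigma> \<alpha> v) z) = Inr e" "e \<in> harcs \<rho> v"
      "\<bar>hgt (\<psi> (QI \<sigma> \<alpha> v) z) - g v\<bar> < \<delta>" "\<psi> (QI \<sigma> \<alpha> v) z \<in> \<psi> (QI \<rho> \<alpha> v) ` V (QI \<rho> \<alpha> v)"
      "\<And>\<sigma>'. \<psi> (QI \<sigma> \<alpha> v) z \<in> \<psi> (EI \<sigma>' e) ` (V (EI \<sigma>' e) - {0})"
proof -
  define s where "s = sg \<sigma> * (\<phi> \<sigma> v (z \<bullet> b) - perp z \<bullet> perp z)"
  note Q = vertex_chart_admissible[OF v z, folded s_def]
  show ?thesis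
  proof (cases "s = 0")
    case True
    then show ?thesis using N_point(1)[OF v Q(1)] Q(4) vert by simp
  next
    case False
    note P = N_point(2,3)[OF v Q(1) False]
    note N = N_edge[OF v Q(1) False P(1)]
    have "\<alpha> < z \<bullet> b" "z \<bullet> b < \<alpha> + 1" using z by (auto simp: V.simps)
    from vertex_chart_inverse(1,2)[OF Q(1) this N(3)] have "\<psi> (QI \<sigma> \<alpha> v) z \<in> \<psi> (QI (0 < s) \<alpha> v) ` V (QI (0 < s) \<alpha> v)"
      unfolding Q(4) by (metis image_eqI)
    then show ?thesis using arc[OF _ N(1)] P N(2) Q(4,7) by simp
  qed
qed

lemma harcs_unique: "e \<in> harcs \<sigma> v \<Longrightarrow> e \<in> harcs \<rho> v \<Longrightarrow> \<sigma> = \<rho>"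
  using harcs_arcs[of e \<sigma> v] harcs_arcs[of e \<rho> v] base_neq[of e] by (cases \<sigma>; cases \<rho>) auto

text \<open>Charts of different edges could meet only in a common centre, and a centre is present
  only at a cap, which has a single edge.\<close>

lemma transition_edge_edge:
  assumes e: "e \<in> arcs G" "e' \<in> arcs G"
  shows "smooth_transition V \<psi> (EI \<sigma> e) (EI \<sigma>' e')"
proof (cases "e = e'")
  case True
  then show ?thesis
    using transition_edge_ends[OF e(1), of True] transition_edge_ends[OF e(1), of False] smooth_transition_refl[of V, OF open_V]
    by (cases \<sigma>; cases \<sigma>') auto
next
  case False
  have "x \<noteq> 0 \<or> y \<noteq> 0" if "x \<in> V (EI \<sigma> e)" "y \<in> V (EI \<sigma>' e')" "\<psi> (EI \<sigma> e) x = \<psi> (EI \<sigma>' e') y" for x y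
  proof (rule ccontr)
    assume "\<not> ?thesis"
    then have 0: "x = 0" "y = 0" by auto
    have "lab (\<psi> (EI \<sigma> e) x) = lab (\<psi> (EI \<sigma>' e') y)" by (simp only: that(3))
    then have eq: "base \<sigma>' e' = base \<sigma> e" unfolding lab_EI[OF e(1)] lab_EI[OF e(2)] using 0 by simp
    have "\<not> interior_vert (base \<sigma> e)" using that(1) 0 by (simp add: V.simps)
    from cap_unique[OF e refl eq this] show False using False by simp
  qed
  moreover have "x = 0 \<and> y = 0" if "\<psi> (EI \<sigma> e) x = \<psi> (EI \<sigma>' e') y" for x y
    using arg_cong[OF that, of lab] False unfolding lab_EI[OF e(1)] lab_EI[OF e(2)]
    by (auto split: if_splits)
  ultimately show ?thesis by (intro smooth_transition_disjoint) blast
qed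

text \<open>At one vertex, changing the cut and then the side gives every transition. Charts of
  different vertices are disjoint: a common point would lie on an edge joining them, closer than
  \<delta> to both end heights, while these differ by at least \<open>2 * \<delta>\<close>.\<close>

lemma transition_vertex_vertex:
  assumes v: "interior_vert v" and w: "interior_vert w"
  shows "smooth_transition V \<psi> (QI \<sigma> \<alpha> v) (QI \<sigma>' \<beta> w)"
proof (cases "v = w")
  case True
  show ?thesis
  proof (cases "\<sigma>' = \<sigma>")
    case True
    then show ?thesis using \<open>v = w\<close> transition_change_cut[OF v] by simp
  next
    case False
    then have \<sigma>': "\<sigma>' = (\<not> \<sigma>)" by auto
    have "\<psi> (QI \<sigma> \<alpha> v) x \<in> \<psi> (QI \<sigma> \<beta> v) ` V (QI \<sigma> \<beta> v)"
      if xy: "x \<in> V (QI \<sigma> \<alpha> v)" "y \<in> V (QI (\<not> \<sigma>) \<beta> v)" "\<psi> (QI \<sigma> \<alpha> v) x = \<psi> (QI (\<not> \<sigma>) \<beta> v) y" for x y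
    proof -
      define s where "s = sg \<sigma> * (\<phi> \<sigma> v (x \<bullet> b) - perp x \<bullet> perp x)"
      define s' where "s' = sg (\<not> \<sigma>) * (\<phi> (\<not> \<sigma>) v (y \<bullet> b) - perp y \<bullet> perp y)"
      note Q = vertex_chart_admissible[OF v xy(1), folded s_def] and Q' = vertex_chart_admissible[OF v xy(2), folded s'_def]
      note inj = N_inj[OF v Q(1) Q'(1) xy(3)[unfolded Q(4) Q'(4)]]
      obtain k where k: "x \<bullet> b = y \<bullet> b + of_int k" using inj(3) by (auto elim!: Ints_cases simp: algebra_simps)
      have bd: "\<beta> < y \<bullet> b" "y \<bullet> b < \<beta> + 1" using xy(2) by (auto simp: V.simps)
      have "0 < h (\<not> \<sigma>) v (y \<bullet> b) s'"
        using Q(3) unfolding inj(1) by (simp only: k h_shift)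
      from vertex_chart_inverse(1,2)[OF Q'(1) bd this] show ?thesis unfolding xy(3) Q'(4) by (metis image_eqI)
    qed
    then have "\<psi> (QI \<sigma> \<alpha> v) ` V (QI \<sigma> \<alpha> v) \<inter> \<psi> (QI (\<not> \<sigma>) \<beta> v) ` V (QI (\<not> \<sigma>) \<beta> v)
        \<subseteq> \<psi> (QI \<sigma> \<beta> v) ` V (QI \<sigma> \<beta> v)" by blast
    moreover have "inj_on (\<psi> (QI \<sigma> \<beta> v)) (V (QI \<sigma> \<beta> v))" by (rule inj_vertex_chart[OF v])
    ultimately show ?thesis
      unfolding \<sigma>' \<open>v = w\<close>[symmetric]
      by (intro smooth_transition_trans[OF transition_change_cut[OF v] transition_change_side[OF v]])
  qed
next
  case False
  show ?thesis
  proof (rule smooth_transition_disjoint, rule ccontr)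
    assume "\<psi> (QI \<sigma> \<alpha> v) ` V (QI \<sigma> \<alpha> v) \<inter> \<psi> (QI \<sigma>' \<beta> w) ` V (QI \<sigma>' \<beta> w) \<noteq> {}"
    then obtain x y where xy: "x \<in> V (QI \<sigma> \<alpha> v)" "y \<in> V (QI \<sigma>' \<beta> w)" "\<psi> (QI \<sigma> \<alpha> v) x = \<psi> (QI \<sigma>' \<beta> w) y"
      by blast
    show False using v xy(1)
    proof (cases rule: Q_cases)
      case vert
      then show ?thesis using xy(3) False by (cases rule: Q_cases[OF w xy(2)]) auto
    next
      case (arc e \<rho>)
      note a = this
      show ?thesis using w xy(2)
      proof (cases rule: Q_cases)
        case vert
        then show ?thesis using arc(1) xy(3) by simp
      next
        case (arc e' \<rho>')
        then have "e \<in> harcs \<rho>' w" "\<bar>g v - g w\<bar> < 2 * \<delta>" using a xy(3) by auto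
        moreover have "base \<rho> e = v" "base \<rho>' e = w" "e \<in> arcs G"
          using a(2) calculation(1) harcs_arcs by auto
        ultimately show ?thesis using False len_ge[of e] by (cases \<rho>; cases \<rho>') (auto simp: base_def len_def)
      qed
    qed
  qed
qed

text \<open>Explicit formulas exist for charts of the same side \<rho>. The other pairs are routed
  through \<open>QI \<rho>\<close> and \<open>EI \<rho>\<close>, which contain the whole overlap by
  \<open>Q_cases\<close>.\<close>

lemma transition_vertex_edge:
  assumes v: "interior_vert v" and e: "e \<in> arcs G"
  shows "smooth_transition V \<psi> (QI \<sigma> \<alpha> v) (EI \<sigma>' e) \<and> smooth_transition V \<psi> (EI \<sigma>' e) (QI \<sigma> \<alpha> v)"
proof (cases "\<exists>\<rho>. e \<in> harcs \<rho> v")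
  case True
  then obtain \<rho> where \<rho>: "e \<in> harcs \<rho> v" by blast
  have common: "\<psi> (QI \<sigma> \<alpha> v) x \<in> \<psi> (QI \<rho> \<alpha> v) ` V (QI \<rho> \<alpha> v) \<inter> \<psi> (EI \<sigma>'' e) ` V (EI \<sigma>'' e)"
    if xy: "x \<in> V (QI \<sigma> \<alpha> v)" "y \<in> V (EI \<sigma>' e)" "\<psi> (QI \<sigma> \<alpha> v) x = \<psi> (EI \<sigma>' e) y" for x y \<sigma> \<sigma>' \<sigma>''
  using v xy(1)
  proof (cases rule: Q_cases)
    case vert
    then show ?thesis using xy(2,3) v lab_EI[OF e, of \<sigma>' y] by (auto simp: V.simps split: if_splits)
  next
    case (arc e' \<rho>')
    then have "e' = e" using xy(3) lab_EI[OF e, of \<sigma>' y] by (auto split: if_splits)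
    then have "\<rho>' = \<rho>" using harcs_unique[OF arc(2)] \<rho> by simp
    then show ?thesis using arc(4,5) \<open>e' = e\<close> by blast
  qed
  let ?Q = "\<lambda>\<sigma>. \<psi> (QI \<sigma> \<alpha> v) ` V (QI \<sigma> \<alpha> v)" and ?E = "\<lambda>\<sigma>. \<psi> (EI \<sigma> e) ` V (EI \<sigma> e)"
  have sub: "?Q \<sigma> \<inter> ?E \<sigma>' \<subseteq> ?Q \<rho>" "?Q \<sigma> \<inter> ?E \<sigma>' \<subseteq> ?E \<rho>" for \<sigma> \<sigma>'
  proof -
    have "p \<in> ?Q \<rho> \<inter> ?E \<rho>" if p: "p \<in> ?Q \<sigma> \<inter> ?E \<sigma>'" for p
    proof -
      obtain x y where "x \<in> V (QI \<sigma> \<alpha> v)" "p = \<psi> (QI \<sigma> \<alpha> v) x" "y \<in> V (EI \<sigma>' e)" "p = \<psi> (EI \<sigma>' e) y"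
        using p by (elim IntE imageE)
      then show ?thesis using common[of x \<sigma> y \<sigma>' \<rho>] by simp
    qed
    then show "?Q \<sigma> \<inter> ?E \<sigma>' \<subseteq> ?Q \<rho>" "?Q \<sigma> \<inter> ?E \<sigma>' \<subseteq> ?E \<rho>" by (meson IntD1 IntD2 subsetI)+
  qed
  note sub' = sub[unfolded Int_commute[of "?Q _"]]
  have 1: "smooth_transition V \<psi> (QI \<rho> \<alpha> v) (EI \<sigma>' e)"
    by (rule smooth_transition_trans[OF transition_vertex_arm[OF v \<rho>] transition_edge_edge[OF e e] sub(2) inj_edge_chart[OF e]])
  have 2: "smooth_transition V \<psi> (EI \<sigma>' e) (QI \<rho> \<alpha> v)"
    by (rule smooth_transition_trans[OF transition_edge_edge[OF e e] transition_arm_vertex[OF v \<rho>] sub'(2) inj_edge_chart[OF e]])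
  show ?thesis
    using smooth_transition_trans[OF transition_vertex_vertex[OF v v] 1 sub(1) inj_vertex_chart[OF v]]
      smooth_transition_trans[OF 2 transition_vertex_vertex[OF v v] sub'(1) inj_vertex_chart[OF v]] by (rule conjI)
next
  case False
  have "\<psi> (QI \<sigma> \<alpha> v) x \<noteq> \<psi> (EI \<sigma>' e) y" if xy: "x \<in> V (QI \<sigma> \<alpha> v)" "y \<in> V (EI \<sigma>' e)" for x y
  using v xy(1)
  proof (cases rule: Q_cases)
    case vert
    then show ?thesis using xy(2) v lab_EI[OF e, of \<sigma>' y] by (auto simp: V.simps split: if_splits)
  next
    case (arc e' \<rho>')
    then show ?thesis using False lab_EI[OF e, of \<sigma>' y] by (auto split: if_splits)
  qed
  then have "\<psi> (QI \<sigma> \<alpha> v) ` V (QI \<sigma> \<alpha> v) \<inter> \<psi> (EI \<sigma>' e) ` V (EI \<sigma>' e) = {}" by blast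
  then show ?thesis by (intro conjI smooth_transition_disjoint) (simp_all only: Int_commute)
qed

lemma finite_I: "finite I"
proof -
  have "I \<subseteq> (\<Union>\<sigma>. EI \<sigma> ` arcs G) \<union> (\<Union>\<sigma>. \<Union>\<alpha>\<in>{0, 1/2}. QI \<sigma> \<alpha> ` verts G)"
    unfolding I_def interior_vert_def by blast
  then show ?thesis by (rule finite_subset) auto
qed

sublocale atlas: param_atlas I V \<psi>
proof
  fix i j assume ij: "i \<in> I" "j \<in> I"
  then show "smooth_transition V \<psi> i j"
    using transition_edge_edge transition_vertex_vertex transition_vertex_edge unfolding I_def by blast
qed (use finite_I open_V inj_\<psi> in auto)

text \<open>The label decides how to read the code: on the fibre of an interior vertex the stored
  number is the angle, not the height.\<close>

definition "f p = (case lab p of Inl v \<Rightarrow> g v | Inr e \<Rightarrow> hgt p)"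

lemma f_EI: "e \<in> arcs G \<Longrightarrow> f (\<psi> (EI \<sigma> e) z) = g (base \<sigma> e) + sg \<sigma> * (z \<bullet> z)"
  by (simp add: f_def \<psi>.simps mk_sel base_in_verts)

lemma f_N:
  assumes "interior_vert v" "admissible v \<theta> s Y"
  shows "f (N v \<theta> s Y) = g v + s"
  using N_point[OF assms] by (cases "s = 0") (simp_all add: f_def)

lemma f_QI:
  assumes "interior_vert v" "z \<in> V (QI \<sigma> \<alpha> v)"
  shows "f (\<psi> (QI \<sigma> \<alpha> v) z) = g v + sg \<sigma> * (\<phi> \<sigma> v (z \<bullet> b) - perp z \<bullet> perp z)"
  using vertex_chart_admissible(1,4)[OF assms] f_N[OF assms(1)] by simp

lemma index_cases:
  assumes "i \<in> I"
  obtains (E) \<sigma> e where "i = EI \<sigma> e" "e \<in> arcs G"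
  | (Q) \<sigma> \<alpha> v where "i = QI \<sigma> \<alpha> v" "interior_vert v" "\<alpha> = 0 \<or> \<alpha> = 1 / 2"
  using assms by (auto simp: I_def)

lemma smooth_f:
  assumes "i \<in> I"
  shows "smooth_on (V i) (\<lambda>z. f (\<psi> i z))"
  using assms
proof (cases rule: index_cases)
  case (E \<sigma> e)
  then show ?thesis using open_V by (auto simp: f_EI intro!: smooth_on_intros)
next
  case (Q \<sigma> \<alpha> v)
  have "smooth_on (V i) (\<lambda>z. g v + sg \<sigma> * (\<phi> \<sigma> v (z \<bullet> b) - perp z \<bullet> perp z))"
    by (intro smooth_on_intros smooth_on_\<phi> smooth_on_perp open_V)
  then show ?thesis 
    using smooth_on_cong[OF open_V[of i], of "\<lambda>z. f (\<psi> i z)"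
        "\<lambda>z. g v + sg \<sigma> * (\<phi> \<sigma> v (z \<bullet> b) - perp z \<bullet> perp z)"] f_QI[OF Q(2)] unfolding Q(1) by blast
qed

section \<open>Critical points of the height and their Hessians\<close>

definition "\<phi>' \<sigma> v t = 2 * pi * real (m \<sigma> v) * sin (pi * phase \<sigma> v t) * cos (pi * phase \<sigma> v t)"

definition "\<phi>'' \<sigma> v t = 2 * (pi * real (m \<sigma> v))\<^sup>2 * ((cos (pi * phase \<sigma> v t))\<^sup>2 - (sin (pi * phase \<sigma> v t))\<^sup>2)"

lemma \<phi>_deriv: "(\<phi> \<sigma> v has_real_derivative \<phi>' \<sigma> v t) (at t)"
  unfolding \<phi>_def phase_def \<phi>'_def by (auto intro!: derivative_eq_intros simp: algebra_simps)

lemma \<phi>'_deriv: "(\<phi>' \<sigma> v has_real_derivative \<phi>'' \<sigma> v t) (at t)"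
  unfolding \<phi>'_def phase_def \<phi>''_def
  by (auto intro!: derivative_eq_intros simp: algebra_simps power2_eq_square)

text \<open>Since \<open>|y|^2 = |z|^2 - (z \<bullet> b)^2\<close>, the surplus square can be
  absorbed into the function of the axis coordinate.\<close>

lemma f_QI_axial:
  assumes "interior_vert v" "z \<in> V (QI \<sigma> \<alpha> v)"
  shows "f (\<psi> (QI \<sigma> \<alpha> v) z) = g v + (- sg \<sigma>) * (z \<bullet> z) + sg \<sigma> * (\<phi> \<sigma> v (z \<bullet> b) + (z \<bullet> b)\<^sup>2)"
  unfolding f_QI[OF assms] decomp_inner[of z] by (simp add: algebra_simps)

lemma axial_deriv:
  "((\<lambda>t. sg \<sigma> * (\<phi> \<sigma> v t + t\<^sup>2)) has_real_derivative sg \<sigma> * (\<phi>' \<sigma> v t + 2 * t)) (at t)"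
  "((\<lambda>t. sg \<sigma> * (\<phi>' \<sigma> v t + 2 * t)) has_real_derivative sg \<sigma> * (\<phi>'' \<sigma> v t + 2)) (at t)"
  by (auto intro!: derivative_eq_intros \<phi>_deriv \<phi>'_deriv)

lemma deriv_QI:
  assumes v: "interior_vert v" and z: "z \<in> V (QI \<sigma> \<alpha> v)"
  shows "((\<lambda>x. f (\<psi> (QI \<sigma> \<alpha> v) x)) has_derivative
    (\<lambda>k. 2 * (- sg \<sigma>) * (z \<bullet> k) + sg \<sigma> * (\<phi>' \<sigma> v (z \<bullet> b) + 2 * (z \<bullet> b)) * (k \<bullet> b))) (at z)"
  by (rule has_derivative_transform_within_open[OF axial_quadratic_derivative[OF axial_deriv(1)] open_V z])
    (simp only: f_QI_axial[OF v])

lemma deriv_EI: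
  assumes "e \<in> arcs G"
  shows "((\<lambda>x. f (\<psi> (EI \<sigma> e) x)) has_derivative (\<lambda>k. 2 * sg \<sigma> * (z \<bullet> k))) (at z)"
  unfolding f_EI[OF assms] by (auto intro!: derivative_eq_intros simp: inner_commute algebra_simps)

text \<open>The derivative along \<open>perp z\<close> forces \<open>y = 0\<close>, and the one
  along \<open>b\<close> makes the product of sine and cosine vanish. A vanishing cosine would mean
  \<open>\<phi> = 1\<close>, but at \<open>y = 0\<close> the chart has
  \<open>\<phi> < \<delta> \<le> 1 / 2\<close>.\<close>

lemma critical_QI:
  assumes v: "interior_vert v" and z: "z \<in> V (QI \<sigma> \<alpha> v)"
    and crit: "((\<lambda>x. f (\<psi> (QI \<sigma> \<alpha> v) x)) has_derivative (\<lambda>_. 0)) (at z)"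
  shows "perp z = 0" "sin (pi * phase \<sigma> v (z \<bullet> b)) = 0"
proof -
  have D: "2 * (- sg \<sigma>) * (z \<bullet> k) + sg \<sigma> * (\<phi>' \<sigma> v (z \<bullet> b) + 2 * (z \<bullet> b)) * (k \<bullet> b) = 0" for k
    using has_derivative_unique[OF deriv_QI[OF v z] crit] by meson
  have "z \<bullet> perp z = perp z \<bullet> perp z" using decomp[of z] by (metis add_0 inner_add_left inner_scaleR_left mult_zero_right perp_b(2))
  then show perp: "perp z = 0" using D[of "perp z"] by simp
  have 1: "\<phi>' \<sigma> v (z \<bullet> b) = 0" using D[of b] by (simp add: algebra_simps)
  have "\<phi> \<sigma> v (z \<bullet> b) < 1" using z \<delta> perp by (auto simp: V.simps)
  then have "(cos (pi * phase \<sigma> v (z \<bullet> b)))\<^sup>2 > 0" by (simp add: \<phi>_def sin_squared_eq)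
  then have "cos (pi * phase \<sigma> v (z \<bullet> b)) \<noteq> 0" by auto
  then show "sin (pi * phase \<sigma> v (z \<bullet> b)) = 0" using 1 m_pos[OF v, of \<sigma>] by (simp add: \<phi>'_def)
qed

lemma nondegenerate:
  assumes i: "i \<in> I" and z: "z \<in> V i" and crit: "((\<lambda>x. f (\<psi> i x)) has_derivative (\<lambda>_. 0)) (at z)"
  shows "invertible (hessian (\<lambda>x. f (\<psi> i x)) z)"
  using i
proof (cases rule: index_cases)
  case (E \<sigma> e)
  have "(\<lambda>x. f (\<psi> i x)) = (\<lambda>x. g (base \<sigma> e) + sg \<sigma> * (x \<bullet> x) + 0)" using E f_EI by auto
  then show ?thesis
    using axial_quadratic_hessian_invertible[of "\<lambda>_. 0" "\<lambda>_. 0" "\<lambda>_. 0" "sg \<sigma>" z i0 "g (base \<sigma> e)"] by simp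
next
  case (Q \<sigma> \<alpha> v)
  note z' = z[unfolded Q(1)] 
  have sin: "sin (pi * phase \<sigma> v (z \<bullet> b)) = 0" using critical_QI[OF Q(2) z'] crit Q(1) by simp
  then have "(cos (pi * phase \<sigma> v (z \<bullet> b)))\<^sup>2 = 1"
    using sin_cos_squared_add[of "pi * phase \<sigma> v (z \<bullet> b)"] by simp
  then have "\<phi>'' \<sigma> v (z \<bullet> b) \<noteq> 0" using sin m_pos[OF Q(2), of \<sigma>] by (simp add: \<phi>''_def)
  \<comment> \<open>The square absorbed into the axis function cancels
    \<open>2 * (- sg \<sigma>)\<close>; the axis entry of the Hessian is
    \<open>sg \<sigma> * \<phi>''\<close>.\<close>
  then have "2 * (- sg \<sigma>) + sg \<sigma> * (\<phi>'' \<sigma> v (z \<bullet> b) + 2) \<noteq> 0" by (simp add: algebra_simps)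
  then have "invertible (hessian (\<lambda>z. g v + (- sg \<sigma>) * (z \<bullet> z) + sg \<sigma> * (\<phi> \<sigma> v (z \<bullet> b) + (z \<bullet> b)\<^sup>2)) z)"
    by (intro axial_quadratic_hessian_invertible[OF axial_deriv]) auto
  then show ?thesis
    using hessian_cong[OF open_V z, of "\<lambda>x. f (\<psi> i x)"
        "\<lambda>z. g v + (- sg \<sigma>) * (z \<bullet> z) + sg \<sigma> * (\<phi> \<sigma> v (z \<bullet> b) + (z \<bullet> b)\<^sup>2)"] f_QI_axial[OF Q(2)] Q(1)
    by simp
qed

lemma morse_f: "morse_function atlas.A f"
  using smooth_f nondegenerate by (rule atlas.morse_function_A)


section \<open>Vertex fibres and open edges inside the manifold\<close>

definition "vertex_fibre v = {p \<in> atlas.M. lab p = Inl v}"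

definition "edge_piece e = {p \<in> atlas.M. lab p = Inr e}"

lemma edge_index: "e \<in> arcs G \<Longrightarrow> EI \<sigma> e \<in> I" and vertex_index: "interior_vert v \<Longrightarrow> \<alpha> \<in> {0, 1/2} \<Longrightarrow> QI \<sigma> \<alpha> v \<in> I"
  by (auto simp: I_def)

lemma in_M: "i \<in> I \<Longrightarrow> z \<in> V i \<Longrightarrow> \<psi> i z \<in> atlas.M"
  by (auto simp: atlas.M_def)

lemma edge_piece_eq:
  assumes e: "e \<in> arcs G"
  shows "edge_piece e = \<psi> (EI \<sigma> e) ` (V (EI \<sigma> e) - {0})"
proof
  show "\<psi> (EI \<sigma> e) ` (V (EI \<sigma> e) - {0}) \<subseteq> edge_piece e"
    using in_M[OF edge_index[OF e]] by (auto simp: edge_piece_def lab_EI[OF e])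
  show "edge_piece e \<subseteq> \<psi> (EI \<sigma> e) ` (V (EI \<sigma> e) - {0})"
  proof
    fix p assume "p \<in> edge_piece e"
    then obtain i x where i: "i \<in> I" "x \<in> V i" "p = \<psi> i x" and l: "lab p = Inr e"
      by (auto simp: edge_piece_def atlas.M_def)
    from i(1) show "p \<in> \<psi> (EI \<sigma> e) ` (V (EI \<sigma> e) - {0})"
    proof (cases rule: index_cases)
      case (E \<sigma>' e')
      have "lab p = (if x = 0 then Inl (base \<sigma>' e') else Inr e')" unfolding i(3) E(1) by (rule lab_EI[OF E(2)])
      then have "x \<noteq> 0" "e' = e" using l by (auto split: if_splits)
      then have "p \<in> \<psi> (EI \<sigma> e) ` V (EI \<sigma> e)" using edge_chart_image[OF e, of x \<sigma>' \<sigma>] i E by auto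
      then obtain y where y: "y \<in> V (EI \<sigma> e)" "p = \<psi> (EI \<sigma> e) y" by auto
      then have "y \<noteq> 0" using l lab_EI[OF e, of \<sigma> y] by auto
      then show ?thesis using y by auto
    next
      case (Q \<sigma>' \<alpha> v)
      from Q(2) i(2)[unfolded Q(1)] show ?thesis
      proof (cases rule: Q_cases)
        case vert
        then show ?thesis using l i(3) Q(1) by simp
      next
        case (arc e' \<rho>)
        then have "e' = e" using l i(3) Q(1) by simp
        then show ?thesis using arc(5) i(3) Q(1) by simp
      qed
    qed
  qed
qed

lemma lift_witness:
  assumes v: "interior_vert v" and T: "admissible v \<theta> s Y" and h: "0 < h (\<not> \<sigma>) v \<theta> s" and \<theta>: "\<theta> - \<alpha> \<notin> \<int>"
  defines "z \<equiv> lift \<alpha> \<theta> *\<^sub>R b + (1 / sqrt (h (\<not> \<sigma>) v \<theta> s)) *\<^sub>R Y"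
  shows "z \<in> V (QI \<sigma> \<alpha> v)" "\<psi> (QI \<sigma> \<alpha> v) z = N v \<theta> s Y"
proof -
  obtain k where k: "lift \<alpha> \<theta> = \<theta> + of_int k" using lift_shift .
  have bd: "\<alpha> < lift \<alpha> \<theta>" "lift \<alpha> \<theta> < \<alpha> + 1" using lift_bounds[OF \<theta>] by auto
  have 1: "h (\<not> \<sigma>) v (lift \<alpha> \<theta>) s = h (\<not> \<sigma>) v \<theta> s" by (simp only: k h_shift)
  have 2: "admissible v (lift \<alpha> \<theta>) s Y" using T by (simp only: k admissible_shift)
  have 3: "0 < h (\<not> \<sigma>) v (lift \<alpha> \<theta>) s" unfolding 1 by (rule h)
  from vertex_chart_inverse(1,2)[OF 2 bd 3, unfolded 1]
  show "z \<in> V (QI \<sigma> \<alpha> v)" "\<psi> (QI \<sigma> \<alpha> v) z = N v \<theta> s Y"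
    unfolding z_def by (simp_all only: k N_shift[OF v])
qed

lemma ex_cut: obtains \<alpha> :: real where "\<alpha> \<in> {0, 1/2}" "\<theta> - \<alpha> \<notin> \<int>"
proof (cases "\<theta> \<in> \<int>")
  case True
  then obtain k where k: "\<theta> = of_int k" by (auto elim: Ints_cases)
  have "\<theta> - 1/2 \<notin> \<int>"
  proof
    assume "\<theta> - 1/2 \<in> \<int>"
    then obtain j where "\<theta> - 1/2 = of_int j" by (auto elim: Ints_cases)
    then have "real_of_int (2 * k - 1) = real_of_int (2 * j)" using k by simp
    then have "2 * k - 1 = 2 * j" by (simp only: of_int_eq_iff)
    then show False by presburger
  qed
  then show ?thesis using that[of "1/2"] by simp
next
  case False
  then show ?thesis using that[of 0] by simp
qed

lemma ex_side: assumes "interior_vert v" obtains \<sigma> where "0 < h (\<not> \<sigma>) v \<theta> s"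
  using h_sum[of True v \<theta> s] \<phi>_sum_pos[OF assms, of \<theta>] that[of True] that[of False]
  by (cases "0 < h False v \<theta> s") auto

lemma N_in_M:
  assumes v: "interior_vert v" and T: "admissible v \<theta> s Y"
  shows "\<exists>\<sigma>. \<exists>\<alpha>\<in>{0, 1/2}. N v \<theta> s Y \<in> \<psi> (QI \<sigma> \<alpha> v) ` V (QI \<sigma> \<alpha> v)"
proof -
  obtain \<sigma> where h: "0 < h (\<not> \<sigma>) v \<theta> s" using ex_side[OF v] .
  obtain \<alpha> :: real where \<alpha>: "\<alpha> \<in> {0, 1/2}" "\<theta> - \<alpha> \<notin> \<int>" using ex_cut .
  from lift_witness[OF v T h \<alpha>(2)] \<alpha>(1) show ?thesis by (metis image_eqI)
qed

lemma vertex_fibre_interior: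
  assumes v: "interior_vert v"
  shows "vertex_fibre v = {N v \<theta> 0 Y | \<theta> Y. admissible v \<theta> 0 Y}"
proof
  show "{N v \<theta> 0 Y | \<theta> Y. admissible v \<theta> 0 Y} \<subseteq> vertex_fibre v"
  proof
    fix p assume "p \<in> {N v \<theta> 0 Y | \<theta> Y. admissible v \<theta> 0 Y}"
    then obtain \<theta> Y where p: "p = N v \<theta> 0 Y" "admissible v \<theta> 0 Y" by blast
    obtain \<sigma> \<alpha> where "\<alpha> \<in> {0, 1/2}" "p \<in> \<psi> (QI \<sigma> \<alpha> v) ` V (QI \<sigma> \<alpha> v)"
      using N_in_M[OF v p(2)] p(1) by blast
    then have "p \<in> atlas.M" using vertex_index[OF v] by (auto simp: atlas.M_def)
    then show "p \<in> vertex_fibre v" using N_point(1)[OF v p(2)] p(1) by (simp add: vertex_fibre_def)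
  qed
  show "vertex_fibre v \<subseteq> {N v \<theta> 0 Y | \<theta> Y. admissible v \<theta> 0 Y}"
  proof
    fix p assume "p \<in> vertex_fibre v"
    then obtain i x where i: "i \<in> I" "x \<in> V i" "p = \<psi> i x" and l: "lab p = Inl v"
      by (auto simp: vertex_fibre_def atlas.M_def)
    from i(1) show "p \<in> {N v \<theta> 0 Y | \<theta> Y. admissible v \<theta> 0 Y}"
    proof (cases rule: index_cases)
      case (E \<sigma> e)
      have "lab p = (if x = 0 then Inl (base \<sigma> e) else Inr e)" unfolding i(3) E(1) by (rule lab_EI[OF E(2)])
      then have "x = 0" "base \<sigma> e = v" using l by (auto split: if_splits)
      then show ?thesis using v i(2) E(1) by (simp add: V.simps)
    next
      case (Q \<sigma> \<alpha> w)
      define s where "s = sg \<sigma> * (\<phi> \<sigma> w (x \<bullet> b) - perp x \<bullet> perp x)"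
      note Q' = vertex_chart_admissible[OF Q(2) i(2)[unfolded Q(1)], folded s_def]
      have s: "s = 0" using N_point(2)[OF Q(2) Q'(1)] Q'(4) l i(3) Q(1) by (cases "s = 0") auto
      then have "w = v" using N_point(1)[OF Q(2) Q'(1)] Q'(4) l i(3) Q(1) by simp
      then show ?thesis using Q'(1,4) s i(3) Q(1) by auto
    qed
  qed
qed

lemma ex_arc:
  assumes v: "v \<in> verts G"
  obtains \<sigma> e where "e \<in> harcs \<sigma> v"
proof -
  have "out_arcs G v \<noteq> {} \<or> in_arcs G v \<noteq> {}"
    using degrees[OF v] by (auto simp: in_degree_def out_degree_def simp del: in_in_arcs_conv in_out_arcs_conv)
  then have "harcs True v \<noteq> {} \<or> harcs False v \<noteq> {}" by (simp add: harcs_def)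
  then show ?thesis using that by blast
qed

lemma cap_point:
  assumes e: "e \<in> arcs G" "\<not> interior_vert (base \<sigma> e)"
  shows "0 \<in> V (EI \<sigma> e)" "\<psi> (EI \<sigma> e) 0 = mk (Inl (base \<sigma> e)) 0 0"
  using e len_pos by (auto simp: V.simps \<psi>.simps)

lemma vertex_fibre_cap:
  assumes v: "v \<in> verts G" "\<not> interior_vert v"
  shows "vertex_fibre v = {mk (Inl v) 0 0}"
proof
  obtain \<sigma> e where e: "e \<in> harcs \<sigma> v" using ex_arc[OF v(1)] .
  then have e': "e \<in> arcs G" "base \<sigma> e = v" using harcs_arcs by auto
  have "mk (Inl v) 0 0 \<in> atlas.M"
    using in_M[OF edge_index[OF e'(1)] cap_point(1)[OF e'(1), of \<sigma>]] cap_point(2)[OF e'(1), of \<sigma>] e'(2) v(2) by simp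
  then show "{mk (Inl v) 0 0} \<subseteq> vertex_fibre v" using v(1) by (simp add: vertex_fibre_def mk_sel)
  show "vertex_fibre v \<subseteq> {mk (Inl v) 0 0}"
  proof
    fix p assume "p \<in> vertex_fibre v"
    then obtain i x where i: "i \<in> I" "x \<in> V i" "p = \<psi> i x" and l: "lab p = Inl v"
      by (auto simp: vertex_fibre_def atlas.M_def)
    from i(1) show "p \<in> {mk (Inl v) 0 0}"
    proof (cases rule: index_cases)
      case (E \<sigma> e)
      have "lab p = (if x = 0 then Inl (base \<sigma> e) else Inr e)" unfolding i(3) E(1) by (rule lab_EI[OF E(2)])
      then have "x = 0" "base \<sigma> e = v" using l by (auto split: if_splits)
      then show ?thesis using i(3) E(1) by (simp add: \<psi>.simps)
    next
      case (Q \<sigma> \<alpha> w)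
      from Q(2) i(2)[unfolded Q(1)] show ?thesis
        by (cases rule: Q_cases) (use l i(3) Q(1,2) v(2) in auto)
    qed
  qed
qed

lemma M_cases:
  assumes "p \<in> atlas.M"
  obtains (vert) v where "v \<in> verts G" "p \<in> vertex_fibre v" | (arc) e where "e \<in> arcs G" "p \<in> edge_piece e"
proof -
  obtain i x where i: "i \<in> I" "x \<in> V i" "p = \<psi> i x" using assms by (auto simp: atlas.M_def)
  from i(1) have "(\<exists>v\<in>verts G. lab p = Inl v) \<or> (\<exists>e\<in>arcs G. lab p = Inr e)"
  proof (cases rule: index_cases)
    case (E \<sigma> e)
    have "lab p = (if x = 0 then Inl (base \<sigma> e) else Inr e)" unfolding i(3) E(1) by (rule lab_EI[OF E(2)])
    then show ?thesis using E(2) base_in_verts by auto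
  next
    case (Q \<sigma> \<alpha> w)
    from Q(2) i(2)[unfolded Q(1)] show ?thesis
      by (cases rule: Q_cases) (use i(3) Q(1,2) interior_in_verts harcs_arcs in auto)
  qed
  then show ?thesis using that assms by (auto simp: vertex_fibre_def edge_piece_def)
qed

lemma f_vertex_fibre: "p \<in> vertex_fibre v \<Longrightarrow> f p = g v"
  by (simp add: vertex_fibre_def f_def)

lemma f_edge_piece:
  assumes e: "e \<in> arcs G" and p: "p \<in> edge_piece e"
  shows "g (tail G e) < f p" "f p < g (head G e)"
proof -
  obtain z where z: "z \<in> V (EI True e) - {0}" "p = \<psi> (EI True e) z" using p edge_piece_eq[OF e, of True] by auto
  have "f p = g (tail G e) + z \<bullet> z" using f_EI[OF e, of True z] z(2) by (simp add: base_def)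
  then show "g (tail G e) < f p" "f p < g (head G e)" using z(1) by (auto simp: V.simps len_def)
qed

lemma continuous_f: "continuous_map atlas.X euclideanreal f"
  by (rule atlas.continuous_map_from_X)
    (use smooth_f in \<open>auto simp: o_def intro: smooth_on_imp_continuous_on\<close>)

lemma open_edge_piece: "e \<in> arcs G \<Longrightarrow> openin atlas.X (edge_piece e)"
  using edge_piece_eq[of e True] atlas.openin_param_image[OF edge_index, of e "V (EI True e) - {0}" True] open_V[of "EI True e"]
  by (simp add: open_delete)

lemma DIM_ge_2: "2 \<le> DIM(real ^ 'n)"
  using card_ge_2 by simp

text \<open>The piece is a punctured ball, which is connected because the dimension is at least 2;
  the same bound makes the level spheres in it connected.\<close>

lemma connected_edge_piece:
  assumes e: "e \<in> arcs G"
  shows "connectedin atlas.X (edge_piece e)"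
  unfolding edge_piece_eq[OF e, of True]
proof (rule atlas.connectedin_param_image[OF edge_index[OF e]])
  have "V (EI True e) - {0} = ball 0 (sqrt (len e)) - {0}"
    by (auto simp: V.simps dist_norm norm_eq_sqrt_inner)
  then show "connectedin euclidean (V (EI True e) - {0})"
    using connected_punctured_ball[OF DIM_ge_2, of 0 "sqrt (len e)"] by simp
qed auto

lemma connected_fibre_edge_piece:
  assumes e: "e \<in> arcs G"
  shows "connectedin atlas.X {p \<in> edge_piece e. f p = t}"
proof (cases "g (tail G e) < t \<and> t < g (head G e)")
  case True
  let ?r = "sqrt (t - g (tail G e))"
  have S: "z \<in> sphere 0 ?r \<longleftrightarrow> z \<bullet> z = t - g (tail G e)" for z :: "real ^ 'n"
    using True by (simp add: norm_eq_sqrt_inner)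
  have "sphere 0 ?r \<subseteq> V (EI True e) - {0}"
    using True unfolding subset_iff S by (auto simp: V.simps len_def)
  moreover have "f (\<psi> (EI True e) z) = t \<longleftrightarrow> z \<in> sphere 0 ?r" for z
    unfolding S f_EI[OF e] by (auto simp: base_def)
  ultimately have "sphere 0 ?r = {z \<in> V (EI True e) - {0}. f (\<psi> (EI True e) z) = t}" by blast
  then have "{p \<in> edge_piece e. f p = t} = \<psi> (EI True e) ` sphere 0 ?r"
    unfolding edge_piece_eq[OF e, of True] by auto
  moreover have "connectedin euclidean (sphere (0 :: real ^ 'n) ?r)"
    using connected_sphere[OF DIM_ge_2, of 0 ?r] by simp
  ultimately show ?thesis
    using atlas.connectedin_param_image[OF edge_index[OF e], of "sphere 0 ?r" True] \<open>_ \<subseteq> _\<close> by auto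
next
  case False
  then have "{p \<in> edge_piece e. f p = t} = {}" using f_edge_piece[OF e] by auto
  then show ?thesis by (simp only: connectedin_empty)
qed

lemma edge_piece_nonempty: "e \<in> arcs G \<Longrightarrow> edge_piece e \<noteq> {}"
proof -
  assume e: "e \<in> arcs G"
  have "mk (Inr e) ((g (tail G e) + g (head G e)) / 2) b \<in> \<psi> (EI True e) ` (V (EI True e) - {0})"
    using g_gap[OF e] \<delta> by (intro edge_point_in_image[OF e]) auto
  then show ?thesis using edge_piece_eq[OF e] by blast
qed

lemma admissible_circle:
  assumes "\<eta> \<bullet> b = 0" "\<eta> \<bullet> \<eta> = 1"
  shows "admissible v \<theta> 0 (sqrt (\<phi> True v \<theta> * \<phi> False v \<theta>) *\<^sub>R \<eta>)"
  using assms \<delta> \<phi>_nonneg by (simp add: admissible_def h_def)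

text \<open>In the chart of side \<sigma> and cut \<alpha> the curve has axis coordinate
  \<open>lift \<alpha> \<theta>\<close> and
  \<open>y = sqrt (\<phi> \<sigma> v \<theta>) *\<^sub>R \<eta>\<close>, which is continuous. No
  single chart contains the curve, so the preimage of an open set is assembled from all sides and
  cuts.\<close>

lemma continuous_circle:
  assumes v: "interior_vert v" and \<eta>: "\<eta> \<bullet> b = 0" "\<eta> \<bullet> \<eta> = 1"
  shows "continuous_map euclideanreal atlas.X (\<lambda>\<theta>. N v \<theta> 0 (sqrt (\<phi> True v \<theta> * \<phi> False v \<theta>) *\<^sub>R \<eta>))"
    (is "continuous_map _ _ ?\<gamma>")
  unfolding continuous_map_def
proof (intro conjI allI impI)
  note T = admissible_circle[OF \<eta>]
  let ?w = "\<lambda>\<sigma> \<alpha> \<theta>. lift \<alpha> \<theta> *\<^sub>R b + sqrt (\<phi> \<sigma> v \<theta>) *\<^sub>R \<eta>"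
  have w: "?w \<sigma> \<alpha> \<theta> \<in> V (QI \<sigma> \<alpha> v) \<and> \<psi> (QI \<sigma> \<alpha> v) (?w \<sigma> \<alpha> \<theta>) = ?\<gamma> \<theta>"
    if h: "0 < \<phi> (\<not> \<sigma>) v \<theta>" and \<theta>: "\<theta> - \<alpha> \<notin> \<int>" for \<sigma> \<alpha> \<theta>
  proof -
    have h0: "h (\<not> \<sigma>) v \<theta> 0 = \<phi> (\<not> \<sigma>) v \<theta>" by (simp add: h_def)
    have "\<phi> True v \<theta> * \<phi> False v \<theta> = \<phi> (\<not> \<sigma>) v \<theta> * \<phi> \<sigma> v \<theta>" by (cases \<sigma>) auto
    then have "(1 / sqrt (\<phi> (\<not> \<sigma>) v \<theta>)) *\<^sub>R sqrt (\<phi> True v \<theta> * \<phi> False v \<theta>) *\<^sub>R \<eta> = sqrt (\<phi> \<sigma> v \<theta>) *\<^sub>R \<eta>"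
      using h by (simp add: real_sqrt_mult)
    with lift_witness[OF v T[of v \<theta>] _ \<theta>, of \<sigma>, unfolded h0, OF h] show ?thesis by (simp only:)
  qed
  show "?\<gamma> \<in> topspace euclideanreal \<rightarrow> topspace atlas.X"
  proof (rule funcsetI)
    fix \<theta> :: real
    show "?\<gamma> \<theta> \<in> topspace atlas.X"
      using N_in_M[OF v T[of v \<theta>]] vertex_index[OF v] unfolding atlas.topspace_X atlas.M_def by blast
  qed
  fix U assume U: "openin atlas.X U"
  let ?S = "\<lambda>\<sigma> \<alpha>. {\<theta>. 0 < \<phi> (\<not> \<sigma>) v \<theta>} \<inter> (\<lambda>\<theta>. \<theta> - \<alpha>) -` {x. x \<notin> \<int>}"
  let ?P = "\<lambda>\<sigma> \<alpha>. {z \<in> V (QI \<sigma> \<alpha> v). \<psi> (QI \<sigma> \<alpha> v) z \<in> U}"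
  have "\<theta> \<in> (\<Union>\<sigma>. \<Union>\<alpha>\<in>{0, 1/2}. ?S \<sigma> \<alpha> \<inter> ?w \<sigma> \<alpha> -` ?P \<sigma> \<alpha>)" if "?\<gamma> \<theta> \<in> U" for \<theta>
  proof -
    obtain \<sigma> where "0 < h (\<not> \<sigma>) v \<theta> 0" using ex_side[OF v] .
    then have h: "0 < \<phi> (\<not> \<sigma>) v \<theta>" by (simp add: h_def)
    obtain \<alpha> :: real where \<alpha>: "\<alpha> \<in> {0, 1/2}" "\<theta> - \<alpha> \<notin> \<int>" using ex_cut .
    have "\<theta> \<in> ?S \<sigma> \<alpha> \<inter> ?w \<sigma> \<alpha> -` ?P \<sigma> \<alpha>" using w[OF h \<alpha>(2)] that h \<alpha>(2) by simp
    then show ?thesis using \<alpha>(1) by blast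
  qed
  moreover have "?\<gamma> \<theta> \<in> U" if "\<theta> \<in> ?S \<sigma> \<alpha> \<inter> ?w \<sigma> \<alpha> -` ?P \<sigma> \<alpha>" for \<theta> \<sigma> \<alpha>
    using w[of \<sigma> \<theta> \<alpha>] that by simp
  ultimately have eq: "{\<theta> \<in> topspace euclideanreal. ?\<gamma> \<theta> \<in> U} =
      (\<Union>\<sigma>. \<Union>\<alpha>\<in>{0, 1/2}. ?S \<sigma> \<alpha> \<inter> ?w \<sigma> \<alpha> -` ?P \<sigma> \<alpha>)" by (simp only: topspace_euclidean) blast
  have "open (?S \<sigma> \<alpha> \<inter> ?w \<sigma> \<alpha> -` ?P \<sigma> \<alpha>)" if \<alpha>: "\<alpha> \<in> {0, 1/2}" for \<sigma> \<alpha>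
  proof -
    have S: "open (?S \<sigma> \<alpha>)"
      by (intro continuous_open_preimage open_not_Ints open_Collect_less continuous_intros)
    have "smooth_on (?S \<sigma> \<alpha>) (lift \<alpha>)"
      unfolding lift_def by (intro smooth_on_intros S) auto
    then have cont: "continuous_on (?S \<sigma> \<alpha>) (?w \<sigma> \<alpha>)"
      by (intro continuous_intros smooth_on_imp_continuous_on)
    have P: "open (?P \<sigma> \<alpha>)" using U vertex_index[OF v \<alpha>] by (simp add: atlas.openin_X)
    show ?thesis by (rule continuous_open_preimage[OF cont S P])
  qed
  then show "openin euclideanreal {\<theta> \<in> topspace euclideanreal. ?\<gamma> \<theta> \<in> U}"
    unfolding eq open_openin[symmetric] by (intro open_UN ballI)
qed

lemma ex_unit_orthogonal: obtains \<eta> :: "real ^ 'n" where "\<eta> \<bullet> b = 0" "\<eta> \<bullet> \<eta> = 1"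
proof -
  have "\<exists>j. j \<noteq> i0"
  proof (rule ccontr)
    assume "\<not> ?thesis"
    then have "UNIV = {i0}" by auto
    then have "CARD('n) = card {i0}" by (simp only:)
    then show False using card_ge_2 by simp
  qed
  then obtain j where "j \<noteq> i0" by blast
  then show ?thesis by (intro that[of "axis j 1"]) (auto simp: inner_axis_axis)
qed

text \<open>The zero level is swept out by closed curves, one for each unit vector \<eta> orthogonal
  to \<open>b\<close>. All of them pass through the point with \<open>\<theta> = 0\<close> and
  \<open>Y = 0\<close>, where \<open>\<phi> True v\<close> vanishes, so the union is connected even
  if there are only two choices of \<eta>.\<close>

lemma connected_vertex_fibre:
  assumes v: "v \<in> verts G"
  shows "connectedin atlas.X (vertex_fibre v)"
proof (cases "interior_vert v")
  case True
  let ?\<gamma> = "\<lambda>\<eta> \<theta>. N v \<theta> 0 (sqrt (\<phi> True v \<theta> * \<phi> False v \<theta>) *\<^sub>R \<eta>)"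
  let ?H = "{\<eta> :: real ^ 'n. \<eta> \<bullet> b = 0 \<and> \<eta> \<bullet> \<eta> = 1}"
  have "vertex_fibre v = (\<Union>\<eta>\<in>?H. range (?\<gamma> \<eta>))"
  proof
    show "(\<Union>\<eta>\<in>?H. range (?\<gamma> \<eta>)) \<subseteq> vertex_fibre v" unfolding vertex_fibre_interior[OF True] using admissible_circle by blast
    show "vertex_fibre v \<subseteq> (\<Union>\<eta>\<in>?H. range (?\<gamma> \<eta>))"
    proof
      fix p assume "p \<in> vertex_fibre v"
      then obtain \<theta> Y where p: "p = N v \<theta> 0 Y" "admissible v \<theta> 0 Y" unfolding vertex_fibre_interior[OF True] by blast
      have YY: "Y \<bullet> Y = \<phi> True v \<theta> * \<phi> False v \<theta>" and Yb: "Y \<bullet> b = 0" using p(2) by (auto simp: admissible_def h_def)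
      obtain \<eta>0 :: "real ^ 'n" where \<eta>0: "\<eta>0 \<bullet> b = 0" "\<eta>0 \<bullet> \<eta>0 = 1" using ex_unit_orthogonal .
      \<comment> \<open>At \<open>Y = 0\<close> any unit vector orthogonal to \<open>b\<close>
        serves; one exists because the dimension is at least 2.\<close>
      define \<eta> where "\<eta> = (if Y = 0 then \<eta>0 else (1 / sqrt (Y \<bullet> Y)) *\<^sub>R Y)"
      have "\<eta> \<in> ?H" using \<eta>0 Yb by (auto simp: \<eta>_def)
      moreover have "Y = sqrt (\<phi> True v \<theta> * \<phi> False v \<theta>) *\<^sub>R \<eta>" by (auto simp: \<eta>_def simp flip: YY)
      ultimately show "p \<in> (\<Union>\<eta>\<in>?H. range (?\<gamma> \<eta>))" using p(1) by blast
    qed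
  qed
  moreover have "connectedin atlas.X (\<Union>((\<lambda>\<eta>. range (?\<gamma> \<eta>)) ` ?H))"
  proof (rule connectedin_Union)
    fix S assume "S \<in> (\<lambda>\<eta>. range (?\<gamma> \<eta>)) ` ?H"
    then obtain \<eta> where \<eta>: "\<eta> \<bullet> b = 0" "\<eta> \<bullet> \<eta> = 1" "S = range (?\<gamma> \<eta>)" by auto
    show "connectedin atlas.X S" unfolding \<eta>(3)
      by (rule connectedin_continuous_map_image[OF continuous_circle[OF True \<eta>(1,2)]]) simp
  next
    have "\<phi> True v 0 = 0" by (simp add: \<phi>_def phase_def)
    then have "N v 0 0 0 \<in> range (?\<gamma> \<eta>)" for \<eta> by (intro range_eqI[of _ _ 0]) simp
    then have "N v 0 0 0 \<in> (\<Inter>\<eta>\<in>?H. range (?\<gamma> \<eta>))" by (intro INT_I)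
    then show "\<Inter>((\<lambda>\<eta>. range (?\<gamma> \<eta>)) ` ?H) \<noteq> {}" by (intro ex_in_conv[THEN iffD1] exI)
  qed
  ultimately show ?thesis by (simp only:)
next
  case False
  have "mk (Inl v) 0 0 \<in> atlas.M" using vertex_fibre_cap[OF v False] by (auto simp: vertex_fibre_def)
  then show ?thesis unfolding vertex_fibre_cap[OF v False] by (simp add: atlas.topspace_X)
qed

text \<open>The zero of \<open>\<phi> \<sigma> v\<close> at which the arc numbered \<open>k\<close>
  begins, taken with \<open>y = 0\<close>. It serves twice: as a critical point on the vertex fibre
  and as a limit of points of the edge.\<close>

lemma saddle_at_arm:
  assumes v: "interior_vert v" and e: "e \<in> harcs \<sigma> v"
  obtains \<alpha> z k where "\<alpha> \<in> {0, 1/2}" "z \<in> V (QI \<sigma> \<alpha> v)" "perp z = 0" "phase \<sigma> v (z \<bullet> b) = of_int k"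
    "armZ \<sigma> v k = e" "\<phi> \<sigma> v (z \<bullet> b) = 0" "\<psi> (QI \<sigma> \<alpha> v) z \<in> vertex_fibre v"
proof -
  obtain k where k: "armZ \<sigma> v k = e" using armZ_surj[OF v e] .
  define \<theta> where "\<theta> = (of_int k - (if \<sigma> then 0 else 1 / (2 * real (m True v)))) / real (m \<sigma> v)"
  have phase: "phase \<sigma> v \<theta> = of_int k" using m_pos[OF v, of \<sigma>] by (simp add: phase_def \<theta>_def)
  have \<phi>: "\<phi> \<sigma> v \<theta> = 0" using sin_sq_Ints[of "phase \<sigma> v \<theta>"] by (simp add: \<phi>_def phase)
  have pos: "0 < \<phi> (\<not> \<sigma>) v \<theta>" using \<phi>_sum_pos[OF v, of \<theta>] \<phi> by (cases \<sigma>) auto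
  have T: "admissible v \<theta> 0 0" using \<phi> \<delta> \<phi>_nonneg by (cases \<sigma>) (auto simp: admissible_def h_def)
  obtain \<alpha> :: real where \<alpha>: "\<alpha> \<in> {0, 1/2}" "\<theta> - \<alpha> \<notin> \<int>" using ex_cut .
  define z where "z = lift \<alpha> \<theta> *\<^sub>R b"
  have "0 < h (\<not> \<sigma>) v \<theta> 0" using pos by (simp add: h_def)
  note W = lift_witness[OF v T this \<alpha>(2), simplified, folded z_def]
  obtain j where j: "lift \<alpha> \<theta> = \<theta> + of_int j" using lift_shift .
  have zb: "z \<bullet> b = \<theta> + of_int j" by (simp add: z_def j)
  show ?thesis
  proof (rule that[OF \<alpha>(1) W(1)])
    show "perp z = 0" by (simp add: perp_def z_def)
    show "phase \<sigma> v (z \<bullet> b) = of_int (k + int (m \<sigma> v) * j)" unfolding zb phase_shift phase by simp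
    show "armZ \<sigma> v (k + int (m \<sigma> v) * j) = e" using k armZ_eq_iff[OF v, of \<sigma> k "k + int (m \<sigma> v) * j"] by simp
    show "\<phi> \<sigma> v (z \<bullet> b) = 0" unfolding zb \<phi>_shift by (rule \<phi>)
    show "\<psi> (QI \<sigma> \<alpha> v) z \<in> vertex_fibre v" unfolding W(2) vertex_fibre_interior[OF v] using T by blast
  qed
qed

lemma in_closure_param:
  assumes i: "i \<in> I" and z: "z \<in> V i"
    and lim: "\<And>U. open U \<Longrightarrow> z \<in> U \<Longrightarrow> U \<subseteq> V i \<Longrightarrow> \<exists>x\<in>U. \<psi> i x \<in> S"
  shows "\<psi> i z \<in> atlas.X closure_of S"
  unfolding in_closure_of
proof (intro conjI allI impI)
  show "\<psi> i z \<in> topspace atlas.X" using in_M[OF i z] by (simp add: atlas.topspace_X)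
  fix T assume T: "\<psi> i z \<in> T \<and> openin atlas.X T"
  then have "open {x \<in> V i. \<psi> i x \<in> T}" using i by (simp add: atlas.openin_X)
  then show "\<exists>y. y \<in> S \<and> y \<in> T" using lim[of "{x \<in> V i. \<psi> i x \<in> T}"] T z by auto
qed

text \<open>From the saddle at the start of its arc, a small step in \<theta> alone enters the edge.
  At a cap, the centre of the ball is a limit of the punctured ball.\<close>

lemma base_closure:
  assumes e: "e \<in> arcs G"
  shows "vertex_fibre (base \<sigma> e) \<inter> atlas.X closure_of edge_piece e \<noteq> {}"
proof (cases "interior_vert (base \<sigma> e)")
  case True
  let ?v = "base \<sigma> e"
  have "e \<in> harcs \<sigma> ?v" using e by (simp add: harcs_iff base_in_verts)
  from saddle_at_arm[OF True this] obtain \<alpha> z k where z: "\<alpha> \<in> {0, 1/2}" "z \<in> V (QI \<sigma> \<alpha> ?v)" "perp z = 0"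
    "phase \<sigma> ?v (z \<bullet> b) = of_int k" "armZ \<sigma> ?v k = e" "\<phi> \<sigma> ?v (z \<bullet> b) = 0" "\<psi> (QI \<sigma> \<alpha> ?v) z \<in> vertex_fibre ?v" .
  have "\<psi> (QI \<sigma> \<alpha> ?v) z \<in> atlas.X closure_of edge_piece e"
  proof (rule in_closure_param[OF vertex_index[OF True z(1)] z(2)])
    fix U assume U: "open U" "z \<in> U" "U \<subseteq> V (QI \<sigma> \<alpha> ?v)"
    obtain \<epsilon> where \<epsilon>: "0 < \<epsilon>" "ball z \<epsilon> \<subseteq> U" using U(1,2) open_contains_ball by blast
    have m: "0 < real (m \<sigma> ?v)" using m_pos[OF True] by simp
    \<comment> \<open>The first bound keeps the point in the ball; the second keeps the phase
      between \<open>k\<close> and \<open>k + 1\<close>, hence the point on the arm numbered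
      \<open>k\<close>.\<close>
    define t where "t = min (\<epsilon> / 2) (1 / (2 * real (m \<sigma> ?v)))"
    have t: "0 < t" "t < \<epsilon>" "real (m \<sigma> ?v) * t < 1"
      using \<epsilon>(1) m by (auto simp: t_def min_def field_simps)
    let ?x = "z + t *\<^sub>R b"
    have "?x \<in> U" using \<epsilon>(2) t(1,2) by (auto simp: dist_norm norm_eq_sqrt_inner[of b] subset_iff)
    then have xV: "?x \<in> V (QI \<sigma> \<alpha> ?v)" using U(3) by auto
    have xb: "?x \<bullet> b = z \<bullet> b + t" by (simp add: inner_add_left)
    have yx: "perp ?x = 0" using z(3) by (simp add: perp_def inner_add_left algebra_simps)
    have phase: "phase \<sigma> ?v (?x \<bullet> b) = of_int k + real (m \<sigma> ?v) * t"
      using z(4) unfolding xb by (simp add: phase_def algebra_simps)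
    have mt: "0 < real (m \<sigma> ?v) * t" using m t(1) by simp
    have fl: "\<lfloor>phase \<sigma> ?v (?x \<bullet> b)\<rfloor> = k" unfolding phase using mt t(3) by (intro floor_unique) auto
    have "0 < pi * (real (m \<sigma> ?v) * t)" "pi * (real (m \<sigma> ?v) * t) < pi" using mt t(3) by auto
    then have "sin (pi * (real (m \<sigma> ?v) * t)) \<noteq> 0" using sin_gt_zero by (metis less_irrefl)
    then have "0 < \<phi> \<sigma> ?v (?x \<bullet> b)"
      using sin_sq_shift[of "real (m \<sigma> ?v) * t" k] unfolding \<phi>_def phase by (simp add: add.commute)
    define s where "s = sg \<sigma> * (\<phi> \<sigma> ?v (?x \<bullet> b) - perp ?x \<bullet> perp ?x)"
    have s: "s \<noteq> 0" "(0 < s) = \<sigma>"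
      using \<open>0 < \<phi> \<sigma> ?v (?x \<bullet> b)\<close> unfolding s_def yx by (auto simp: sg_def)
    note Q = vertex_chart_admissible[OF True xV, folded s_def]
    have "lab (\<psi> (QI \<sigma> \<alpha> ?v) ?x) = Inr e"
      using N_point(2)[OF True Q(1) s(1)] s(2) z(5) unfolding Q(4) fl[symmetric] by simp
    then have "\<psi> (QI \<sigma> \<alpha> ?v) ?x \<in> edge_piece e" using in_M[OF vertex_index[OF True z(1)] xV] by (simp add: edge_piece_def)
    then show "\<exists>x\<in>U. \<psi> (QI \<sigma> \<alpha> ?v) x \<in> edge_piece e" using \<open>?x \<in> U\<close> by blast
  qed
  then show ?thesis using z(7) by blast
next
  case False
  have "\<psi> (EI \<sigma> e) 0 \<in> atlas.X closure_of edge_piece e"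
  proof (rule in_closure_param[OF edge_index[OF e] cap_point(1)[OF e False]])
    fix U assume U: "open U" "(0 :: real ^ 'n) \<in> U" "U \<subseteq> V (EI \<sigma> e)"
    have "U \<noteq> {0}" using U(1) not_open_singleton[of "0 :: real ^ 'n"] by auto
    then obtain x where "x \<in> U" "x \<noteq> 0" using U(2) by auto
    then show "\<exists>x\<in>U. \<psi> (EI \<sigma> e) x \<in> edge_piece e" using edge_piece_eq[OF e, of \<sigma>] U(3) by blast
  qed
  moreover have "\<psi> (EI \<sigma> e) 0 \<in> vertex_fibre (base \<sigma> e)"
    using vertex_fibre_cap[OF base_in_verts[OF e] False] cap_point(2)[OF e False] by simp
  ultimately show ?thesis by blast
qed

lemma vertex_fibre_critical:
  assumes v: "v \<in> verts G"
  shows "\<exists>p\<in>vertex_fibre v. critical_point atlas.A f p"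
proof -
  obtain \<sigma> e where e: "e \<in> harcs \<sigma> v" using ex_arc[OF v] .
  then have e': "e \<in> arcs G" "base \<sigma> e = v" using harcs_arcs by auto
  show ?thesis
  proof (cases "interior_vert v")
    case True
    from saddle_at_arm[OF True e] obtain \<alpha> z k where z: "\<alpha> \<in> {0, 1/2}" "z \<in> V (QI \<sigma> \<alpha> v)" "perp z = 0"
      "phase \<sigma> v (z \<bullet> b) = of_int k" "armZ \<sigma> v k = e" "\<phi> \<sigma> v (z \<bullet> b) = 0" "\<psi> (QI \<sigma> \<alpha> v) z \<in> vertex_fibre v" .
    have \<phi>': "\<phi>' \<sigma> v (z \<bullet> b) = 0" using z(6) by (simp add: \<phi>'_def \<phi>_def)
    have "2 * (- sg \<sigma>) * (z \<bullet> k) + sg \<sigma> * (\<phi>' \<sigma> v (z \<bullet> b) + 2 * (z \<bullet> b)) * (k \<bullet> b) = 0" for k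
    proof -
      have "z \<bullet> k = ((z \<bullet> b) *\<^sub>R b + perp z) \<bullet> k" by (simp only: decomp)
      also have "\<dots> = (z \<bullet> b) * (k \<bullet> b)" by (simp add: z(3) inner_commute[of b k])
      finally show ?thesis unfolding \<phi>' by simp
    qed
    then have "((\<lambda>x. f (\<psi> (QI \<sigma> \<alpha> v) x)) has_derivative (\<lambda>_. 0)) (at z)"
      using deriv_QI[OF True z(2)] by (simp only:)
    then show ?thesis using z(7) vertex_index[OF True z(1)] z(2) unfolding atlas.critical_point_A by blast
  next
    case False
    have "((\<lambda>x. f (\<psi> (EI \<sigma> e) x)) has_derivative (\<lambda>_. 0)) (at 0)"
      using deriv_EI[OF e'(1), of \<sigma> 0] by simp
    moreover have "\<psi> (EI \<sigma> e) 0 \<in> vertex_fibre v" using vertex_fibre_cap[OF v False] cap_point(2)[OF e'(1)] e'(2) False by simp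
    ultimately show ?thesis
      using edge_index[OF e'(1)] cap_point(1)[OF e'(1)] e'(2) False unfolding atlas.critical_point_A by blast
  qed
qed

lemma critical_in_vertex_fibre:
  assumes "critical_point atlas.A f p"
  shows "\<exists>v\<in>verts G. p \<in> vertex_fibre v"
proof -
  obtain i z where i: "i \<in> I" "z \<in> V i" "p = \<psi> i z" "((\<lambda>x. f (\<psi> i x)) has_derivative (\<lambda>_. 0)) (at z)"
    using assms unfolding atlas.critical_point_A by blast
  have p: "p \<in> atlas.M" using in_M i by simp
  from i(1) show ?thesis
  proof (cases rule: index_cases)
    case (E \<sigma> e)
    have "2 * sg \<sigma> * (z \<bullet> k) = 0" for k
      using has_derivative_unique[OF deriv_EI[OF E(2)] i(4)[unfolded E(1)]] by meson
    from this[of z] have "z = 0" by simp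
    then have "lab p = Inl (base \<sigma> e)" using lab_EI[OF E(2), of \<sigma> 0] i(3) E(1) by simp
    then show ?thesis using base_in_verts[OF E(2)] p by (auto simp: vertex_fibre_def)
  next
    case (Q \<sigma> \<alpha> v)
    note z = i(2)[unfolded Q(1)]
    note c = critical_QI[OF Q(2) z i(4)[unfolded Q(1)]]
    have "sg \<sigma> * (\<phi> \<sigma> v (z \<bullet> b) - perp z \<bullet> perp z) = 0" using c by (simp add: \<phi>_def)
    then have "lab p = Inl v"
      using N_point(1)[OF Q(2) vertex_chart_admissible(1)[OF Q(2) z]] vertex_chart_admissible(4)[OF Q(2) z] i(3) Q(1) by simp
    then show ?thesis using interior_in_verts[OF Q(2)] p by (auto simp: vertex_fibre_def)
  qed
qed

lemma vertex_fibre_nonempty: "v \<in> verts G \<Longrightarrow> vertex_fibre v \<noteq> {}"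
  using vertex_fibre_critical by blast

text \<open>The charts around the vertex are open, contain its fibre and stay inside the star;
  together with the open edges they fill it.\<close>

lemma open_star_vertex_fibre:
  assumes v: "v \<in> verts G"
  shows "openin atlas.X (vertex_fibre v \<union> (\<Union>e\<in>{e \<in> arcs G. tail G e = v \<or> head G e = v}. edge_piece e))"
    (is "openin _ (_ \<union> ?E)")
proof -
  have E: "openin atlas.X ?E" using open_edge_piece by auto
  have inc: "edge_piece e \<subseteq> ?E" if "e \<in> harcs \<rho> v" for e \<rho>
    using harcs_arcs[OF that] by (auto simp: base_def split: if_splits)
  obtain W where W: "openin atlas.X W" "vertex_fibre v \<subseteq> W" "W \<subseteq> vertex_fibre v \<union> ?E"
  proof (cases "interior_vert v")
    case True
    show ?thesis
    proof (rule that)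
      let ?W = "\<Union>\<sigma>. \<Union>\<alpha>\<in>{0, 1/2}. \<psi> (QI \<sigma> \<alpha> v) ` V (QI \<sigma> \<alpha> v)"
      have "openin atlas.X (\<psi> (QI \<sigma> \<alpha> v) ` V (QI \<sigma> \<alpha> v))" if "\<alpha> \<in> {0, 1/2}" for \<sigma> \<alpha>
        by (rule atlas.openin_param_image[OF vertex_index[OF True that] open_V subset_refl])
      then have "openin atlas.X U"
        if "U \<in> (\<lambda>(\<sigma>, \<alpha>). \<psi> (QI \<sigma> \<alpha> v) ` V (QI \<sigma> \<alpha> v)) ` (UNIV \<times> {0, 1/2})" for U
        using that by (elim imageE SigmaE) (simp only: prod.case)
      then have "openin atlas.X (\<Union>((\<lambda>(\<sigma>, \<alpha>). \<psi> (QI \<sigma> \<alpha> v) ` V (QI \<sigma> \<alpha> v)) ` (UNIV \<times> {0, 1/2})))"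
        by (rule openin_Union)
      also have "\<Union>((\<lambda>(\<sigma>, \<alpha>). \<psi> (QI \<sigma> \<alpha> v) ` V (QI \<sigma> \<alpha> v)) ` (UNIV \<times> {0, 1/2})) = ?W"
        unfolding UN_simps by auto
      finally show "openin atlas.X ?W" .
      show "vertex_fibre v \<subseteq> ?W"
      proof
        fix p assume "p \<in> vertex_fibre v"
        then obtain \<theta> Y where p: "p = N v \<theta> 0 Y" "admissible v \<theta> 0 Y" unfolding vertex_fibre_interior[OF True] by blast
        obtain \<sigma> \<alpha> where "\<alpha> \<in> {0, 1/2}" "p \<in> \<psi> (QI \<sigma> \<alpha> v) ` V (QI \<sigma> \<alpha> v)"
          using N_in_M[OF True p(2)] unfolding p(1) by (elim exE bexE)
        then show "p \<in> ?W" by (intro UN_I UNIV_I)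
      qed
      have "\<psi> (QI \<sigma> \<alpha> v) z \<in> vertex_fibre v \<union> ?E" if "\<alpha> \<in> {0, 1/2}" "z \<in> V (QI \<sigma> \<alpha> v)" for \<sigma> \<alpha> z
        using True that(2)
      proof (cases rule: Q_cases)
        case vert
        then show ?thesis using in_M[OF vertex_index[OF True that(1)] that(2)] by (simp add: vertex_fibre_def)
      next
        case (arc e \<rho>)
        then have "\<psi> (QI \<sigma> \<alpha> v) z \<in> edge_piece e"
          using in_M[OF vertex_index[OF True that(1)] that(2)] by (simp add: edge_piece_def)
        then show ?thesis using inc[OF arc(2)] by blast
      qed
      then show "?W \<subseteq> vertex_fibre v \<union> ?E" by blast
    qed
  next
    case False
    obtain \<sigma> e where e: "e \<in> harcs \<sigma> v" using ex_arc[OF v] .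
    then have e': "e \<in> arcs G" "base \<sigma> e = v" using harcs_arcs by auto
    have 0: "0 \<in> V (EI \<sigma> e)" "\<psi> (EI \<sigma> e) 0 = mk (Inl v) 0 0" using cap_point[OF e'(1)] e'(2) False by auto
    show ?thesis
    proof (rule that)
      show "openin atlas.X (\<psi> (EI \<sigma> e) ` V (EI \<sigma> e))"
        by (rule atlas.openin_param_image[OF edge_index[OF e'(1)] open_V]) simp
      show "vertex_fibre v \<subseteq> \<psi> (EI \<sigma> e) ` V (EI \<sigma> e)"
        using imageI[OF 0(1), of "\<psi> (EI \<sigma> e)"] unfolding vertex_fibre_cap[OF v False] 0(2) by simp
      have "\<psi> (EI \<sigma> e) ` V (EI \<sigma> e) \<subseteq> insert (\<psi> (EI \<sigma> e) 0) (edge_piece e)" using edge_piece_eq[OF e'(1), of \<sigma>] by auto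
      then show "\<psi> (EI \<sigma> e) ` V (EI \<sigma> e) \<subseteq> vertex_fibre v \<union> ?E"
        using inc[OF e] unfolding 0(2) vertex_fibre_cap[OF v False] by blast
    qed
  qed
  then have "vertex_fibre v \<union> ?E = W \<union> ?E" by blast
  then show ?thesis using W(1) E by auto
qed

sublocale reeb: reeb_partition G atlas.X atlas.A f vertex_fibre edge_piece g
proof
  show "topspace atlas.X = (\<Union>v\<in>verts G. vertex_fibre v) \<union> (\<Union>e\<in>arcs G. edge_piece e)"
    unfolding atlas.topspace_X by (auto elim: M_cases) (auto simp: vertex_fibre_def edge_piece_def)
qed (use continuous_f f_vertex_fibre f_edge_piece connected_vertex_fibre vertex_fibre_nonempty connected_edge_piece edge_piece_nonempty connected_fibre_edge_piece open_edge_piece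
    open_star_vertex_fibre base_closure[of _ True] base_closure[of _ False] critical_in_vertex_fibre vertex_fibre_critical
    in \<open>auto simp: vertex_fibre_def edge_piece_def base_def\<close>)


text \<open>Coordinates on the union of the charts around an interior vertex that separate its points.\<close>

definition "\<kappa> v p = (SOME c. \<exists>\<theta> s Y. admissible v \<theta> s Y \<and> N v \<theta> s Y = p \<and> c = (cos (2 * pi * \<theta>), sin (2 * pi * \<theta>), Y))"

lemma \<kappa>_N:
  assumes v: "interior_vert v" and T: "admissible v \<theta> s Y"
  shows "\<kappa> v (N v \<theta> s Y) = (cos (2 * pi * \<theta>), sin (2 * pi * \<theta>), Y)"
  unfolding \<kappa>_def
proof (rule some_equality)
  show "\<exists>\<theta>' s' Y'. admissible v \<theta>' s' Y' \<and> N v \<theta>' s' Y' = N v \<theta> s Y \<and>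
      (cos (2 * pi * \<theta>), sin (2 * pi * \<theta>), Y) = (cos (2 * pi * \<theta>'), sin (2 * pi * \<theta>'), Y')"
    using T by blast
  fix c
  assume "\<exists>\<theta>' s' Y'. admissible v \<theta>' s' Y' \<and> N v \<theta>' s' Y' = N v \<theta> s Y \<and> c = (cos (2 * pi * \<theta>'), sin (2 * pi * \<theta>'), Y')"
  then obtain \<theta>' s' Y' where c: "admissible v \<theta>' s' Y'" "N v \<theta>' s' Y' = N v \<theta> s Y"
    "c = (cos (2 * pi * \<theta>'), sin (2 * pi * \<theta>'), Y')" by blast
  note inj = N_inj[OF v c(1) T c(2)]
  obtain k where "\<theta>' = \<theta> + of_int k" using inj(3) by (auto elim!: Ints_cases simp: algebra_simps)
  then have "2 * pi * \<theta>' = 2 * pi * \<theta> + 2 * pi * of_int k" by (simp add: algebra_simps)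
  then have "sin (2 * pi * \<theta>') = sin (2 * pi * \<theta>) \<and> cos (2 * pi * \<theta>') = cos (2 * pi * \<theta>)"
    unfolding sin_cos_eq_iff by blast
  then show "c = (cos (2 * pi * \<theta>), sin (2 * pi * \<theta>), Y)" using c(3) inj(2) by simp
qed

text \<open>Cosine and sine determine \<theta> modulo 1, and \<open>Y\<close> is recorded as it is.
  The height is not recorded, which is why \<open>s\<close> is common to both points.\<close>

lemma \<kappa>_separates:
  assumes v: "interior_vert v" and T: "admissible v \<theta> s Y" "admissible v \<theta>' s Y'"
    and eq: "\<kappa> v (N v \<theta> s Y) = \<kappa> v (N v \<theta>' s Y')"
  shows "N v \<theta> s Y = N v \<theta>' s Y'"
proof -
  have Y: "Y = Y'" and "sin (2 * pi * \<theta>) = sin (2 * pi * \<theta>') \<and> cos (2 * pi * \<theta>) = cos (2 * pi * \<theta>')"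
    using eq unfolding \<kappa>_N[OF v T(1)] \<kappa>_N[OF v T(2)] by auto
  then obtain k :: int where "2 * pi * \<theta> = 2 * pi * \<theta>' + 2 * pi * of_int k" unfolding sin_cos_eq_iff by blast
  then have "2 * pi * \<theta> = 2 * pi * (\<theta>' + of_int k)" by (simp add: algebra_simps)
  then have "\<theta> = \<theta>' + of_int k" by simp
  then show ?thesis using Y N_shift[OF v] by simp
qed

definition "Qchart v = (\<Union>\<sigma>. \<Union>\<alpha>\<in>{0, 1/2}. \<psi> (QI \<sigma> \<alpha> v) ` V (QI \<sigma> \<alpha> v))"

lemma open_\<kappa>:
  assumes v: "interior_vert v" and B: "open B"
  shows "openin atlas.X {p \<in> Qchart v. \<kappa> v p \<in> B}"
proof -
  let ?k = "\<lambda>z. (cos (2 * pi * (z \<bullet> b)), sin (2 * pi * (z \<bullet> b)),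
      sqrt (\<phi> True v (z \<bullet> b) + \<phi> False v (z \<bullet> b) - perp z \<bullet> perp z) *\<^sub>R perp z)"
  have k: "\<kappa> v (\<psi> (QI \<sigma> \<alpha> v) z) = ?k z" if "z \<in> V (QI \<sigma> \<alpha> v)" for \<sigma> \<alpha> z
    unfolding vertex_chart_admissible(4)[OF v that] by (rule \<kappa>_N[OF v vertex_chart_admissible(1)[OF v that]])
  let ?U = "\<lambda>(\<sigma>, \<alpha>). \<psi> (QI \<sigma> \<alpha> v) ` (V (QI \<sigma> \<alpha> v) \<inter> ?k -` B)"
  have op: "open (V (QI \<sigma> \<alpha> v) \<inter> ?k -` B)" for \<sigma> \<alpha>
    by (intro continuous_open_preimage open_V B continuous_intros)
  have "openin atlas.X (\<psi> (QI \<sigma> \<alpha> v) ` (V (QI \<sigma> \<alpha> v) \<inter> ?k -` B))" if "\<alpha> \<in> {0, 1/2}" for \<sigma> \<alpha>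
    by (rule atlas.openin_param_image[OF vertex_index[OF v that] op]) simp
  then have "openin atlas.X U" if "U \<in> ?U ` (UNIV \<times> {0, 1/2})" for U
    using that by (elim imageE SigmaE) (simp only: prod.case)
  then have "openin atlas.X (\<Union>(?U ` (UNIV \<times> {0, 1/2})))" by (rule openin_Union)
  moreover have "{p \<in> Qchart v. \<kappa> v p \<in> B} = \<Union>(?U ` (UNIV \<times> {0, 1/2}))"
    unfolding Qchart_def using k by fastforce
  ultimately show ?thesis by simp
qed

lemma vertex_fibre_subset_Qchart: 
  assumes v: "interior_vert v"
  shows "vertex_fibre v \<subseteq> Qchart v"
proof
  fix p assume "p \<in> vertex_fibre v"
  then obtain \<theta> Y where p: "p = N v \<theta> 0 Y" "admissible v \<theta> 0 Y" unfolding vertex_fibre_interior[OF v] by blast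
  obtain \<sigma> \<alpha> where "\<alpha> \<in> {0, 1/2}" "p \<in> \<psi> (QI \<sigma> \<alpha> v) ` V (QI \<sigma> \<alpha> v)"
    using N_in_M[OF v p(2)] unfolding p(1) by (elim exE bexE)
  then show "p \<in> Qchart v" unfolding Qchart_def by (intro UN_I UNIV_I)
qed

section \<open>Separation of points\<close>

lemma separate_vertex_fibre:
  assumes v: "v \<in> verts G" and p: "p \<in> vertex_fibre v" "p' \<in> vertex_fibre v" "p \<noteq> p'"
  shows "\<exists>U W. openin atlas.X U \<and> openin atlas.X W \<and> p \<in> U \<and> p' \<in> W \<and> disjnt U W"
proof (cases "interior_vert v")
  case True
  have "\<kappa> v p \<noteq> \<kappa> v p'" using p \<kappa>_separates[OF True] unfolding vertex_fibre_interior[OF True] by blast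
  then obtain B B' where B: "open B" "open B'" "\<kappa> v p \<in> B" "\<kappa> v p' \<in> B'" "B \<inter> B' = {}"
    using hausdorff by metis
  show ?thesis
    using open_\<kappa>[OF True B(1)] open_\<kappa>[OF True B(2)] B(3,4,5) p vertex_fibre_subset_Qchart[OF True]
    by (intro exI[of _ "{p \<in> Qchart v. \<kappa> v p \<in> B}"] exI[of _ "{p \<in> Qchart v. \<kappa> v p \<in> B'}"])
      (auto simp: disjnt_def)
next
  case False
  then show ?thesis using p vertex_fibre_cap[OF v False] by simp
qed

lemma separate_edge_piece:
  assumes e: "e \<in> arcs G" and p: "p \<in> edge_piece e" "p' \<in> edge_piece e" "p \<noteq> p'"
  shows "\<exists>U W. openin atlas.X U \<and> openin atlas.X W \<and> p \<in> U \<and> p' \<in> W \<and> disjnt U W"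
proof -
  let ?V = "V (EI True e) - {0}"
  obtain z z' where z: "z \<in> ?V" "p = \<psi> (EI True e) z" "z' \<in> ?V" "p' = \<psi> (EI True e) z'"
    using p edge_piece_eq[OF e, of True] by blast
  then have "z \<noteq> z'" using p(3) by auto
  then obtain B B' where B: "open B" "open B'" "z \<in> B" "z' \<in> B'" "B \<inter> B' = {}" using hausdorff by metis
  have op: "open ?V" using open_V[of "EI True e"] by (rule open_delete)
  have "disjnt (\<psi> (EI True e) ` (?V \<inter> B)) (\<psi> (EI True e) ` (?V \<inter> B'))"
    using B(5) inj_edge_chart[OF e, of True] by (fastforce simp: disjnt_def dest: inj_onD)
  moreover have "openin atlas.X (\<psi> (EI True e) ` (?V \<inter> B))" "openin atlas.X (\<psi> (EI True e) ` (?V \<inter> B'))"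
    by (rule atlas.openin_param_image[OF edge_index[OF e]]; use op B in auto)+
  ultimately show ?thesis using z B(3,4) by blast
qed

text \<open>Points of different height are separated by the height. At equal height, different
  pieces have disjoint neighbourhoods: no edge joins two vertices of the same height, and an edge
  passing the height of \<open>v\<close> in its interior is not incident to \<open>v\<close>. Within
  one piece, coordinates separate.\<close>

lemma Hausdorff_X: "Hausdorff_space atlas.X"
  unfolding Hausdorff_space_def
proof (intro allI impI, elim conjE)
  fix p p' assume pp: "p \<in> topspace atlas.X" "p' \<in> topspace atlas.X" "p \<noteq> p'"
  let ?sep = "\<lambda>p p'. \<exists>U W. openin atlas.X U \<and> openin atlas.X W \<and> p \<in> U \<and> p' \<in> W \<and> disjnt U W"
  have sym: "?sep p p'" if "?sep p' p" for p p' using that by (metis disjnt_sym)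
  show "?sep p p'"
  proof (cases "f p = f p'")
    case False
    then obtain B B' where B: "open B" "open B'" "f p \<in> B" "f p' \<in> B'" "B \<inter> B' = {}" using hausdorff by metis
    have "openin atlas.X {x \<in> topspace atlas.X. f x \<in> S}" if "open S" for S
      using openin_continuous_map_preimage[OF continuous_f] that by simp
    then have "openin atlas.X {x \<in> topspace atlas.X. f x \<in> B}" "openin atlas.X {x \<in> topspace atlas.X. f x \<in> B'}"
      using B by auto
    moreover have "disjnt {x \<in> topspace atlas.X. f x \<in> B} {x \<in> topspace atlas.X. f x \<in> B'}"
      using B(5) by (auto simp: disjnt_def)
    ultimately show ?thesis using B(3,4) pp by blast
  next
    case True
    have FE: "?sep p p'" if "v \<in> verts G" "p \<in> vertex_fibre v" "e \<in> arcs G" "p' \<in> edge_piece e" "f p = f p'" for p p' v e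
    proof -
      have "g (tail G e) \<noteq> g v" "g (head G e) \<noteq> g v"
        using f_vertex_fibre[OF that(2)] f_edge_piece[OF that(3,4)] that(5) by auto
      then have "disjnt (vertex_fibre v \<union> (\<Union>e\<in>{e \<in> arcs G. tail G e = v \<or> head G e = v}. edge_piece e)) (edge_piece e)"
        by (auto simp: disjnt_def vertex_fibre_def edge_piece_def)
      then show ?thesis using open_star_vertex_fibre[OF that(1)] open_edge_piece[OF that(3)] that(2,4) by blast
    qed
    from pp(1) show ?thesis unfolding atlas.topspace_X
    proof (cases rule: M_cases)
      case (vert v)
      note p = this
      from pp(2) show ?thesis unfolding atlas.topspace_X
      proof (cases rule: M_cases)
        case (vert w)
        show ?thesis
        proof (cases "v = w")
          case True
          then show ?thesis using separate_vertex_fibre[OF p(1,2)] vert pp(3) by simp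
        next
          case False
          have "g v = g w" using f_vertex_fibre p(2) vert(2) \<open>f p = f p'\<close> by metis
          then have "\<not> (\<exists>e\<in>arcs G. {tail G e, head G e} = {v, w})"
            using g_gap \<delta> by (fastforce simp: doubleton_eq_iff)
          then have "disjnt (vertex_fibre v \<union> (\<Union>e\<in>{e \<in> arcs G. tail G e = v \<or> head G e = v}. edge_piece e))
              (vertex_fibre w \<union> (\<Union>e\<in>{e \<in> arcs G. tail G e = w \<or> head G e = w}. edge_piece e))"
            using False by (auto simp: disjnt_def vertex_fibre_def edge_piece_def)
          then show ?thesis using open_star_vertex_fibre[OF p(1)] open_star_vertex_fibre[OF vert(1)] p(2) vert(2) by blast
        qed
      next
        case (arc e)
        then show ?thesis using FE p True by blast
      qed
    next
      case (arc e)
      note p = this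
      from pp(2) show ?thesis unfolding atlas.topspace_X
      proof (cases rule: M_cases)
        case (vert w)
        then show ?thesis using sym[OF FE[OF vert p True[symmetric]]] by simp
      next
        case (arc e')
        show ?thesis
        proof (cases "e = e'")
          case True
          then show ?thesis using separate_edge_piece[OF p(1,2)] arc pp(3) by simp
        next
          case False
          then have "disjnt (edge_piece e) (edge_piece e')" by (auto simp: disjnt_def edge_piece_def)
          then show ?thesis using open_edge_piece[OF p(1)] open_edge_piece[OF arc(1)] p(2) arc(2) by blast
        qed
      qed
    qed
  qed
qed

text \<open>Compact parts of the chart domains that still cover the manifold. For the two cuts,
  windows of length 1/2 cover the circle; the smaller of the two factors is at most half of their
  sum; and the points dropped near the ends of an edge are covered from the vertex or cap
  there.\<close>

fun core :: "('v, 'e) chart_index \<Rightarrow> (real ^ 'n) set" where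
  "core (EI \<sigma> e) = {z. z \<bullet> z \<le> len e - \<delta> / 2} \<inter>
     (if interior_vert (base \<sigma> e) then {z. \<delta> / 2 \<le> z \<bullet> z} else UNIV)"
| "core (QI \<sigma> \<alpha> v) = {z. \<alpha> + 1/4 \<le> z \<bullet> b \<and> z \<bullet> b \<le> \<alpha> + 3/4 \<and>
     2 * (perp z \<bullet> perp z) \<le> \<phi> True v (z \<bullet> b) + \<phi> False v (z \<bullet> b) \<and> \<bar>\<phi> \<sigma> v (z \<bullet> b) - perp z \<bullet> perp z\<bar> \<le> \<delta> / 2}"

declare core.simps [simp del]

lemma core_subset_V:
  assumes "i \<in> I"
  shows "core i \<subseteq> V i"
  using assms
proof (cases rule: index_cases)
  case (E \<sigma> e)
  then show ?thesis using \<delta> by (auto simp: core.simps V.simps)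
next
  case (Q \<sigma> \<alpha> v)
  show ?thesis
  proof
    fix z assume "z \<in> core i"
    then show "z \<in> V i" using \<phi>_sum_pos[OF Q(2), of "z \<bullet> b"] \<delta>(1) unfolding Q(1) by (auto simp: core.simps V.simps)
  qed
qed

lemma compact_core: "compact (core i)"
proof (cases i)
  case (EI \<sigma> e)
  have "bounded (core i)"
  proof (rule boundedI)
    fix z assume "z \<in> core i"
    then have "z \<bullet> z \<le> len e - \<delta> / 2" by (simp add: EI core.simps)
    then show "norm z \<le> sqrt (len e - \<delta> / 2)" by (simp add: norm_eq_sqrt_inner)
  qed
  moreover have "closed (core i)"
    unfolding EI core.simps by (cases "interior_vert (base \<sigma> e)") (auto intro!: closed_Int closed_Collect_le continuous_intros)
  ultimately show ?thesis by (simp add: compact_eq_bounded_closed)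
next
  case (QI \<sigma> \<alpha> v)
  have "bounded (core i)"
  proof (rule boundedI)
    fix z assume z: "z \<in> core i"
    have "norm ((z \<bullet> b) *\<^sub>R b) = \<bar>z \<bullet> b\<bar>" by (simp add: norm_eq_sqrt_inner[of b])
    moreover have "norm (perp z) \<le> 1"
      using z \<phi>_le_1[of True v "z \<bullet> b"] \<phi>_le_1[of False v "z \<bullet> b"]
      by (simp add: QI core.simps norm_eq_sqrt_inner)
    moreover have "\<bar>z \<bullet> b\<bar> \<le> \<bar>\<alpha>\<bar> + 1" using z by (auto simp: QI core.simps)
    ultimately have "norm ((z \<bullet> b) *\<^sub>R b + perp z) \<le> \<bar>\<alpha>\<bar> + 1 + 1" by (intro norm_triangle_le) simp
    then show "norm z \<le> \<bar>\<alpha>\<bar> + 1 + 1" by (simp only: decomp)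
  qed
  moreover have "closed (core i)"
    unfolding QI core.simps by (intro closed_Collect_conj closed_Collect_le continuous_intros)
  ultimately show ?thesis by (simp add: compact_eq_bounded_closed)
qed

definition "core_points = (\<Union>i\<in>I. \<psi> i ` core i)"

lemma core_pointI: "i \<in> I \<Longrightarrow> z \<in> core i \<Longrightarrow> \<psi> i z \<in> core_points"
  by (auto simp: core_points_def)

lemma N_in_core_points:
  assumes v: "interior_vert v" and T: "admissible v \<theta> s Y" and s: "\<bar>s\<bar> \<le> \<delta> / 2"
  shows "N v \<theta> s Y \<in> core_points"
proof -
  \<comment> \<open>With the smaller factor as \<open>h \<sigma>\<close>, the value
    \<open>|y|^2\<close> is at most half of the sum and the opposite factor is positive.\<close>
  define \<sigma> where "\<sigma> = (h True v \<theta> s \<le> h False v \<theta> s)"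
  have le: "h \<sigma> v \<theta> s \<le> h (\<not> \<sigma>) v \<theta> s" 
    by (cases "h True v \<theta> s \<le> h False v \<theta> s") (simp_all add: \<sigma>_def)
  have sum: "h \<sigma> v \<theta> s + h (\<not> \<sigma>) v \<theta> s = \<phi> True v \<theta> + \<phi> False v \<theta>" by (rule h_sum)
  then have pos: "0 < h (\<not> \<sigma>) v \<theta> s" using le \<phi>_sum_pos[OF v, of \<theta>] by linarith
  \<comment> \<open>A fractional part outside the middle half of the unit interval is moved into it
    by a half turn.\<close>
  obtain \<alpha> :: real where \<alpha>: "\<alpha> \<in> {0, 1/2}" "1/4 \<le> frac (\<theta> - \<alpha>)" "frac (\<theta> - \<alpha>) \<le> 3/4"
  proof (cases "1/4 \<le> frac \<theta> \<and> frac \<theta> \<le> 3/4")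
    case True
    then show ?thesis using that[of 0] by simp
  next
    case False
    have "0 \<le> frac \<theta>" "frac \<theta> < 1" by (simp_all add: frac_lt_1)
    then consider "frac \<theta> < 1/4" "frac (\<theta> - 1/2) = frac \<theta> + 1/2" | "3/4 < frac \<theta>" "frac (\<theta> - 1/2) = frac \<theta> - 1/2"
    proof -
      have *: "frac (\<theta> - 1/2) = r" if "0 \<le> r" "r < 1" "\<theta> - 1/2 - r \<in> \<int>" for r
        using that frac_unique_iff by blast
      have 1: "\<theta> - frac \<theta> \<in> \<int>" by (simp add: frac_def)
      consider "frac \<theta> < 1/4" | "3/4 < frac \<theta>" using False by linarith
      then show thesis
      proof cases
        case 1
        have "\<theta> - 1/2 - (frac \<theta> + 1/2) = of_int (\<lfloor>\<theta>\<rfloor> - 1)" by (simp add: frac_def)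
        then have "frac (\<theta> - 1/2) = frac \<theta> + 1/2" using 1 by (intro *) (auto simp: add_nonneg_nonneg)
        then show thesis using that(1) 1 by blast
      next
        case 2
        have "\<theta> - 1/2 - (frac \<theta> - 1/2) = of_int \<lfloor>\<theta>\<rfloor>" by (simp add: frac_def)
        then have "frac (\<theta> - 1/2) = frac \<theta> - 1/2" using 2 \<open>frac \<theta> < 1\<close> by (intro *) auto
        then show thesis using that(2) 2 by blast
      qed
    qed
    then show ?thesis using \<open>0 \<le> frac \<theta>\<close> \<open>frac \<theta> < 1\<close> by (cases; intro that[of "1/2"]) auto
  qed
  have \<theta>: "\<theta> - \<alpha> \<notin> \<int>" using \<alpha>(2) by (auto simp flip: frac_eq_0_iff)
  define z where "z = lift \<alpha> \<theta> *\<^sub>R b + (1 / sqrt (h (\<not> \<sigma>) v \<theta> s)) *\<^sub>R Y"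
  note W = lift_witness[OF v T pos \<theta>, folded z_def]
  have zb: "z \<bullet> b = lift \<alpha> \<theta>" and yz: "perp z = (1 / sqrt (h (\<not> \<sigma>) v \<theta> s)) *\<^sub>R Y"
    using admissibleD(1)[OF T] unfolding z_def by (subst compose_b; simp)+
  obtain k where k: "lift \<alpha> \<theta> = \<theta> + of_int k" using lift_shift .
  have yy: "perp z \<bullet> perp z = h \<sigma> v \<theta> s" using admissibleD(4)[OF T, of \<sigma>] pos by (simp add: yz field_simps)
  have \<phi>: "\<phi> \<rho> v (z \<bullet> b) = \<phi> \<rho> v \<theta>" for \<rho> unfolding zb k \<phi>_shift ..
  have "\<bar>\<phi> \<sigma> v \<theta> - h \<sigma> v \<theta> s\<bar> = \<bar>s\<bar>" by (simp add: h_def)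
  then have "z \<in> core (QI \<sigma> \<alpha> v)"
    unfolding core.simps mem_Collect_eq \<phi> yy using \<alpha>(2,3) le sum s by (simp add: zb lift_def)
  then show ?thesis using core_pointI[OF vertex_index[OF v \<alpha>(1)]] W(2) by metis
qed

lemma end_in_core_points:
  assumes e: "e \<in> arcs G" and z: "z \<in> V (EI \<sigma> e)" "z \<bullet> z \<le> \<delta> / 2"
  shows "\<psi> (EI \<sigma> e) z \<in> core_points"
proof (cases "interior_vert (base \<sigma> e)")
  case True
  have "e \<in> harcs \<sigma> (base \<sigma> e)" using e by (simp add: harcs_iff base_in_verts)
  then obtain k where k: "armZ \<sigma> (base \<sigma> e) k = e" using armZ_surj[OF True] by blast
  have "z \<noteq> 0" using z(1) True by (simp add: V.simps)
  then have "0 < z \<bullet> z" "z \<bullet> z < \<delta>" using z(2) \<delta> by auto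
  note P = arm_param[OF True this k]
  have "\<bar>sg \<sigma> * (z \<bullet> z)\<bar> \<le> \<delta> / 2" using z(2) by simp
  from N_in_core_points[OF True P(2) this] show ?thesis unfolding P(4) .
next
  case False
  have "z \<in> core (EI \<sigma> e)" using False z(2) len_ge[OF e] \<delta> by (simp add: core.simps)
  then show ?thesis by (rule core_pointI[OF edge_index[OF e]])
qed

lemma M_eq_core_points: "atlas.M = core_points"
proof
  show "core_points \<subseteq> atlas.M" using core_subset_V unfolding core_points_def atlas.M_def by blast
  show "atlas.M \<subseteq> core_points"
  proof
    fix p assume "p \<in> atlas.M"
    then show "p \<in> core_points"
    proof (cases rule: M_cases)
      case (vert v)
      show ?thesis
      proof (cases "interior_vert v")
        case True
        then show ?thesis using vert(2) N_in_core_points[OF True] \<delta> unfolding vertex_fibre_interior[OF True] by auto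
      next
        case False
        obtain \<sigma> e where "e \<in> harcs \<sigma> v" using ex_arc[OF vert(1)] .
        then have e: "e \<in> arcs G" "base \<sigma> e = v" using harcs_arcs by auto
        have "p = \<psi> (EI \<sigma> e) 0" using vert(2) vertex_fibre_cap[OF vert(1) False] cap_point(2)[OF e(1)] e(2) False by simp
        then show ?thesis using end_in_core_points[OF e(1) cap_point(1)[OF e(1)]] e(2) False \<delta> by simp
      qed
    next
      case (arc e)
      obtain z where z: "z \<in> V (EI True e)" "z \<noteq> 0" "p = \<psi> (EI True e) z"
        using arc(2) edge_piece_eq[OF arc(1), of True] by blast
      note fl = edge_chart_flip[OF arc(1) z(1,2)]
      consider "z \<bullet> z \<le> \<delta> / 2" | "len e - \<delta> / 2 \<le> z \<bullet> z" | "\<delta> / 2 \<le> z \<bullet> z" "z \<bullet> z \<le> len e - \<delta> / 2"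
        by linarith
      then show ?thesis
      proof cases
        case 1
        then show ?thesis using end_in_core_points[OF arc(1) z(1)] z(3) by simp
      next
        case 2
        let ?z = "(sqrt (len e - z \<bullet> z) / sqrt (z \<bullet> z)) *\<^sub>R z"
        have "0 < z \<bullet> z" "0 < len e - z \<bullet> z" using z by (auto simp: V.simps)
        then have "?z \<bullet> ?z = len e - z \<bullet> z" by (simp add: field_simps)
        then have "?z \<bullet> ?z \<le> \<delta> / 2" using 2 by linarith
        from end_in_core_points[OF arc(1) fl(1) this] show ?thesis using fl(2) z(3) by simp
      next
        case 3
        then have "z \<in> core (EI True e)" by (simp add: core.simps)
        then show ?thesis using core_pointI[OF edge_index[OF arc(1)]] z(3) by blast
      qed
    qed
  qed
qed

lemma compact_X: "compact_space atlas.X"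
proof -
  have "compactin atlas.X (\<Union>((\<lambda>i. \<psi> i ` core i) ` I))"
  proof (rule compactin_Union)
    fix S assume "S \<in> (\<lambda>i. \<psi> i ` core i) ` I"
    then show "compactin atlas.X S"
      using atlas.compactin_param_image[OF _ compact_core core_subset_V] by blast
  qed (use finite_I in auto)
  then show ?thesis using M_eq_core_points by (simp add: compact_space_def core_points_def atlas.topspace_X)
qed

lemma closed_manifold_with_reeb_graph:
  assumes "Digraph_Component.connected G"
  shows "closed_connected_manifold atlas.X atlas.A \<and> morse_function atlas.A f \<and>
    digraph_iso (reeb_graph atlas.X atlas.A f) G"
proof -
  have ne: "verts G \<noteq> {}" and reach: "\<And>u v. u \<in> verts G \<Longrightarrow> v \<in> verts G \<Longrightarrow> u \<rightarrow>\<^sup>*\<^bsub>mk_symmetric G\<^esub> v"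
    using assms by (auto simp: connected_def strongly_connected_def)
  have "connected_space atlas.X"
  proof (rule reeb.connected_space_X)
    fix S assume S: "S \<subseteq> verts G" "S \<noteq> {}" "\<And>e. e \<in> arcs G \<Longrightarrow> tail G e \<in> S \<longleftrightarrow> head G e \<in> S"
    obtain u where u: "u \<in> S" using S(2) by blast
    have "w \<in> S" if "u \<rightarrow>\<^sup>*\<^bsub>mk_symmetric G\<^esub> w" for w
      using that unfolding reachable_def
    proof (induction rule: rtrancl_on_induct)
      case (step y z)
      then show ?case using S(3) by (auto simp: arcs_ends_conv parcs_mk_symmetric)
    qed (rule u)
    then show "S = verts G" using reach u S(1) by blast
  qed
  moreover have "topspace atlas.X \<noteq> {}"
    using ne vertex_fibre_nonempty unfolding atlas.topspace_X vertex_fibre_def by blast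
  ultimately show ?thesis
    using Hausdorff_X atlas.second_countable_X compact_X atlas.smooth_atlas_A morse_f
      reeb.digraph_iso_reeb_graph by (simp add: closed_connected_manifold_def)
qed

end

text \<open>If no edge leaves \<open>v\<close>, then \<open>g\<close> is at most its value at
  \<open>v\<close> on the whole open star, so \<open>v\<close> is a local maximum and has degree one
  by \<open>ext\<close>; if no edge enters, it is a local minimum.\<close>

lemma good_orientation_degrees:
  fixes G :: "('v, 'e) pre_digraph"
  assumes G: "fin_digraph G" and ind: "induces_orientation g G"
    and ext: "\<And>x. local_extremum (realization G) g x \<Longrightarrow>
      \<exists>v\<in>verts G. x = Inl v \<and> in_degree G v + out_degree G v = 1"
  shows "e \<in> arcs G \<Longrightarrow> g (Inl (tail G e)) < g (Inl (head G e))"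
    and "v \<in> verts G \<Longrightarrow> out_arcs G v \<noteq> {} \<and> in_arcs G v \<noteq> {} \<or> in_degree G v + out_degree G v = 1"
proof -
  interpret fin_digraph G by (rule G)
  have mono: "strict_mono_on {0..1} (\<lambda>t. g (edge_point G e t))" if "e \<in> arcs G" for e
    using ind that by (simp add: induces_orientation_def)
  have end_less: "g (Inl (tail G e)) < g (edge_point G e t)" if "e \<in> arcs G" "0 < t" "t \<le> 1" for e t
    using strict_mono_onD[OF mono[OF that(1)], of 0 t] that by (simp add: edge_point_def)
  have less_end: "g (edge_point G e t) < g (Inl (head G e))" if "e \<in> arcs G" "0 \<le> t" "t < 1" for e t
    using strict_mono_onD[OF mono[OF that(1)], of t 1] that by (simp add: edge_point_def)
  show lt: "g (Inl (tail G e)) < g (Inl (head G e))" if "e \<in> arcs G" for e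
    using end_less[OF that, of 1] by (simp add: edge_point_def)
  assume v: "v \<in> verts G"
  \<comment> \<open>Whole open edges can be used, since \<open>g\<close> is strictly monotonic along
    all of an edge.\<close>
  let ?U = "insert (Inl v) {Inr (e, t) | e t. e \<in> arcs G \<and> 0 < t \<and> t < 1 \<and> (tail G e = v \<or> head G e = v)}"
  have U: "openin (realization G) ?U"
    unfolding openin_realization
  proof (intro conjI ballI)
    show "?U \<subseteq> realization_points G" using v by (auto simp: realization_points_def)
    fix e assume e: "e \<in> arcs G"
    \<comment> \<open>The strict increase excludes loops, so \<open>?U\<close> contains at most one
      end of each edge.\<close>
    have ne: "tail G e \<noteq> head G e" using lt[OF e] by auto
    have "{t \<in> {0..1}. edge_point G e t \<in> ?U} = {0..1} \<inter>
        (if tail G e = v then {..<1} else if head G e = v then {0<..} else {})"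
      using e ne by (auto simp: edge_point_def split: if_splits)
    then show "openin (top_of_set {0..1}) {t \<in> {0..1}. edge_point G e t \<in> ?U}"
      by (auto simp: openin_open)
  qed
  have pt: "edge_point G e t = Inr (e, t)" if "0 < t" "t < 1" for e t
    using that by (simp add: edge_point_def)
  show "out_arcs G v \<noteq> {} \<and> in_arcs G v \<noteq> {} \<or> in_degree G v + out_degree G v = 1"
  proof (cases "out_arcs G v = {} \<or> in_arcs G v = {}")
    case True
    then have "(\<forall>y\<in>?U. g (Inl v) \<le> g y) \<or> (\<forall>y\<in>?U. g y \<le> g (Inl v))"
    proof
      assume out: "out_arcs G v = {}"
      have "g y \<le> g (Inl v)" if y: "y \<in> ?U" for y
      proof -
        consider "y = Inl v" | e t where "e \<in> arcs G" "0 < t" "t < 1" "y = Inr (e, t)" "tail G e = v \<or> head G e = v"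
          using y by blast
        then show ?thesis
        proof cases
          case (2 e t)
          then have "head G e = v" using out by (auto simp: out_arcs_def)
          then show ?thesis using less_end[OF 2(1), of t] 2 by (simp add: pt)
        qed simp
      qed
      then show ?thesis by blast
    next
      assume in0: "in_arcs G v = {}"
      have "g (Inl v) \<le> g y" if y: "y \<in> ?U" for y
      proof -
        consider "y = Inl v" | e t where "e \<in> arcs G" "0 < t" "t < 1" "y = Inr (e, t)" "tail G e = v \<or> head G e = v"
          using y by blast
        then show ?thesis
        proof cases
          case (2 e t)
          then have "tail G e = v" using in0 by (auto simp: in_arcs_def)
          then show ?thesis using end_less[OF 2(1), of t] 2 by (simp add: pt)
        qed simp
      qed
      then show ?thesis by blast
    qed
    moreover have "Inl v \<in> topspace (realization G)" using v by (simp add: realization_points_def)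
    ultimately have "local_extremum (realization G) g (Inl v)"
      using U unfolding local_extremum_def by blast
    then show ?thesis using ext by blast
  qed blast
qed

theorem theorem4p3:
  fixes \<Gamma> :: "('v, 'e) pre_digraph"
  assumes "fin_digraph \<Gamma>"
    and "Digraph_Component.connected \<Gamma>"
    and "good_orientation \<Gamma>"
    and "CARD('n::finite) \<ge> 2"
  shows "\<exists>(M :: (nat \<Rightarrow> real) topology) (A :: (nat \<Rightarrow> real, 'n) chart set)
           (f :: (nat \<Rightarrow> real) \<Rightarrow> real).
           closed_connected_manifold M A \<and> morse_function A f \<and>
           digraph_iso (reeb_graph M A f) \<Gamma>"
proof -
  interpret fin_digraph \<Gamma> by (rule assms(1))
  obtain g0 where "induces_orientation g0 \<Gamma>" "\<And>x. local_extremum (realization \<Gamma>) g0 x \<Longrightarrow>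
      \<exists>v\<in>verts \<Gamma>. x = Inl v \<and> in_degree \<Gamma> v + out_degree \<Gamma> v = 1"
    using assms(3) unfolding good_orientation_def by blast
  note deg = good_orientation_degrees[OF assms(1) this]
  define g where "g v = g0 (Inl v)" for v
  \<comment> \<open>Half of the least height difference along an edge, capped at 1/2; the inserted
    1/2 also keeps the set nonempty.\<close>
  define \<delta> where "\<delta> = Min (insert (1/2) ((\<lambda>e. (g (head \<Gamma> e) - g (tail \<Gamma> e)) / 2) ` arcs \<Gamma>))"
  have "0 < \<delta>" using deg(1) by (auto simp: \<delta>_def g_def)
  moreover have "\<delta> \<le> 1/2" unfolding \<delta>_def by (intro Min_le) auto
  ultimately have \<delta>: "0 < \<delta>" "\<delta> \<le> 1/2" .
  have gap: "g (tail \<Gamma> e) + 2 * \<delta> \<le> g (head \<Gamma> e)" if "e \<in> arcs \<Gamma>" for e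
  proof -
    have "\<delta> \<le> (g (head \<Gamma> e) - g (tail \<Gamma> e)) / 2" unfolding \<delta>_def using that by (intro Min_le) auto
    then show ?thesis by simp
  qed
  define L :: "('v + 'e) set" where "L = Inl ` verts \<Gamma> \<union> Inr ` arcs \<Gamma>"
  have "finite L" by (simp add: L_def)
  then obtain c :: "'v + 'e \<Rightarrow> nat" where c: "inj_on c L" using finite_imp_inj_to_nat_seg by blast
  define ix where "ix = from_nat_into (UNIV :: 'n set)"
  have ix: "surj ix" unfolding ix_def by (intro range_from_nat_into) auto
  \<comment> \<open>Entry 0 is the number of the label, entry 1 the real parameter, and the rest
    lists the coordinates of the vector along the surjection \<open>ix\<close>, so all three can be
    read back.\<close>
  define mk :: "'v + 'e \<Rightarrow> real \<Rightarrow> real ^ 'n \<Rightarrow> nat \<Rightarrow> real"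
    where "mk l t x = case_nat (real (c l)) (case_nat t (\<lambda>k. x $ ix k))" for l t x
  define lab where "lab p = inv_into L c (nat \<lfloor>p 0\<rfloor>)" for p :: "nat \<Rightarrow> real"
  define hgt where "hgt p = p 1" for p :: "nat \<Rightarrow> real"
  define vec :: "(nat \<Rightarrow> real) \<Rightarrow> real ^ 'n" where "vec p = (\<chi> i. p (Suc (Suc (inv ix i))))" for p
  interpret C: reeb_construction \<Gamma> g \<delta> "SOME i :: 'n. True" mk lab hgt vec
  proof
    fix l t and x :: "real ^ 'n" assume l: "l \<in> Inl ` verts \<Gamma> \<union> Inr ` arcs \<Gamma>"
    show "lab (mk l t x) = l" using c l by (simp add: lab_def mk_def L_def)
    show "hgt (mk l t x) = t" by (simp add: hgt_def mk_def)
    show "vec (mk l t x) = x" by (simp add: vec_def mk_def vec_eq_iff surj_f_inv_f[OF ix])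
  qed (use \<delta> gap deg(2) assms(4) in auto)
  show ?thesis using C.closed_manifold_with_reeb_graph[OF assms(2)] by blast
qed

end
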